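(* Let $\mathscr{F}$ range over down-closed families. If the $\mathscr{F}$-PCF problem can be solved efficiently (in polynomial time) for any sub-partition $\mathscr{P}$, then the $\mathscr{F}$-supplier problem has a polynomial time $3$-approximation algorithm. Otherwise, there is no non-trivial (polynomial time) approximation algorithm for the $\mathscr{F}$-supplier problem.
   Context: $\mathscr{F}$-supplier problem: given a finite set $X=F\cup C$ with metric $d$ and a down-closed family $\mathscr{F}\subseteq2^F$ (closed under taking subsets), find $S\in\mathscr{F}$ minimizing $\max_{v\in C}d(v,S)$, where $d(v,S)=\min_{u\in S}d(v,u)$; let $\mathrm{OPT}$ be the optimum. A $\alpha$-approximation returns $S\in\mathscr{F}$ with $\max_{v\in C}d(v,S)\le\alpha\,\mathrm{OPT}$; it is non-trivial if $\alpha$ is finite. $\mathscr{F}$-PCF problem: given $(F,\mathscr{F},\mathscr{P})$ with $\mathscr{F}\subseteq2^F$ down-closed and $\mathscr{P}$ an arbitrary sub-partition of $F$ (a collection of pairwise disjoint subsets of $F$), decide whether there exists $S\in\mathscr{F}$ with $|S\cap A|=1$ for every $A\in\mathscr{P}$. *)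

theory Defs
  imports
    "HOL-Analysis.Analysis"
    "HOL-Computational_Algebra.Polynomial"
    "HOL-Library.Discrete_Functions"
begin

section \<open>Down-closed families, the PCF problem and the supplier problem\<close>

definition down_closed :: "'a set \<Rightarrow> 'a set set \<Rightarrow> bool" where
  "down_closed F \<F> \<longleftrightarrow> \<F> \<subseteq> Pow F \<and> (\<forall>S\<in>\<F>. \<forall>T. T \<subseteq> S \<longrightarrow> T \<in> \<F>)"

definition sub_partition :: "'a set \<Rightarrow> 'a set set \<Rightarrow> bool" where
  "sub_partition F P \<longleftrightarrow> P \<subseteq> Pow F \<and> pairwise disjnt P"

definition pcf :: "'a set set \<Rightarrow> 'a set set \<Rightarrow> bool" where
  "pcf \<F> P \<longleftrightarrow> (\<exists>S\<in>\<F>. \<forall>A\<in>P. card (S \<inter> A) = 1)"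

text \<open>
  In \<open>ennreal\<close>, the distance to the empty set is \<open>\<infinity>\<close>, and the maximum over an empty
  set of clients is \<open>0\<close>.  All sets below are finite, so that \<open>INF\<close> and \<open>SUP\<close> are minimum and
  maximum otherwise.
\<close>

definition set_distance :: "('a \<Rightarrow> 'a \<Rightarrow> real) \<Rightarrow> 'a \<Rightarrow> 'a set \<Rightarrow> ennreal" where
  "set_distance d v S = (INF u\<in>S. ennreal (d v u))"

definition supplier_cost :: "('a \<Rightarrow> 'a \<Rightarrow> real) \<Rightarrow> 'a set \<Rightarrow> 'a set \<Rightarrow> ennreal" where
  "supplier_cost d C S = (SUP v\<in>C. set_distance d v S)"

definition supplier_opt :: "('a \<Rightarrow> 'a \<Rightarrow> real) \<Rightarrow> 'a set \<Rightarrow> 'a set set \<Rightarrow> ennreal" where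
  "supplier_opt d C \<F> = (INF S\<in>\<F>. supplier_cost d C S)"

definition approx_solution ::
    "ennreal \<Rightarrow> ('a \<Rightarrow> 'a \<Rightarrow> real) \<Rightarrow> 'a set \<Rightarrow> 'a set set \<Rightarrow> 'a set \<Rightarrow> bool" where
  "approx_solution \<alpha> d C \<F> S \<longleftrightarrow>
     S \<in> \<F> \<and> supplier_cost d C S \<le> \<alpha> * supplier_opt d C \<F>"


section \<open>Polynomial time\<close>

text \<open>
  The machine model is the random access machine with addition and truncated subtraction at unit
  cost, programmed in structured form.  It has registers and arrays, both holding natural numbers
  and both indexed by natural numbers; a program names finitely many of them.  Since a step
  lengthens the binary representation of a number by at most one bit (there is no multiplication),
  unit cost is legitimate here: the model is polynomially equivalent to Turing machines, for input
  length measured in bits.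
\<close>

datatype com =
    Skip
  | Const nat nat        \<comment> \<open>\<open>r\<^sub>x := n\<close>\<close>
  | Add nat nat nat      \<comment> \<open>\<open>r\<^sub>x := r\<^sub>y + r\<^sub>z\<close>\<close>
  | Sub nat nat nat      \<comment> \<open>\<open>r\<^sub>x := r\<^sub>y - r\<^sub>z\<close>\<close>
  | Load nat nat nat     \<comment> \<open>\<open>r\<^sub>x := A\<^sub>a[r\<^sub>y]\<close>\<close>
  | Store nat nat nat    \<comment> \<open>\<open>A\<^sub>a[r\<^sub>x] := r\<^sub>y\<close>\<close>
  | Seq com com
  | IfNZ nat com com
  | WhileNZ nat com

type_synonym state = "(nat \<Rightarrow> nat) \<times> (nat \<Rightarrow> nat \<Rightarrow> nat)"

text \<open>\<open>exec c s t s'\<close>: started in \<open>s\<close>, the program \<open>c\<close> halts in \<open>s'\<close> after \<open>t\<close> steps.\<close>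

inductive exec :: "com \<Rightarrow> state \<Rightarrow> nat \<Rightarrow> state \<Rightarrow> bool" where
  Skip: "exec Skip s 1 s"
| Const: "exec (Const x n) (r, m) 1 (r(x := n), m)"
| Add: "exec (Add x y z) (r, m) 1 (r(x := r y + r z), m)"
| Sub: "exec (Sub x y z) (r, m) 1 (r(x := r y - r z), m)"
| Load: "exec (Load x a y) (r, m) 1 (r(x := m a (r y)), m)"
| Store: "exec (Store a x y) (r, m) 1 (r, m(a := (m a)(r x := r y)))"
| Seq: "exec c1 s t1 s' \<Longrightarrow> exec c2 s' t2 s'' \<Longrightarrow> exec (Seq c1 c2) s (t1 + t2) s''"
| IfTrue: "fst s x \<noteq> 0 \<Longrightarrow> exec c1 s t s' \<Longrightarrow> exec (IfNZ x c1 c2) s (1 + t) s'"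
| IfFalse: "fst s x = 0 \<Longrightarrow> exec c2 s t s' \<Longrightarrow> exec (IfNZ x c1 c2) s (1 + t) s'"
| WhileFalse: "fst s x = 0 \<Longrightarrow> exec (WhileNZ x c) s 1 s"
| WhileTrue: "fst s x \<noteq> 0 \<Longrightarrow> exec c s t1 s' \<Longrightarrow> exec (WhileNZ x c) s' t2 s'' \<Longrightarrow>
    exec (WhileNZ x c) s (1 + t1 + t2) s''"

text \<open>
  Inputs and outputs are lists of numbers, stored in array \<open>0\<close> with their length in register \<open>0\<close>;
  all else is \<open>0\<close> initially.
\<close>

definition init :: "nat list \<Rightarrow> state" where
  "init xs = ((\<lambda>_. 0)(0 := length xs),
              (\<lambda>_ _. 0)(0 := (\<lambda>i. if i < length xs then xs ! i else 0)))"

definition result :: "state \<Rightarrow> nat list" where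
  "result s = map (snd s 0) [0..<fst s 0]"

definition bit_size :: "nat list \<Rightarrow> nat" where
  "bit_size xs = (\<Sum>x\<leftarrow>xs. floor_log x + 1)"

text \<open>
  A computational problem is a set of pairs \<open>(xs, Y)\<close> of an admissible input \<open>xs\<close> and the set \<open>Y\<close>
  of outputs that are correct for it.  Nothing is required of a program on other inputs.
  Reading off the output is charged, since register \<open>0\<close> may hold a number exponential in the
  number of steps.
\<close>

definition polytime_solvable :: "(nat list \<times> nat list set) set \<Rightarrow> bool" where
  "polytime_solvable Q \<longleftrightarrow>
     (\<exists>c. \<exists>p :: nat poly. \<forall>(xs, Y)\<in>Q. \<exists>t s.
        exec c (init xs) t s \<and> t + length (result s) \<le> poly p (bit_size xs) \<and> result s \<in> Y)"


section \<open>The computational problems\<close>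

text \<open>
  A polynomial-time claim is about an infinite class of set families, given implicitly by finite
  descriptions.  A representation maps some words \<open>w\<close> to a pair \<open>(n, \<F>)\<close>: the word \<open>w\<close> describes
  the family \<open>\<F>\<close> on the ground set \<open>F = {..<n}\<close>.  No assumption is made on how difficult it is to
  work with the descriptions.  Families are non-empty, as otherwise the supplier problem has no
  feasible solution.
\<close>

type_synonym family_rep = "nat list \<Rightarrow> (nat \<times> nat set set) option"

definition down_closed_rep :: "family_rep \<Rightarrow> bool" where
  "down_closed_rep rep \<longleftrightarrow>
     (\<forall>w n \<F>. rep w = Some (n, \<F>) \<longrightarrow> down_closed {..<n} \<F> \<and> \<F> \<noteq> {})"

definition enc_list :: "nat list \<Rightarrow> nat list" where
  "enc_list xs = length xs # xs"

definition enc_set :: "nat set \<Rightarrow> nat list" where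
  "enc_set A = enc_list (sorted_list_of_set A)"

definition enc_sets :: "nat set list \<Rightarrow> nat list" where
  "enc_sets As = length As # concat (map enc_set As)"

definition enc_rat :: "rat \<Rightarrow> nat list" where
  "enc_rat q = [nat (fst (quotient_of q)), nat (snd (quotient_of q))]"

definition enc_matrix :: "nat \<Rightarrow> (nat \<Rightarrow> nat \<Rightarrow> rat) \<Rightarrow> nat list" where
  "enc_matrix m d = concat (map (\<lambda>i. concat (map (\<lambda>j. enc_rat (d i j)) [0..<m])) [0..<m])"

text \<open>
  The sub-partition is listed as \<open>Ps\<close>.  The ground set is listed element by element, so the input
  is at least as long as \<open>F\<close> is large.
\<close>

definition pcf_problem :: "family_rep \<Rightarrow> (nat list \<times> nat list set) set" where
  "pcf_problem rep =
     {(enc_list w @ enc_set {..<n} @ enc_sets Ps,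
       {[if pcf \<F> (set Ps) then 1 else 0]}) | w n \<F> Ps.
      rep w = Some (n, \<F>) \<and> distinct Ps \<and> sub_partition {..<n} (set Ps)}"

text \<open>
  The points \<open>X = F \<union> C\<close> are numbered such that \<open>F = {..<n}\<close> and \<open>X = {..<m}\<close>; \<open>F\<close> and \<open>C\<close> may
  overlap.  Distances are rational in order to be finite input data.
\<close>

definition supplier_problem :: "ennreal \<Rightarrow> family_rep \<Rightarrow> (nat list \<times> nat list set) set" where
  "supplier_problem \<alpha> rep =
     {(enc_list w @ enc_set {..<n} @ enc_set C @ enc_set {..<m} @ enc_matrix m d,
       {ys. approx_solution \<alpha> (\<lambda>x y. of_rat (d x y)) C \<F> (set ys)}) | w n \<F> m C d.
      rep w = Some (n, \<F>) \<and> {..<n} \<union> C = {..<m} \<and>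
      Metric_space {..<m} (\<lambda>x y. of_rat (d x y))}"

definition pcf_polytime :: "family_rep \<Rightarrow> bool" where
  "pcf_polytime rep \<longleftrightarrow> polytime_solvable (pcf_problem rep)"

definition supplier_polytime_approx :: "ennreal \<Rightarrow> family_rep \<Rightarrow> bool" where
  "supplier_polytime_approx \<alpha> rep \<longleftrightarrow> polytime_solvable (supplier_problem \<alpha> rep)"

end

theory Submission
  imports Defs
begin

text \<open>
  Supplier from PCF: for a guessed distance \<open>\<lambda>\<close>, scan the clients and keep those whose
  \<open>\<lambda>\<close>-ball in \<open>F\<close> is disjoint from the balls kept before.  If \<open>\<lambda> \<ge> OPT\<close>, an optimal solution
  meets all kept balls, so PCF answers yes for them; conversely a set in \<open>\<F>\<close> that meets every kept
  ball serves every client within \<open>3\<lambda>\<close>, since a client that is not kept shares a facility with a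
  kept ball.  Deleting elements from the balls as long as PCF still answers yes leaves singletons,
  whose union is in \<open>\<F>\<close>.  The least distance between a client and a facility for which this
  succeeds is at most \<open>OPT\<close>.

  PCF from supplier: add a client to each part, at distance \<open>1\<close> to the elements of the part, with
  distance \<open>M > \<alpha>\<close> between points of different parts.  A solution of cost below \<open>M\<close> meets every part
  and can be thinned out to an exact one.

  Both algorithms are written in a language with lists and an oracle instruction, which is compiled
  to the machine.  The machine starts with empty memory, so the compiled oracle logs the addresses
  that it writes to, and these are cleared after each call.
\<close>

section \<open>A structured language with lists and an oracle\<close>

text \<open>Nothing is known about how a word describes its family, so both reductions treat the
  word as opaque: they copy it, with the ground set, into every query and learn about the family
  only from the answers. Answers are guaranteed only on admissible inputs, so a query must be a
  repetition-free list of disjoint sets, or a genuine metric. Empty balls, which could occur several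
  times in such a list, are therefore sorted out before PCF is asked. A guess below OPT may or may
  not succeed, so success need not be monotone in the guess and there is no binary search: all
  client-facility distances are run through and the least successful one is kept. Success below OPT
  does no harm, since the factor 3 is relative to the guess. In the other direction \<open>M\<close>
  can be a constant of the program because \<alpha> is fixed and finite. The numbers in a rational
  distance may be exponential in the input length and the machine cannot multiply. Comparing
  distances by cross-multiplication thus needs a product by repeated doubling, whose number of steps
  is governed by the bit length.\<close>

datatype exp = N nat | V nat | Len nat | Idx nat exp | Plus exp exp | Minus exp exp

datatype cmd =
    Assign nat exp
  | Clear nat
  | Push nat exp
  | Update nat exp exp
  | Then cmd cmd (infixr ";;" 60)
  | Cond exp cmd cmd
  | While exp cmd
  | Call

type_synonym hstate = "(nat \<Rightarrow> nat) \<times> (nat \<Rightarrow> nat list)"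

fun ev :: "exp \<Rightarrow> hstate \<Rightarrow> nat" where
  "ev (N n) s = n"
| "ev (V x) s = fst s x"
| "ev (Len a) s = length (snd s a)"
| "ev (Idx a e) s = (if ev e s < length (snd s a) then snd s a ! ev e s else 0)"
| "ev (Plus e1 e2) s = ev e1 s + ev e2 s"
| "ev (Minus e1 e2) s = ev e1 s - ev e2 s"

text \<open>A call passes list 2 to the oracle and receives list 3. Besides the oracle's own time it
  is charged for both lengths, because the compiled call copies both lists. Every other step costs
  1; the size of its expressions is accounted for by \<open>cost\<close>.\<close>

inductive hexec :: "com \<Rightarrow> cmd \<Rightarrow> hstate \<Rightarrow> nat \<Rightarrow> hstate \<Rightarrow> bool" for c where
  Assign: "hexec c (Assign x e) (r, l) 1 (r(x := ev e (r, l)), l)"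
| Clear: "hexec c (Clear a) (r, l) 1 (r, l(a := []))"
| Push: "hexec c (Push a e) (r, l) 1 (r, l(a := l a @ [ev e (r, l)]))"
| Update: "hexec c (Update a e1 e2) (r, l) 1 (r, l(a := (l a)[ev e1 (r, l) := ev e2 (r, l)]))"
| Then: "hexec c C1 s t1 s' \<Longrightarrow> hexec c C2 s' t2 s'' \<Longrightarrow> hexec c (C1 ;; C2) s (t1 + t2) s''"
| IfTrue: "ev e s \<noteq> 0 \<Longrightarrow> hexec c C1 s t s' \<Longrightarrow> hexec c (Cond e C1 C2) s (1 + t) s'"
| IfFalse: "ev e s = 0 \<Longrightarrow> hexec c C2 s t s' \<Longrightarrow> hexec c (Cond e C1 C2) s (1 + t) s'"
| WhileFalse: "ev e s = 0 \<Longrightarrow> hexec c (While e C) s 1 s"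
| WhileTrue: "ev e s \<noteq> 0 \<Longrightarrow> hexec c C s t1 s' \<Longrightarrow> hexec c (While e C) s' t2 s'' \<Longrightarrow>
    hexec c (While e C) s (1 + t1 + t2) s''"
| Call: "exec c (init (l 2)) t s \<Longrightarrow>
    hexec c Call (r, l) (t + length (l 2) + length (result s) + 1) (r, l(3 := result s))"

section \<open>Compilation\<close>

subsection \<open>Weakest preconditions for the machine\<close>

definition lwp :: "com \<Rightarrow> (nat \<Rightarrow> state \<Rightarrow> bool) \<Rightarrow> state \<Rightarrow> bool" where
  "lwp c Q s \<longleftrightarrow> (\<exists>t s'. exec c s t s' \<and> Q t s')"

inductive_cases exec_elims:
  "exec Skip s t s'"
  "exec (Const x n) s t s'"
  "exec (Add x y z) s t s'"
  "exec (Sub x y z) s t s'"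
  "exec (Load x a y) s t s'"
  "exec (Store a x y) s t s'"

inductive_cases exec_SeqE: "exec (Seq c1 c2) s t s'"
inductive_cases exec_IfE: "exec (IfNZ x c1 c2) s t s'"
inductive_cases exec_WhileE: "exec (WhileNZ x c) s t s'"

lemma exec_iffs:
  "exec Skip s t s' \<longleftrightarrow> t = 1 \<and> s' = s"
  "exec (Const x n) (R, M) t s' \<longleftrightarrow> t = 1 \<and> s' = (R(x := n), M)"
  "exec (Add x y z) (R, M) t s' \<longleftrightarrow> t = 1 \<and> s' = (R(x := R y + R z), M)"
  "exec (Sub x y z) (R, M) t s' \<longleftrightarrow> t = 1 \<and> s' = (R(x := R y - R z), M)"
  "exec (Load x a y) (R, M) t s' \<longleftrightarrow> t = 1 \<and> s' = (R(x := M a (R y)), M)"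
  "exec (Store a x y) (R, M) t s' \<longleftrightarrow> t = 1 \<and> s' = (R, M(a := (M a)(R x := R y)))"
  by (auto elim: exec_elims intro: exec.intros simp del: One_nat_def)

lemma lwp_simps [simp]:
  "lwp Skip Q s \<longleftrightarrow> Q 1 s"
  "lwp (Const x n) Q (R, M) \<longleftrightarrow> Q 1 (R(x := n), M)"
  "lwp (Add x y z) Q (R, M) \<longleftrightarrow> Q 1 (R(x := R y + R z), M)"
  "lwp (Sub x y z) Q (R, M) \<longleftrightarrow> Q 1 (R(x := R y - R z), M)"
  "lwp (Load x a y) Q (R, M) \<longleftrightarrow> Q 1 (R(x := M a (R y)), M)"
  "lwp (Store a x y) Q (R, M) \<longleftrightarrow> Q 1 (R, M(a := (M a)(R x := R y)))"
  by (simp_all add: lwp_def exec_iffs del: split_paired_Ex)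

lemma lwpI: "exec c s t s' \<Longrightarrow> Q t s' \<Longrightarrow> lwp c Q s"
  unfolding lwp_def by (intro exI conjI)

lemma lwpE:
  assumes "lwp c Q s" obtains t s' where "exec c s t s'" "Q t s'"
  using assms unfolding lwp_def by (elim exE conjE)

lemma lwp_Seq [simp]:
  "lwp (Seq c1 c2) Q s \<longleftrightarrow> lwp c1 (\<lambda>t. lwp c2 (\<lambda>t'. Q (t + t'))) s"
proof
  assume "lwp (Seq c1 c2) Q s"
  then show "lwp c1 (\<lambda>t. lwp c2 (\<lambda>t'. Q (t + t'))) s"
    by (elim lwpE exec_SeqE) (intro lwpI, assumption+, simp)
next
  assume "lwp c1 (\<lambda>t. lwp c2 (\<lambda>t'. Q (t + t'))) s"
  then show "lwp (Seq c1 c2) Q s"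
    by (elim lwpE) (intro lwpI[OF exec.Seq])
qed

lemma lwp_If [simp]:
  "lwp (IfNZ x c1 c2) Q s \<longleftrightarrow>
     (if fst s x \<noteq> 0 then lwp c1 (\<lambda>t. Q (1 + t)) s else lwp c2 (\<lambda>t. Q (1 + t)) s)"
    (is "?L \<longleftrightarrow> ?R")
proof
  assume ?L
  then show ?R
    by (elim lwpE exec_IfE) (simp_all, (intro lwpI, assumption, simp)+)
next
  assume R: ?R
  show ?L
  proof (cases "fst s x = 0")
    case True
    with R have "lwp c2 (\<lambda>t. Q (1 + t)) s" by simp
    with True show ?thesis by (elim lwpE) (intro lwpI[OF exec.IfFalse])
  next
    case False
    with R have "lwp c1 (\<lambda>t. Q (1 + t)) s" by simp
    with False show ?thesis by (elim lwpE) (intro lwpI[OF exec.IfTrue])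
  qed
qed

lemma lwp_While_unfold:
  "lwp (WhileNZ x c) Q s \<longleftrightarrow>
     (if fst s x \<noteq> 0 then lwp c (\<lambda>t. lwp (WhileNZ x c) (\<lambda>t'. Q (1 + t + t'))) s else Q 1 s)"
    (is "?L \<longleftrightarrow> ?R")
proof
  assume ?L
  then obtain t s' where e: "exec (WhileNZ x c) s t s'" and Q: "Q t s'" by (elim lwpE)
  from e show ?R
  proof (rule exec_WhileE)
    assume "t = Suc 0" "s' = s" "fst s x = 0"
    then show ?R using Q by simp
  next
    fix t1 s1 t2
    assume *: "t = Suc (t1 + t2)" "0 < fst s x" "exec c s t1 s1" "exec (WhileNZ x c) s1 t2 s'"
    have "lwp (WhileNZ x c) (\<lambda>t'. Q (1 + t1 + t')) s1"
      using * Q by (intro lwpI[OF *(4)]) simp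
    with * show ?R by (simp add: lwpI)
  qed
next
  assume R: ?R
  show ?L
  proof (cases "fst s x = 0")
    case True
    with R show ?thesis by (intro lwpI[OF exec.WhileFalse]) simp_all
  next
    case False
    with R have "lwp c (\<lambda>t. lwp (WhileNZ x c) (\<lambda>t'. Q (1 + t + t'))) s" by simp
    with False show ?thesis by (elim lwpE) (intro lwpI[OF exec.WhileTrue])
  qed
qed

lemma lwp_mono:
  "lwp c P s \<Longrightarrow> (\<And>t s'. P t s' \<Longrightarrow> Q t s') \<Longrightarrow> lwp c Q s"
  unfolding lwp_def by blast

text \<open>The invariant is indexed by the number of iterations still to come, so the loop runs
  exactly \<open>n\<close> times; the extra 1 per round, and the final 1, are the tests of the
  guard.\<close>

lemma lwp_While:
  assumes "I n R M"
    and step: "\<And>i R M. I (Suc i) R M \<Longrightarrow>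
      R x \<noteq> 0 \<and> lwp c (\<lambda>t (R', M'). t \<le> B \<and> I i R' M') (R, M)"
    and stop: "\<And>R M. I 0 R M \<Longrightarrow> R x = 0"
  shows "lwp (WhileNZ x c) (\<lambda>t (R', M'). t \<le> n * (B + 1) + 1 \<and> I 0 R' M') (R, M)"
  using assms(1)
proof (induction n arbitrary: R M)
  case 0
  then have "R x = 0" by (rule stop)
  with 0 show ?case by (subst lwp_While_unfold) simp
next
  case (Suc n)
  from step[OF Suc.prems] have "R x \<noteq> 0"
    and c: "lwp c (\<lambda>t (R', M'). t \<le> B \<and> I n R' M') (R, M)" by auto
  from c have "lwp c (\<lambda>t. lwp (WhileNZ x c) (\<lambda>t' (R', M').
      1 + t + t' \<le> Suc n * (B + 1) + 1 \<and> I 0 R' M')) (R, M)"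
  proof (rule lwp_mono)
    fix t s'
    assume "case s' of (R', M') \<Rightarrow> t \<le> B \<and> I n R' M'"
    then obtain R' M' where s': "s' = (R', M')" "t \<le> B" "I n R' M'" by (cases s') auto
    show "lwp (WhileNZ x c) (\<lambda>t' (R', M').
      1 + t + t' \<le> Suc n * (B + 1) + 1 \<and> I 0 R' M') s'"
      unfolding s'(1) by (rule lwp_mono[OF Suc.IH[OF s'(3)]]) (use s'(2) in auto)
  qed
  with \<open>R x \<noteq> 0\<close> show ?case by (subst lwp_While_unfold) simp
qed

subsection \<open>Layout of the memory\<close>

text \<open>
  Registers are divided among the scalars, the lengths of the lists, temporary values and the
  registers of the oracle program; arrays among the lists, the arrays of the oracle program and
  the log of the addresses that the oracle program has written to.
\<close>

definition lreg :: "nat \<Rightarrow> nat" where "lreg a = 4 * a"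
definition sreg :: "nat \<Rightarrow> nat" where "sreg x = 4 * x + 1"
definition treg :: "nat \<Rightarrow> nat" where "treg k = 4 * k + 2"
definition creg :: "nat \<Rightarrow> nat" where "creg x = 4 * x + 3"
definition larr :: "nat \<Rightarrow> nat" where "larr a = 2 * a"
definition carr :: "nat \<Rightarrow> nat" where "carr a = 4 * a + 1"
definition logarr :: nat where "logarr = 3"

lemma layout_simps [simp]:
  "lreg a = lreg b \<longleftrightarrow> a = b" "sreg a = sreg b \<longleftrightarrow> a = b" "treg a = treg b \<longleftrightarrow> a = b"
  "creg a = creg b \<longleftrightarrow> a = b"
  "lreg a \<noteq> sreg b" "lreg a \<noteq> treg b" "lreg a \<noteq> creg b"
  "sreg a \<noteq> lreg b" "sreg a \<noteq> treg b" "sreg a \<noteq> creg b"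
  "treg a \<noteq> lreg b" "treg a \<noteq> sreg b" "treg a \<noteq> creg b"
  "creg a \<noteq> lreg b" "creg a \<noteq> sreg b" "creg a \<noteq> treg b"
  "larr a = larr b \<longleftrightarrow> a = b" "carr a = carr b \<longleftrightarrow> a = b"
  "larr a \<noteq> carr b" "larr a \<noteq> logarr" "carr a \<noteq> larr b" "carr a \<noteq> logarr"
  "logarr \<noteq> larr a" "logarr \<noteq> carr a"
  unfolding lreg_def sreg_def treg_def creg_def larr_def carr_def logarr_def by presburger+

subsection \<open>Oracle calls\<close>

text \<open>Apart from renaming, only \<open>Store\<close> changes: it also appends the address to
  the log, whose length is kept in \<open>treg 0\<close> (\<open>treg 1\<close> holds the constant
  1). The log does not record which array was written; clearing therefore wipes a logged address in
  every array that the program can write to.\<close>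

fun inst :: "com \<Rightarrow> com" where
  "inst Skip = Skip"
| "inst (Const x n) = Const (creg x) n"
| "inst (Add x y z) = Add (creg x) (creg y) (creg z)"
| "inst (Sub x y z) = Sub (creg x) (creg y) (creg z)"
| "inst (Load x a y) = Load (creg x) (carr a) (creg y)"
| "inst (Store a x y) = Seq (Store (carr a) (creg x) (creg y))
     (Seq (Store logarr (treg 0) (creg x)) (Add (treg 0) (treg 0) (treg 1)))"
| "inst (Seq c1 c2) = Seq (inst c1) (inst c2)"
| "inst (IfNZ x c1 c2) = IfNZ (creg x) (inst c1) (inst c2)"
| "inst (WhileNZ x c) = WhileNZ (creg x) (inst c)"

fun regs_of :: "com \<Rightarrow> nat list" where
  "regs_of (Const x n) = [x]"
| "regs_of (Add x y z) = [x]"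
| "regs_of (Sub x y z) = [x]"
| "regs_of (Load x a y) = [x]"
| "regs_of (Seq c1 c2) = regs_of c1 @ regs_of c2"
| "regs_of (IfNZ x c1 c2) = regs_of c1 @ regs_of c2"
| "regs_of (WhileNZ x c) = regs_of c"
| "regs_of _ = []"

fun arrs_of :: "com \<Rightarrow> nat list" where
  "arrs_of (Store a x y) = [a]"
| "arrs_of (Seq c1 c2) = arrs_of c1 @ arrs_of c2"
| "arrs_of (IfNZ x c1 c2) = arrs_of c1 @ arrs_of c2"
| "arrs_of (WhileNZ x c) = arrs_of c"
| "arrs_of _ = []"

text \<open>Whatever lies outside these two finite lists still has its initial value after a run. A
  clean-up that follows the program text can thus be complete.\<close>

lemma exec_unchanged:
  assumes "exec c s t s'"
  shows "\<forall>x. x \<notin> set (regs_of c) \<longrightarrow> fst s' x = fst s x"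
    and "\<forall>a. a \<notin> set (arrs_of c) \<longrightarrow> snd s' a = snd s a"
  using assms by (induction rule: exec.induct) auto

text \<open>The last conjunct is the point of the log: every nonzero oracle cell has its address
  among the first \<open>treg 0\<close> log entries, so clearing those addresses restores empty
  memory.\<close>

definition sim :: "state \<Rightarrow> state \<Rightarrow> bool" where
  "sim s S \<longleftrightarrow> (\<forall>x. fst S (creg x) = fst s x) \<and> (\<forall>a. snd S (carr a) = snd s a) \<and>
     fst S (treg 1) = 1 \<and> (\<forall>a i. snd s a i \<noteq> 0 \<longrightarrow> (\<exists>j<fst S (treg 0). snd S logarr j = i))"

definition caller_eq :: "state \<Rightarrow> state \<Rightarrow> bool" where
  "caller_eq S S' \<longleftrightarrow> (\<forall>x. fst S' (sreg x) = fst S (sreg x)) \<and>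
     (\<forall>a. fst S' (lreg a) = fst S (lreg a)) \<and> (\<forall>a. snd S' (larr a) = snd S (larr a))"

lemma caller_eq_refl [simp]: "caller_eq S S"
  by (simp add: caller_eq_def)

lemma caller_eq_trans: "caller_eq S S' \<Longrightarrow> caller_eq S' S'' \<Longrightarrow> caller_eq S S''"
  by (simp add: caller_eq_def)

text \<open>The factor 3 comes from \<open>Store\<close>, the only instruction that becomes three.
  The log grows by at most one entry per step, which bounds the later cost of clearing.\<close>

lemma lwp_inst:
  "exec c s t s' \<Longrightarrow> sim s S \<Longrightarrow>
   lwp (inst c) (\<lambda>t' S'. t' \<le> 3 * t \<and> sim s' S' \<and> caller_eq S S' \<and>
     fst S' (treg 0) \<le> fst S (treg 0) + t) S"
proof (induction arbitrary: S rule: exec.induct)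
  case (Store a x y r m)
  obtain R M where S: "S = (R, M)" by (cases S)
  have *: "\<forall>x. R (creg x) = r x" "\<forall>a. M (carr a) = m a" "R (treg 1) = 1"
    "\<And>a i. m a i \<noteq> 0 \<Longrightarrow> \<exists>j<R (treg 0). M logarr j = i"
    using Store by (auto simp: S sim_def)
  have "\<exists>j<Suc (R (treg 0)). ((M logarr)(R (treg 0) := r x)) j = i"
    if "(m(a := (m a)(r x := r y))) b i \<noteq> 0" for b i
  proof (cases "i = r x")
    case True
    then show ?thesis by (intro exI[of _ "R (treg 0)"]) simp
  next
    case False
    with that have "m b i \<noteq> 0" by (simp split: if_splits)
    from *(4)[OF this] obtain j where "j < R (treg 0)" "M logarr j = i" by blast
    then show ?thesis by (intro exI[of _ j]) simp
  qed
  with * show ?case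
    by (simp add: S sim_def caller_eq_def)
next
  case (Seq c1 s t1 s' c2 t2 s'')
  show ?case
    apply simp
    apply (rule lwp_mono[OF Seq.IH(1)[OF Seq.prems]])
    apply (elim conjE)
    apply (rule lwp_mono[OF Seq.IH(2)], assumption)
    apply (auto intro: caller_eq_trans)
    done
next
  case (IfTrue s x c1 t s' c2)
  then have "fst S (creg x) \<noteq> 0" by (simp add: sim_def)
  then show ?case
    by simp (rule lwp_mono[OF IfTrue.IH[OF IfTrue.prems]], auto)
next
  case (IfFalse s x c2 t s' c1)
  then have "fst S (creg x) = 0" by (simp add: sim_def)
  then show ?case
    by simp (rule lwp_mono[OF IfFalse.IH[OF IfFalse.prems]], auto)
next
  case (WhileFalse s x c)
  then have "fst S (creg x) = 0" by (simp add: sim_def)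
  then show ?case
    using WhileFalse by (simp add: lwp_While_unfold)
next
  case (WhileTrue s x c t1 s' t2 s'')
  then have "fst S (creg x) \<noteq> 0" by (simp add: sim_def)
  then show ?case
    apply simp
    apply (subst lwp_While_unfold)
    apply simp
    apply (rule lwp_mono[OF WhileTrue.IH(1)[OF WhileTrue.prems]])
    apply (elim conjE)
    apply (rule lwp_mono[OF WhileTrue.IH(2)[simplified]], assumption)
    apply (auto intro: caller_eq_trans)
    done
next
  case (Skip s)
  then show ?case by simp
next
  case (Const x n r m)
  then show ?case by (cases S) (simp add: sim_def caller_eq_def)
next
  case (Add x y z r m)
  then show ?case by (cases S) (simp add: sim_def caller_eq_def)
next
  case (Sub x y z r m)
  then show ?case by (cases S) (simp add: sim_def caller_eq_def)
next
  case (Load x a y r m)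
  then show ?case by (cases S) (simp add: sim_def caller_eq_def)
qed

text \<open>The input cells are logged as well, since they must be cleared even if the oracle never
  writes to them. There is no move instruction; the final \<open>Add\<close> sets the oracle's
  length register correctly only because that register is 0 between calls
  (\<open>idle\<close>).\<close>

definition copy_in :: com where
  "copy_in = Seq (Const (treg 0) 0) (Seq (Const (treg 1) 1) (Seq (Const (treg 2) 0)
     (Seq (Sub (treg 3) (lreg 2) (treg 2))
     (Seq (WhileNZ (treg 3)
        (Seq (Load (treg 4) (larr 2) (treg 2)) (Seq (Store (carr 0) (treg 2) (treg 4))
        (Seq (Store logarr (treg 0) (treg 2)) (Seq (Add (treg 0) (treg 0) (treg 1))
        (Seq (Add (treg 2) (treg 2) (treg 1)) (Sub (treg 3) (lreg 2) (treg 2))))))))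
     (Add (creg 0) (creg 0) (treg 2))))))"

definition copy_out :: com where
  "copy_out = Seq (Const (treg 2) 0) (Seq (Const (lreg 3) 0) (Seq (Add (lreg 3) (lreg 3) (creg 0))
     (Seq (Sub (treg 3) (creg 0) (treg 2))
     (WhileNZ (treg 3)
        (Seq (Load (treg 4) (carr 0) (treg 2)) (Seq (Store (larr 3) (treg 2) (treg 4))
        (Seq (Add (treg 2) (treg 2) (treg 1)) (Sub (treg 3) (creg 0) (treg 2)))))))))"

definition clean_cell :: "nat list \<Rightarrow> com" where
  "clean_cell as = foldr (\<lambda>a. Seq (Store (carr a) (treg 2) (treg 3))) as Skip"

definition clean_regs :: "nat list \<Rightarrow> com" where
  "clean_regs xs = foldr (\<lambda>x. Seq (Const (creg x) 0)) xs Skip"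

definition clean_arrs :: "nat list \<Rightarrow> com" where
  "clean_arrs as = Seq (Const (treg 3) 0) (WhileNZ (treg 0)
     (Seq (Sub (treg 0) (treg 0) (treg 1)) (Seq (Load (treg 2) logarr (treg 0)) (clean_cell as))))"

text \<open>The leading 0 in both clean-up lists stands for array 0 and register 0, which
  \<open>copy_in\<close> fills whether or not the program itself writes to them.\<close>

definition call_code :: "com \<Rightarrow> com" where
  "call_code c = Seq copy_in (Seq (inst c) (Seq copy_out
     (Seq (clean_arrs (0 # arrs_of c)) (clean_regs (0 # regs_of c)))))"

definition idle :: "state \<Rightarrow> bool" where
  "idle S \<longleftrightarrow> (\<forall>x. fst S (creg x) = 0) \<and> (\<forall>a i. snd S (carr a) i = 0)"

lemma lwp_copy_in:
  assumes "idle S" "fst S (lreg 2) = length xs" "\<forall>i<length xs. snd S (larr 2) i = xs ! i"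
  shows "lwp copy_in (\<lambda>t S'. t \<le> 7 * length xs + 6 \<and> sim (init xs) S' \<and> caller_eq S S' \<and>
    fst S' (treg 0) = length xs) S"
proof -
  obtain R M where S: "S = (R, M)" by (cases S)
  let ?n = "length xs"
  define I where "I k R' M' \<longleftrightarrow> k \<le> ?n \<and> R' (treg 0) = ?n - k \<and> R' (treg 1) = 1 \<and>
     R' (treg 2) = ?n - k \<and> R' (treg 3) = k \<and> (\<forall>x. R' (creg x) = 0) \<and> caller_eq (R, M) (R', M') \<and>
     (\<forall>a i. M' (carr a) i = (if a = 0 \<and> i < ?n - k then xs ! i else 0)) \<and>
     (\<forall>i<?n - k. M' logarr i = i)" for k R' M'
  have "lwp (WhileNZ (treg 3)
        (Seq (Load (treg 4) (larr 2) (treg 2)) (Seq (Store (carr 0) (treg 2) (treg 4))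
        (Seq (Store logarr (treg 0) (treg 2)) (Seq (Add (treg 0) (treg 0) (treg 1))
        (Seq (Add (treg 2) (treg 2) (treg 1)) (Sub (treg 3) (lreg 2) (treg 2))))))))
     (\<lambda>t (R', M'). t \<le> ?n * (6 + 1) + 1 \<and> I 0 R' M')
     (R(treg 0 := 0, treg (Suc 0) := Suc 0, treg 2 := 0, treg 3 := ?n), M)"
  proof (rule lwp_While[where I = I and n = "?n"], goal_cases)
    case 1
    show ?case using assms by (simp add: I_def S idle_def caller_eq_def)
  next
    case (2 i R' M')
    then show ?case using assms
      by (auto simp: I_def S caller_eq_def less_Suc_eq)
  next
    case (3 R' M')
    then show ?case by (simp add: I_def)
  qed
  note loop = this
  have fin: "R' (treg 2) = ?n \<and> R' (creg 0) = 0 \<and> R' (treg 0) = ?n \<and>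
      sim (init xs) (R'(creg 0 := ?n), M') \<and> caller_eq (R, M) (R'(creg 0 := ?n), M')"
    if I: "I 0 R' M'" for R' M'
  proof -
    have "M' (carr a) = snd (init xs) a" for a
      using I by (intro ext) (auto simp: I_def init_def)
    moreover have "\<exists>j<?n. M' logarr j = i" if "snd (init xs) a i \<noteq> 0" for a i
    proof -
      have "i < ?n" using that by (simp add: init_def split: if_splits)
      moreover have "M' logarr i = i" using I \<open>i < ?n\<close> unfolding I_def by simp
      ultimately show ?thesis by blast
    qed
    moreover have "fst (init xs) = (\<lambda>_. 0)(0 := ?n)" by (simp add: init_def)
    ultimately show ?thesis
      using I by (simp add: I_def sim_def caller_eq_def)
  qed
  from loop show ?thesis
    unfolding copy_in_def S
    apply (simp add: assms(2)[unfolded S, simplified])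
    apply (rule lwp_mono, assumption)
    apply clarsimp
    apply (frule fin)
    apply simp
    done
qed

lemma lwp_copy_out:
  assumes "fst S (treg 1) = 1"
  shows "lwp copy_out (\<lambda>t S'. t \<le> 5 * fst S (creg 0) + 5 \<and> fst S' (lreg 3) = fst S (creg 0) \<and>
    (\<forall>i<fst S (creg 0). snd S' (larr 3) i = snd S (carr 0) i) \<and>
    (\<forall>a. a \<noteq> 3 \<longrightarrow> fst S' (lreg a) = fst S (lreg a) \<and> snd S' (larr a) = snd S (larr a)) \<and>
    (\<forall>x. fst S' (sreg x) = fst S (sreg x)) \<and>
    (\<forall>x. fst S' (creg x) = fst S (creg x)) \<and> (\<forall>a. snd S' (carr a) = snd S (carr a)) \<and>
    fst S' (treg 0) = fst S (treg 0) \<and> fst S' (treg 1) = 1 \<and> snd S' logarr = snd S logarr) S"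
proof -
  obtain R M where S: "S = (R, M)" by (cases S)
  let ?n = "R (creg 0)"
  define I where "I k R' M' \<longleftrightarrow> k \<le> ?n \<and> R' (lreg 3) = ?n \<and> R' (treg 3) = k \<and> R' (treg 2) = ?n - k \<and>
    (\<forall>i<?n - k. M' (larr 3) i = M (carr 0) i) \<and>
    (\<forall>a. a \<noteq> 3 \<longrightarrow> R' (lreg a) = R (lreg a) \<and> M' (larr a) = M (larr a)) \<and>
    (\<forall>x. R' (sreg x) = R (sreg x)) \<and>
    (\<forall>x. R' (creg x) = R (creg x)) \<and> (\<forall>a. M' (carr a) = M (carr a)) \<and>
    R' (treg 0) = R (treg 0) \<and> R' (treg 1) = 1 \<and> M' logarr = M logarr" for k R' M'
  have "lwp (WhileNZ (treg 3)
        (Seq (Load (treg 4) (carr 0) (treg 2)) (Seq (Store (larr 3) (treg 2) (treg 4))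
        (Seq (Add (treg 2) (treg 2) (treg 1)) (Sub (treg 3) (creg 0) (treg 2))))))
     (\<lambda>t (R', M'). t \<le> ?n * (4 + 1) + 1 \<and> I 0 R' M')
     (R(treg 2 := 0, lreg 3 := ?n, treg 3 := ?n), M)"
  proof (rule lwp_While[where I = I and n = "?n"], goal_cases)
    case 1
    show ?case using assms by (simp add: I_def S)
  next
    case (2 i R' M')
    then show ?case
      by (auto simp: I_def less_Suc_eq)
  next
    case (3 R' M')
    then show ?case by (simp add: I_def)
  qed
  then show ?thesis
    unfolding copy_out_def S
    apply simp
    apply (rule lwp_mono, assumption)
    apply (auto simp: I_def)
    done
qed

lemma lwp_clean_cell:
  "lwp (clean_cell as) (\<lambda>t S'. t = length as + 1 \<and> fst S' = R \<and>
     (\<forall>a. snd S' (larr a) = M (larr a)) \<and> snd S' logarr = M logarr \<and>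
     (\<forall>a i. snd S' (carr a) i = (if a \<in> set as \<and> i = R (treg 2) then R (treg 3) else M (carr a) i)))
   (R, M)"
proof (induction as arbitrary: M)
  case Nil
  then show ?case by (simp add: clean_cell_def)
next
  case (Cons b as)
  show ?case
    unfolding clean_cell_def
    apply simp
    apply (fold clean_cell_def)
    apply (rule lwp_mono[OF Cons.IH])
    apply auto
    done
qed

lemma lwp_clean_regs:
  "lwp (clean_regs xs) (\<lambda>t S'. t = length xs + 1 \<and> snd S' = M \<and>
     (\<forall>a. fst S' (lreg a) = R (lreg a)) \<and> (\<forall>a. fst S' (sreg a) = R (sreg a)) \<and>
     (\<forall>x. fst S' (creg x) = (if x \<in> set xs then 0 else R (creg x))))
   (R, M)"
proof (induction xs arbitrary: R)
  case Nil
  then show ?case by (simp add: clean_regs_def)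
next
  case (Cons b xs)
  show ?case
    unfolding clean_regs_def
    apply simp
    apply (fold clean_regs_def)
    apply (rule lwp_mono[OF Cons.IH])
    apply auto
    done
qed

text \<open>The log is consumed from its end. Throughout, the addresses of all nonzero oracle cells
  are among the entries not yet consumed, so an exhausted log means that all cells are 0.\<close>

lemma lwp_clean_arrs:
  assumes "R (treg 1) = 1"
    "\<And>a i. M (carr a) i \<noteq> 0 \<Longrightarrow> a \<in> set as \<and> (\<exists>j<R (treg 0). M logarr j = i)"
  shows "lwp (clean_arrs as) (\<lambda>t S'. t \<le> R (treg 0) * (length as + 4) + 2 \<and>
     (\<forall>a. fst S' (lreg a) = R (lreg a)) \<and> (\<forall>x. fst S' (sreg x) = R (sreg x)) \<and>
     (\<forall>x. fst S' (creg x) = R (creg x)) \<and> (\<forall>a. snd S' (larr a) = M (larr a)) \<and>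
     (\<forall>a i. snd S' (carr a) i = 0)) (R, M)"
proof -
  let ?n = "R (treg 0)"
  define I where "I k R' M' \<longleftrightarrow> R' (treg 0) = k \<and> R' (treg 1) = 1 \<and> R' (treg 3) = 0 \<and>
     (\<forall>a. R' (lreg a) = R (lreg a)) \<and> (\<forall>x. R' (sreg x) = R (sreg x)) \<and>
     (\<forall>x. R' (creg x) = R (creg x)) \<and> (\<forall>a. M' (larr a) = M (larr a)) \<and>
     (\<forall>a i. M' (carr a) i \<noteq> 0 \<longrightarrow> a \<in> set as \<and> (\<exists>j<k. M' logarr j = i))" for k R' M'
  have "lwp (WhileNZ (treg 0)
     (Seq (Sub (treg 0) (treg 0) (treg 1)) (Seq (Load (treg 2) logarr (treg 0)) (clean_cell as))))
     (\<lambda>t (R', M'). t \<le> ?n * ((length as + 3) + 1) + 1 \<and> I 0 R' M')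
     (R(treg 3 := 0), M)"
  proof (rule lwp_While[where I = I and n = "?n"], goal_cases)
    case 1
    show ?case using assms by (simp add: I_def)
  next
    case (2 i R' M')
    let ?R = "R'(treg 0 := i, treg 2 := M' logarr i)"
    have "lwp (clean_cell as) (\<lambda>t (R'', M''). t + 2 \<le> length as + 3 \<and> I i R'' M'') (?R, M')"
    proof (rule lwp_mono[OF lwp_clean_cell], goal_cases)
      case (1 t S)
      obtain R'' M'' where S: "S = (R'', M'')" by (cases S)
      have *: "M'' (carr a) x = (if a \<in> set as \<and> x = M' logarr i then 0 else M' (carr a) x)" for a x
        using 1 2 by (simp add: S I_def)
      have R: "R'' = ?R" and log: "M'' logarr = M' logarr"
        and larr: "\<forall>a. M'' (larr a) = M' (larr a)" and t: "t = length as + 1"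
        using 1 by (auto simp: S)
      have key: "a \<in> set as \<and> (\<exists>j<i. M'' logarr j = x)" if "M'' (carr a) x \<noteq> 0" for a x
      proof -
        have "M' (carr a) x \<noteq> 0" using that unfolding * by (simp split: if_splits)
        then have a: "a \<in> set as" and "\<exists>j<Suc i. M' logarr j = x"
          using 2 unfolding I_def by blast+
        moreover have "x \<noteq> M' logarr i" using that a unfolding * by (simp split: if_splits)
        ultimately show ?thesis unfolding log by (auto simp: less_Suc_eq)
      qed
      have "I i R'' M''"
        using 2 key larr unfolding I_def R by simp
      then show ?case by (simp add: S t)
    qed
    then have "lwp (clean_cell as) (\<lambda>t S. Suc (Suc t) \<le> length as + 3 \<and> I i (fst S) (snd S)) (?R, M')"
      by (rule lwp_mono) auto
    moreover have "R' (treg 0) = Suc i" "R' (treg 1) = 1" using 2 unfolding I_def by blast+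
    ultimately show ?case by (simp add: case_prod_beta)
  next
    case (3 R' M')
    then show ?case by (simp add: I_def)
  qed
  then show ?thesis
    unfolding clean_arrs_def
    apply simp
    apply (rule lwp_mono, assumption)
    apply (auto simp: I_def algebra_simps)
    done
qed

text \<open>Copying is linear in the lengths of query and answer, the simulation takes at most
  \<open>3 * t\<close> steps, and clearing visits at most \<open>t + length xs\<close> log entries
  at a price proportional to the number of arrays of \<open>c\<close>. The constant 30 absorbs the
  rest, so the factor depends on \<open>c\<close> only.\<close>

lemma lwp_call_code:
  assumes "exec c (init xs) t s" "idle S" "fst S (lreg 2) = length xs"
    "\<forall>i<length xs. snd S (larr 2) i = xs ! i"
  shows "lwp (call_code c) (\<lambda>t' S'.
    t' \<le> (30 + length (arrs_of c) + length (regs_of c)) * (t + length xs + length (result s) + 1) \<and>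
    idle S' \<and> fst S' (lreg 3) = length (result s) \<and>
    (\<forall>i<length (result s). snd S' (larr 3) i = result s ! i) \<and>
    (\<forall>a. a \<noteq> 3 \<longrightarrow> fst S' (lreg a) = fst S (lreg a) \<and> snd S' (larr a) = snd S (larr a)) \<and>
    (\<forall>x. fst S' (sreg x) = fst S (sreg x))) S"
  unfolding call_code_def lwp_Seq
proof (rule lwp_mono[OF lwp_copy_in[OF assms(2-4)]], elim conjE,
    rule lwp_mono[OF lwp_inst[OF assms(1)]], assumption, elim conjE)
  fix t1 S1 t2 S2
  assume t1: "t1 \<le> 7 * length xs + 6" and S1: "caller_eq S S1" "fst S1 (treg 0) = length xs"
    and t2: "t2 \<le> 3 * t" and S2: "sim s S2" "caller_eq S1 S2" "fst S2 (treg 0) \<le> fst S1 (treg 0) + t"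
  let ?ys = "result s"
  have creg0: "fst S2 (creg 0) = length ?ys" using S2(1) by (simp add: sim_def result_def)
  have carr: "\<And>a. snd S2 (carr a) = snd s a" using S2(1) by (simp add: sim_def)
  have "fst S2 (treg 1) = 1" using S2(1) by (simp add: sim_def)
  then have out: "lwp copy_out (\<lambda>t S'. t \<le> 5 * fst S2 (creg 0) + 5 \<and> fst S' (lreg 3) = fst S2 (creg 0) \<and>
    (\<forall>i<fst S2 (creg 0). snd S' (larr 3) i = snd S2 (carr 0) i) \<and>
    (\<forall>a. a \<noteq> 3 \<longrightarrow> fst S' (lreg a) = fst S2 (lreg a) \<and> snd S' (larr a) = snd S2 (larr a)) \<and>
    (\<forall>x. fst S' (sreg x) = fst S2 (sreg x)) \<and>
    (\<forall>x. fst S' (creg x) = fst S2 (creg x)) \<and> (\<forall>a. snd S' (carr a) = snd S2 (carr a)) \<and>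
    fst S' (treg 0) = fst S2 (treg 0) \<and> fst S' (treg 1) = 1 \<and> snd S' logarr = snd S2 logarr) S2"
    by (rule lwp_copy_out)
  show "lwp copy_out (\<lambda>t3. lwp (clean_arrs (0 # arrs_of c)) (\<lambda>t4. lwp (clean_regs (0 # regs_of c))
    (\<lambda>t5 S'. t1 + (t2 + (t3 + (t4 + t5))) \<le>
      (30 + length (arrs_of c) + length (regs_of c)) * (t + length xs + length ?ys + 1) \<and>
    idle S' \<and> fst S' (lreg 3) = length ?ys \<and>
    (\<forall>i<length ?ys. snd S' (larr 3) i = ?ys ! i) \<and>
    (\<forall>a. a \<noteq> 3 \<longrightarrow> fst S' (lreg a) = fst S (lreg a) \<and> snd S' (larr a) = snd S (larr a)) \<and>
    (\<forall>x. fst S' (sreg x) = fst S (sreg x))))) S2"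
  proof (rule lwp_mono[OF out], elim conjE)
    fix t3 S3
    assume t3: "t3 \<le> 5 * fst S2 (creg 0) + 5"
      and S3: "fst S3 (lreg 3) = fst S2 (creg 0)"
        "\<forall>i<fst S2 (creg 0). snd S3 (larr 3) i = snd S2 (carr 0) i"
        "\<forall>a. a \<noteq> 3 \<longrightarrow> fst S3 (lreg a) = fst S2 (lreg a) \<and> snd S3 (larr a) = snd S2 (larr a)"
        "\<forall>x. fst S3 (sreg x) = fst S2 (sreg x)"
        "\<forall>x. fst S3 (creg x) = fst S2 (creg x)" "\<forall>a. snd S3 (carr a) = snd S2 (carr a)"
        "fst S3 (treg 0) = fst S2 (treg 0)" "fst S3 (treg 1) = 1"
        "snd S3 logarr = snd S2 logarr"
    obtain R3 M3 where S3': "S3 = (R3, M3)" by (cases S3)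
    have arrs: "lwp (clean_arrs (0 # arrs_of c)) (\<lambda>t S'. t \<le> R3 (treg 0) * (length (0 # arrs_of c) + 4) + 2 \<and>
       (\<forall>a. fst S' (lreg a) = R3 (lreg a)) \<and> (\<forall>x. fst S' (sreg x) = R3 (sreg x)) \<and>
       (\<forall>x. fst S' (creg x) = R3 (creg x)) \<and> (\<forall>a. snd S' (larr a) = M3 (larr a)) \<and>
       (\<forall>a i. snd S' (carr a) i = 0)) (R3, M3)"
    proof (rule lwp_clean_arrs)
      show "R3 (treg 1) = 1" using S3 by (simp add: S3')
    next
      fix a i
      assume nz: "M3 (carr a) i \<noteq> 0"
      then have "snd s a i \<noteq> 0" using S3(6) carr by (simp add: S3')
      then have "\<exists>j<fst S2 (treg 0). snd S2 logarr j = i" using S2(1) by (simp add: sim_def)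
      moreover have "a \<in> set (0 # arrs_of c)"
      proof (rule ccontr)
        assume "a \<notin> set (0 # arrs_of c)"
        then have "snd s a i = 0"
          using exec_unchanged(2)[OF assms(1)] by (auto simp: init_def)
        with \<open>snd s a i \<noteq> 0\<close> show False by simp
      qed
      ultimately show "a \<in> set (0 # arrs_of c) \<and> (\<exists>j<R3 (treg 0). M3 logarr j = i)"
        using S3 by (simp add: S3')
    qed
    show "lwp (clean_arrs (0 # arrs_of c)) (\<lambda>t4. lwp (clean_regs (0 # regs_of c))
      (\<lambda>t5 S'. t1 + (t2 + (t3 + (t4 + t5))) \<le>
        (30 + length (arrs_of c) + length (regs_of c)) * (t + length xs + length ?ys + 1) \<and>
      idle S' \<and> fst S' (lreg 3) = length ?ys \<and>
      (\<forall>i<length ?ys. snd S' (larr 3) i = ?ys ! i) \<and>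
      (\<forall>a. a \<noteq> 3 \<longrightarrow> fst S' (lreg a) = fst S (lreg a) \<and> snd S' (larr a) = snd S (larr a)) \<and>
      (\<forall>x. fst S' (sreg x) = fst S (sreg x)))) S3"
      unfolding S3'
    proof (rule lwp_mono[OF arrs], elim conjE)
      fix t4 S4
      assume t4: "t4 \<le> R3 (treg 0) * (length (0 # arrs_of c) + 4) + 2"
        and S4: "\<forall>a. fst S4 (lreg a) = R3 (lreg a)" "\<forall>x. fst S4 (sreg x) = R3 (sreg x)"
          "\<forall>x. fst S4 (creg x) = R3 (creg x)" "\<forall>a. snd S4 (larr a) = M3 (larr a)"
          "\<forall>a i. snd S4 (carr a) i = 0"
      obtain R4 M4 where S4': "S4 = (R4, M4)" by (cases S4)
      have regs: "R4 (creg x) = 0" if "x \<notin> set (0 # regs_of c)" for x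
      proof -
        have "fst s x = 0"
          using that exec_unchanged(1)[OF assms(1)] by (auto simp: init_def)
        then show ?thesis using S4 S3 S2(1) by (simp add: S3' S4' sim_def)
      qed
      have "R3 (treg 0) \<le> t + length xs" using S1 S2 S3 by (simp add: S3')
      then have "R3 (treg 0) * (length (0 # arrs_of c) + 4) \<le> (t + length xs) * (length (arrs_of c) + 5)"
        by (intro mult_mono) auto
      then have time: "t1 + (t2 + (t3 + (t4 + (length (0 # regs_of c) + 1)))) \<le>
        (30 + length (arrs_of c) + length (regs_of c)) * (t + length xs + length ?ys + 1)"
        using t1 t2 t3 t4 unfolding creg0 by (simp add: algebra_simps)
      have res: "\<forall>i<length ?ys. ?ys ! i = snd s 0 i"
        by (simp add: result_def)
      show "lwp (clean_regs (0 # regs_of c))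
        (\<lambda>t5 S'. t1 + (t2 + (t3 + (t4 + t5))) \<le>
          (30 + length (arrs_of c) + length (regs_of c)) * (t + length xs + length ?ys + 1) \<and>
        idle S' \<and> fst S' (lreg 3) = length ?ys \<and>
        (\<forall>i<length ?ys. snd S' (larr 3) i = ?ys ! i) \<and>
        (\<forall>a. a \<noteq> 3 \<longrightarrow> fst S' (lreg a) = fst S (lreg a) \<and> snd S' (larr a) = snd S (larr a)) \<and>
        (\<forall>x. fst S' (sreg x) = fst S (sreg x))) S4"
        unfolding S4'
      proof (rule lwp_mono[OF lwp_clean_regs], elim conjE)
        fix t5 S5
        assume S5: "t5 = length (0 # regs_of c) + 1" "snd S5 = M4" "\<forall>a. fst S5 (lreg a) = R4 (lreg a)"
          "\<forall>a. fst S5 (sreg a) = R4 (sreg a)"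
          "\<forall>x. fst S5 (creg x) = (if x \<in> set (0 # regs_of c) then 0 else R4 (creg x))"
        have "idle S5" using S5 S4 regs by (simp add: idle_def S4')
        moreover have "t1 + (t2 + (t3 + (t4 + t5))) \<le>
          (30 + length (arrs_of c) + length (regs_of c)) * (t + length xs + length ?ys + 1)"
          using time S5(1) by simp
        moreover have "fst S5 (lreg 3) = length ?ys" using S5 S4 S3 creg0 by (simp add: S3' S4')
        moreover have "\<forall>i<length ?ys. snd S5 (larr 3) i = ?ys ! i"
          using S5 S4 S3 creg0 carr res by (simp add: S3' S4')
        moreover have "\<forall>a. a \<noteq> 3 \<longrightarrow> fst S5 (lreg a) = fst S (lreg a) \<and> snd S5 (larr a) = snd S (larr a)"
          "\<forall>x. fst S5 (sreg x) = fst S (sreg x)"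
          using S5 S4 S3 S1 S2 by (simp_all add: S3' S4' caller_eq_def)
        ultimately show "t1 + (t2 + (t3 + (t4 + t5))) \<le>
          (30 + length (arrs_of c) + length (regs_of c)) * (t + length xs + length ?ys + 1) \<and>
        idle S5 \<and> fst S5 (lreg 3) = length ?ys \<and>
        (\<forall>i<length ?ys. snd S5 (larr 3) i = ?ys ! i) \<and>
        (\<forall>a. a \<noteq> 3 \<longrightarrow> fst S5 (lreg a) = fst S (lreg a) \<and> snd S5 (larr a) = snd S (larr a)) \<and>
        (\<forall>x. fst S5 (sreg x) = fst S (sreg x))"
          by blast
      qed
    qed
  qed
qed

subsection \<open>Expressions and commands\<close>

text \<open>Temporaries form a stack: at depth \<open>k\<close> the value ends up in
  \<open>treg k\<close> and no lower temporary is touched. \<open>Idx\<close> first computes length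
  minus index, which is nonzero exactly when the index is in range. This test is essential because
  \<open>Clear\<close> only resets a length and leaves stale cells behind.\<close>

fun cexp :: "nat \<Rightarrow> exp \<Rightarrow> com" where
  "cexp k (N n) = Const (treg k) n"
| "cexp k (V x) = Seq (Const (treg k) 0) (Add (treg k) (treg k) (sreg x))"
| "cexp k (Len a) = Seq (Const (treg k) 0) (Add (treg k) (treg k) (lreg a))"
| "cexp k (Idx a e) = Seq (cexp k e) (Seq (Sub (treg (k + 1)) (lreg a) (treg k))
     (IfNZ (treg (k + 1)) (Load (treg k) (larr a) (treg k)) (Const (treg k) 0)))"
| "cexp k (Plus e1 e2) = Seq (cexp k e1) (Seq (cexp (k + 1) e2) (Add (treg k) (treg k) (treg (k + 1))))"
| "cexp k (Minus e1 e2) = Seq (cexp k e1) (Seq (cexp (k + 1) e2) (Sub (treg k) (treg k) (treg (k + 1))))"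

fun ecost :: "exp \<Rightarrow> nat" where
  "ecost (N n) = 1"
| "ecost (V x) = 2"
| "ecost (Len a) = 2"
| "ecost (Idx a e) = ecost e + 3"
| "ecost (Plus e1 e2) = ecost e1 + ecost e2 + 1"
| "ecost (Minus e1 e2) = ecost e1 + ecost e2 + 1"

definition rel :: "hstate \<Rightarrow> state \<Rightarrow> bool" where
  "rel s S \<longleftrightarrow> idle S \<and> (\<forall>x. fst S (sreg x) = fst s x) \<and>
     (\<forall>a. fst S (lreg a) = length (snd s a)) \<and>
     (\<forall>a. \<forall>i<length (snd s a). snd S (larr a) i = snd s a ! i)"

lemma rel_temp:
  assumes "rel s (R, M)" "\<forall>x. (\<forall>j\<ge>k. x \<noteq> treg j) \<longrightarrow> R' x = R x"
  shows "rel s (R', M)"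
  using assms by (simp add: rel_def idle_def)

lemma lwp_cexp:
  "rel s (R, M) \<Longrightarrow> lwp (cexp k e) (\<lambda>t (R', M'). t \<le> ecost e \<and> M' = M \<and> R' (treg k) = ev e s \<and>
     (\<forall>x. (\<forall>j\<ge>k. x \<noteq> treg j) \<longrightarrow> R' x = R x)) (R, M)"
proof (induction e arbitrary: k R)
  case (Idx a e)
  show ?case
    unfolding cexp.simps lwp_Seq
  proof (rule lwp_mono[OF Idx.IH[OF Idx.prems]], clarify)
    fix t R1
    assume "t \<le> ecost e" and R1: "R1 (treg k) = ev e s" "\<forall>x. (\<forall>j\<ge>k. x \<noteq> treg j) \<longrightarrow> R1 x = R x"
    have "rel s (R1, M)" using rel_temp[OF Idx.prems R1(2)] .
    with R1 \<open>t \<le> ecost e\<close> show "lwp (Sub (treg (k + 1)) (lreg a) (treg k)) (\<lambda>ta.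
      lwp (IfNZ (treg (k + 1)) (Load (treg k) (larr a) (treg k)) (Const (treg k) 0))
      (\<lambda>t' (R', M'). t + (ta + t') \<le> ecost (Idx a e) \<and> M' = M \<and> R' (treg k) = ev (Idx a e) s \<and>
        (\<forall>x. (\<forall>j\<ge>k. x \<noteq> treg j) \<longrightarrow> R' x = R x))) (R1, M)"
      by (simp add: rel_def)
  qed
next
  case (Plus e1 e2)
  show ?case
    unfolding cexp.simps lwp_Seq
  proof (rule lwp_mono[OF Plus.IH(1)[OF Plus.prems]], clarify)
    fix t R1
    assume t: "t \<le> ecost e1" and R1: "R1 (treg k) = ev e1 s" "\<forall>x. (\<forall>j\<ge>k. x \<noteq> treg j) \<longrightarrow> R1 x = R x"
    have "rel s (R1, M)" using rel_temp[OF Plus.prems R1(2)] .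
    then show "lwp (cexp (k + 1) e2) (\<lambda>ta. lwp (Add (treg k) (treg k) (treg (k + 1)))
      (\<lambda>t' (R', M'). t + (ta + t') \<le> ecost (Plus e1 e2) \<and> M' = M \<and> R' (treg k) = ev (Plus e1 e2) s \<and>
        (\<forall>x. (\<forall>j\<ge>k. x \<noteq> treg j) \<longrightarrow> R' x = R x))) (R1, M)"
      by (rule lwp_mono[OF Plus.IH(2)]) (use t R1 in auto)
  qed
next
  case (Minus e1 e2)
  show ?case
    unfolding cexp.simps lwp_Seq
  proof (rule lwp_mono[OF Minus.IH(1)[OF Minus.prems]], clarify)
    fix t R1
    assume t: "t \<le> ecost e1" and R1: "R1 (treg k) = ev e1 s" "\<forall>x. (\<forall>j\<ge>k. x \<noteq> treg j) \<longrightarrow> R1 x = R x"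
    have "rel s (R1, M)" using rel_temp[OF Minus.prems R1(2)] .
    then show "lwp (cexp (k + 1) e2) (\<lambda>ta. lwp (Sub (treg k) (treg k) (treg (k + 1)))
      (\<lambda>t' (R', M'). t + (ta + t') \<le> ecost (Minus e1 e2) \<and> M' = M \<and> R' (treg k) = ev (Minus e1 e2) s \<and>
        (\<forall>x. (\<forall>j\<ge>k. x \<noteq> treg j) \<longrightarrow> R' x = R x))) (R1, M)"
      by (rule lwp_mono[OF Minus.IH(2)]) (use t R1 in auto)
  qed
qed (simp_all add: rel_def)

fun compile :: "com \<Rightarrow> cmd \<Rightarrow> com" where
  "compile c (Assign x e) = Seq (cexp 0 e) (Seq (Const (sreg x) 0) (Add (sreg x) (sreg x) (treg 0)))"
| "compile c (Clear a) = Const (lreg a) 0"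
| "compile c (Push a e) = Seq (cexp 0 e) (Seq (Store (larr a) (lreg a) (treg 0))
     (Seq (Const (treg 0) 1) (Add (lreg a) (lreg a) (treg 0))))"
| "compile c (Update a e1 e2) = Seq (cexp 0 e1) (Seq (cexp 1 e2) (Store (larr a) (treg 0) (treg 1)))"
| "compile c (C1 ;; C2) = Seq (compile c C1) (compile c C2)"
| "compile c (Cond e C1 C2) = Seq (cexp 0 e) (IfNZ (treg 0) (compile c C1) (compile c C2))"
| "compile c (While e C) = Seq (cexp 0 e) (WhileNZ (treg 0) (Seq (compile c C) (cexp 0 e)))"
| "compile c Call = call_code c"

text \<open>A bound on machine steps per step of \<open>hexec\<close>. Loops enter without an
  iteration count, since repetitions are already counted by \<open>hexec\<close>.\<close>

fun cost :: "com \<Rightarrow> cmd \<Rightarrow> nat" where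
  "cost c (Assign x e) = ecost e + 2"
| "cost c (Clear a) = 1"
| "cost c (Push a e) = ecost e + 3"
| "cost c (Update a e1 e2) = ecost e1 + ecost e2 + 1"
| "cost c (C1 ;; C2) = cost c C1 + cost c C2"
| "cost c (Cond e C1 C2) = ecost e + cost c C1 + cost c C2 + 1"
| "cost c (While e C) = ecost e + cost c C + 1"
| "cost c Call = 30 + length (arrs_of c) + length (regs_of c)"

lemma lwp_cexp_rel:
  assumes "rel s S"
  shows "lwp (cexp k e) (\<lambda>t S'. t \<le> ecost e \<and> fst S' (treg k) = ev e s \<and> rel s S' \<and>
     (\<forall>j<k. fst S' (treg j) = fst S (treg j))) S"
proof -
  obtain R M where S: "S = (R, M)" by (cases S)
  show ?thesis
    unfolding S
    by (rule lwp_mono[OF lwp_cexp[OF assms[unfolded S]]]) (auto intro: rel_temp[OF assms[unfolded S]])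
qed

text \<open>Allowing any \<open>K\<close> above the cost lets all subcommands share the constant of
  the whole program during the induction.\<close>

lemma lwp_compile:
  "hexec c C s t s' \<Longrightarrow> cost c C \<le> K \<Longrightarrow> rel s S \<Longrightarrow>
   lwp (compile c C) (\<lambda>t' S'. t' \<le> K * t \<and> rel s' S') S"
proof (induction arbitrary: S rule: hexec.induct)
  case (Assign x e r l)
  show ?case
    unfolding compile.simps lwp_Seq
  proof (rule lwp_mono[OF lwp_cexp_rel[OF Assign(2)]], elim conjE, goal_cases)
    case (1 t S1)
    obtain R M where S1: "S1 = (R, M)" by (cases S1)
    show ?case using 1 Assign(1) by (simp add: S1 rel_def idle_def)
  qed
next
  case (Clear a r l)
  then show ?case by (cases S) (simp add: rel_def idle_def)
next
  case (Push a e r l)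
  show ?case
    unfolding compile.simps lwp_Seq
  proof (rule lwp_mono[OF lwp_cexp_rel[OF Push(2)]], elim conjE, goal_cases)
    case (1 t S1)
    obtain R M where S1: "S1 = (R, M)" by (cases S1)
    show ?case using 1 Push(1) by (simp add: S1 rel_def idle_def nth_append)
  qed
next
  case (Update a e1 e2 r l)
  show ?case
    unfolding compile.simps lwp_Seq
  proof (rule lwp_mono[OF lwp_cexp_rel[OF Update(2)]], elim conjE,
      rule lwp_mono[OF lwp_cexp_rel], assumption, elim conjE, goal_cases)
    case (1 t1 S1 t2 S2)
    obtain R M where S2: "S2 = (R, M)" by (cases S2)
    show ?case using 1 Update(1) by (simp add: S2 rel_def idle_def nth_list_update)
  qed
next
  case (Then C1 s t1 s' C2 t2 s'')
  from Then.prems have K: "cost c C1 \<le> K" "cost c C2 \<le> K" by auto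
  show ?case
    unfolding compile.simps lwp_Seq
    by (rule lwp_mono[OF Then.IH(1)[OF K(1) Then.prems(2)]], elim conjE,
        rule lwp_mono[OF Then.IH(2)[OF K(2)]]) (auto simp: algebra_simps)
next
  case (IfTrue e s C1 t s' C2)
  from IfTrue.prems have K: "cost c C1 \<le> K" "ecost e + 1 \<le> K" by auto
  show ?case
    unfolding compile.simps lwp_Seq
  proof (rule lwp_mono[OF lwp_cexp_rel[OF IfTrue.prems(2)]], elim conjE, goal_cases)
    case (1 t1 S1)
    with IfTrue(1) K show ?case
      by (auto intro!: lwp_mono[OF IfTrue.IH[OF K(1)]])
  qed
next
  case (IfFalse e s C2 t s' C1)
  from IfFalse.prems have K: "cost c C2 \<le> K" "ecost e + 1 \<le> K" by auto
  show ?case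
    unfolding compile.simps lwp_Seq
  proof (rule lwp_mono[OF lwp_cexp_rel[OF IfFalse.prems(2)]], elim conjE, goal_cases)
    case (1 t1 S1)
    with IfFalse(1) K show ?case
      by (auto intro!: lwp_mono[OF IfFalse.IH[OF K(1)]])
  qed
next
  case (WhileFalse e s C)
  from WhileFalse.prems have K: "ecost e + 1 \<le> K" by auto
  show ?case
    unfolding compile.simps lwp_Seq
  proof (rule lwp_mono[OF lwp_cexp_rel[OF WhileFalse.prems(2)]], elim conjE, goal_cases)
    case (1 t1 S1)
    with WhileFalse(1) K show ?case
      by (subst lwp_While_unfold) auto
  qed
next
  case (WhileTrue e s C t1 s' t2 s'')
  from WhileTrue.prems have K: "cost c C \<le> K" "ecost e + 1 \<le> K" "cost c (While e C) \<le> K" by auto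
  show ?case
    unfolding compile.simps lwp_Seq
  proof (rule lwp_mono[OF lwp_cexp_rel[OF WhileTrue.prems(2)]], elim conjE, goal_cases)
    case (1 u0 S0)
    have "lwp (compile c C) (\<lambda>u1. lwp (cexp 0 e) (\<lambda>u2. lwp (WhileNZ (treg 0) (Seq (compile c C) (cexp 0 e)))
      (\<lambda>u3 S'. u0 + (1 + (u1 + u2) + u3) \<le> K * (1 + t1 + t2) \<and> rel s'' S'))) S0"
    proof (rule lwp_mono[OF WhileTrue.IH(1)[OF K(1)]], rule 1, elim conjE, goal_cases)
      case (1 u1 S1)
      \<comment> \<open>The guard evaluation that ends the loop body is regrouped with the remaining
        iterations; together they are the compiled \<open>While\<close> again, to which the
        induction hypothesis applies.\<close>
      have "lwp (cexp 0 e) (\<lambda>u2. lwp (WhileNZ (treg 0) (Seq (compile c C) (cexp 0 e)))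
        (\<lambda>u3 S'. u2 + u3 \<le> K * t2 \<and> rel s'' S')) S1"
        using WhileTrue.IH(2)[OF K(3) 1(2)] by simp
      then show ?case
      proof (rule lwp_mono, elim lwp_mono, elim conjE, goal_cases)
        case (1 u2 S2 u3 S3)
        then show ?case using \<open>u1 \<le> K * t1\<close> \<open>u0 \<le> ecost e\<close> K(2) by (simp add: algebra_simps)
      qed
    qed
    then show ?case
      using 1 WhileTrue(1) by (subst lwp_While_unfold) simp
  qed
next
  case (Call l t s r)
  have "idle S" "fst S (lreg 2) = length (l 2)" "\<forall>i<length (l 2). snd S (larr 2) i = l 2 ! i"
    using Call.prems(2) by (simp_all add: rel_def)
  from lwp_call_code[OF Call(1) this] show ?case
    unfolding compile.simps
  proof (rule lwp_mono, elim conjE, goal_cases)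
    case (1 t' S')
    have "cost c Call * (t + length (l 2) + length (result s) + 1) \<le> K * (t + length (l 2) + length (result s) + 1)"
      using Call.prems(1) by (rule mult_le_mono1)
    with 1 Call.prems show ?case
      by (auto simp: rel_def)
  qed
qed

section \<open>Polynomial-time reductions\<close>

definition wp :: "com \<Rightarrow> cmd \<Rightarrow> (nat \<Rightarrow> hstate \<Rightarrow> bool) \<Rightarrow> hstate \<Rightarrow> bool" where
  "wp c C Q s \<longleftrightarrow> (\<exists>t s'. hexec c C s t s' \<and> Q t s')"

definition hinit :: "nat list \<Rightarrow> hstate" where
  "hinit xs = ((\<lambda>_. 0), (\<lambda>_. [])(0 := xs))"

text \<open>\<open>lreg 0\<close> and \<open>larr 0\<close> are 0, so the machine's input convention
  is already the representation of list 0, and no other list, scalar or oracle cell overlaps it. For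
  the same reason list 0 is the output.\<close>

lemma rel_hinit: "rel (hinit xs) (init xs)"
proof -
  have nz: "creg x \<noteq> 0" "sreg x \<noteq> 0" "carr x \<noteq> 0" for x
    by (simp_all add: creg_def sreg_def carr_def)
  show ?thesis
    by (auto simp: nz rel_def hinit_def init_def idle_def lreg_def larr_def)
qed

definition poly_bounded :: "(nat \<Rightarrow> nat) \<Rightarrow> bool" where
  "poly_bounded f \<longleftrightarrow> (\<exists>p. \<forall>n. f n \<le> poly p n)"

lemma poly_mono_nat: "m \<le> n \<Longrightarrow> poly p m \<le> poly (p :: nat poly) n"
  by (induction p) (auto intro!: add_mono mult_mono)

lemma poly_bounded_const [intro]: "poly_bounded (\<lambda>_. k)"
  unfolding poly_bounded_def by (rule exI[of _ "[:k:]"]) simp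

lemma poly_bounded_id [intro]: "poly_bounded (\<lambda>n. n)"
  unfolding poly_bounded_def by (rule exI[of _ "[:0, 1:]"]) simp

lemma poly_bounded_add [intro]:
  assumes "poly_bounded f" "poly_bounded g" shows "poly_bounded (\<lambda>n. f n + g n)"
proof -
  obtain p q where "\<And>n. f n \<le> poly p n" "\<And>n. g n \<le> poly q n"
    using assms by (auto simp: poly_bounded_def)
  then show ?thesis
    unfolding poly_bounded_def by (intro exI[of _ "p + q"]) (simp add: add_mono)
qed

lemma poly_bounded_mult [intro]:
  assumes "poly_bounded f" "poly_bounded g" shows "poly_bounded (\<lambda>n. f n * g n)"
proof -
  obtain p q where "\<And>n. f n \<le> poly p n" "\<And>n. g n \<le> poly q n"
    using assms by (auto simp: poly_bounded_def)
  then show ?thesis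
    unfolding poly_bounded_def by (intro exI[of _ "p * q"]) (simp add: mult_mono)
qed

lemma poly_bounded_poly [intro]:
  assumes "poly_bounded f" shows "poly_bounded (\<lambda>n. poly p (f n))"
proof -
  obtain q where "\<And>n. f n \<le> poly q n"
    using assms by (auto simp: poly_bounded_def)
  then show ?thesis
    unfolding poly_bounded_def
    by (intro exI[of _ "pcompose p q"]) (simp add: poly_pcompose poly_mono_nat)
qed

text \<open>The form in which reductions are concluded: \<open>C\<close> may call \<open>c\<close>,
  but as \<open>c\<close> is a fixed program, the compiled \<open>C\<close> is an ordinary machine
  program, slower by the constant factor \<open>cost c C\<close> only.\<close>

lemma polytime_solvableI:
  assumes f: "poly_bounded f"
    and C: "\<And>xs Y. (xs, Y) \<in> Q \<Longrightarrow>
      wp c C (\<lambda>t s. t + length (snd s 0) \<le> f (bit_size xs) \<and> snd s 0 \<in> Y) (hinit xs)"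
  shows "polytime_solvable Q"
proof -
  let ?K = "cost c C + 1"
  have "poly_bounded (\<lambda>n. ?K * f n)"
    by (intro poly_bounded_mult poly_bounded_const f)
  then obtain p where p: "\<And>n. ?K * f n \<le> poly p n" unfolding poly_bounded_def by blast
  have "\<exists>t s. exec (compile c C) (init xs) t s \<and> t + length (result s) \<le> poly p (bit_size xs) \<and> result s \<in> Y"
    if Q: "(xs, Y) \<in> Q" for xs Y
  proof -
    obtain t s where h: "hexec c C (hinit xs) t s"
      and t: "t + length (snd s 0) \<le> f (bit_size xs)" and Y: "snd s 0 \<in> Y"
      using C[OF Q] unfolding wp_def by blast
    have "lwp (compile c C) (\<lambda>t' S'. t' \<le> ?K * t \<and> rel s S') (init xs)"
      by (rule lwp_compile[OF h _ rel_hinit]) simp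
    then obtain t' S' where e: "exec (compile c C) (init xs) t' S'" and t': "t' \<le> ?K * t" and rel: "rel s S'"
      by (elim lwpE) auto
    have "result S' = snd s 0"
    proof (rule nth_equalityI)
      show "length (result S') = length (snd s 0)"
        using rel by (simp add: result_def rel_def lreg_def) (metis mult_0_right)
      fix i assume "i < length (result S')"
      then have "i < length (snd s 0)"
        using rel by (simp add: result_def rel_def lreg_def) (metis mult_0_right)
      then have "snd S' (larr 0) i = snd s 0 ! i"
        using rel by (simp add: rel_def)
      then show "result S' ! i = snd s 0 ! i"
        using \<open>i < length (result S')\<close> by (simp add: result_def larr_def)
    qed
    moreover have "t' + length (snd s 0) \<le> ?K * (t + length (snd s 0))"
      using t' by (simp add: algebra_simps)
    moreover have "?K * (t + length (snd s 0)) \<le> ?K * f (bit_size xs)"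
      using t by (rule mult_le_mono2)
    ultimately show ?thesis using e Y p[of "bit_size xs"] by (intro exI[of _ t'] exI[of _ S']) auto
  qed
  then show ?thesis unfolding polytime_solvable_def by blast
qed

subsection \<open>Verification rules\<close>

inductive_cases hexec_elims:
  "hexec c (Assign x e) s t s'" "hexec c (Clear a) s t s'" "hexec c (Push a e) s t s'"
  "hexec c (Update a e1 e2) s t s'" "hexec c Call s t s'"
inductive_cases hexec_ThenE: "hexec c (C1 ;; C2) s t s'"
inductive_cases hexec_IfE: "hexec c (Cond e C1 C2) s t s'"

lemma wpI: "hexec c C s t s' \<Longrightarrow> Q t s' \<Longrightarrow> wp c C Q s"
  unfolding wp_def by (intro exI conjI)

lemma wpE:
  assumes "wp c C Q s" obtains t s' where "hexec c C s t s'" "Q t s'"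
  using assms unfolding wp_def by (elim exE conjE)

lemma hexec_iffs:
  "hexec c (Assign x e) (r, l) t s' \<longleftrightarrow> t = 1 \<and> s' = (r(x := ev e (r, l)), l)"
  "hexec c (Clear a) (r, l) t s' \<longleftrightarrow> t = 1 \<and> s' = (r, l(a := []))"
  "hexec c (Push a e) (r, l) t s' \<longleftrightarrow> t = 1 \<and> s' = (r, l(a := l a @ [ev e (r, l)]))"
  "hexec c (Update a e1 e2) (r, l) t s' \<longleftrightarrow> t = 1 \<and> s' = (r, l(a := (l a)[ev e1 (r, l) := ev e2 (r, l)]))"
  by (auto elim: hexec_elims intro: hexec.intros simp del: One_nat_def)

lemma wp_simps [simp]:
  "wp c (Assign x e) Q (r, l) \<longleftrightarrow> Q 1 (r(x := ev e (r, l)), l)"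
  "wp c (Clear a) Q (r, l) \<longleftrightarrow> Q 1 (r, l(a := []))"
  "wp c (Push a e) Q (r, l) \<longleftrightarrow> Q 1 (r, l(a := l a @ [ev e (r, l)]))"
  "wp c (Update a e1 e2) Q (r, l) \<longleftrightarrow> Q 1 (r, l(a := (l a)[ev e1 (r, l) := ev e2 (r, l)]))"
  by (simp_all add: wp_def hexec_iffs del: split_paired_Ex)

lemma wp_Then [simp]:
  "wp c (C1 ;; C2) Q s \<longleftrightarrow> wp c C1 (\<lambda>t. wp c C2 (\<lambda>t'. Q (t + t'))) s"
proof
  assume "wp c (C1 ;; C2) Q s"
  then show "wp c C1 (\<lambda>t. wp c C2 (\<lambda>t'. Q (t + t'))) s"
    by (elim wpE hexec_ThenE) (intro wpI, assumption+, simp)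
next
  assume "wp c C1 (\<lambda>t. wp c C2 (\<lambda>t'. Q (t + t'))) s"
  then show "wp c (C1 ;; C2) Q s"
    by (elim wpE) (intro wpI[OF hexec.Then])
qed

lemma wp_If [simp]:
  "wp c (Cond e C1 C2) Q s \<longleftrightarrow>
     (if ev e s \<noteq> 0 then wp c C1 (\<lambda>t. Q (1 + t)) s else wp c C2 (\<lambda>t. Q (1 + t)) s)"
    (is "?L \<longleftrightarrow> ?R")
proof
  assume ?L
  then show ?R
    by (elim wpE hexec_IfE) (simp_all, (intro wpI, assumption, simp)+)
next
  assume R: ?R
  show ?L
  proof (cases "ev e s = 0")
    case True
    with R have "wp c C2 (\<lambda>t. Q (1 + t)) s" by simp
    with True show ?thesis by (elim wpE) (intro wpI[OF hexec.IfFalse])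
  next
    case False
    with R have "wp c C1 (\<lambda>t. Q (1 + t)) s" by simp
    with False show ?thesis by (elim wpE) (intro wpI[OF hexec.IfTrue])
  qed
qed

lemma wp_WhileFalse: "ev e s = 0 \<Longrightarrow> Q 1 s \<Longrightarrow> wp c (While e C) Q s"
  by (intro wpI[OF hexec.WhileFalse])

lemma wp_WhileTrue:
  "ev e s \<noteq> 0 \<Longrightarrow> wp c C (\<lambda>t. wp c (While e C) (\<lambda>t'. Q (1 + t + t'))) s \<Longrightarrow> wp c (While e C) Q s"
  by (elim wpE) (intro wpI[OF hexec.WhileTrue])

definition solves_in :: "com \<Rightarrow> nat poly \<Rightarrow> (nat list \<times> nat list set) set \<Rightarrow> bool" where
  "solves_in c p Q \<longleftrightarrow> (\<forall>(xs, Y)\<in>Q. \<exists>t s.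
     exec c (init xs) t s \<and> t + length (result s) \<le> poly p (bit_size xs) \<and> result s \<in> Y)"

text \<open>The factor 2 arises because the answer's length is counted both in the cost of the call
  and in the summand \<open>length ys\<close>.\<close>

lemma wp_Call:
  assumes "solves_in c p P" "(l 2, Y) \<in> P"
    and "\<And>ys t. ys \<in> Y \<Longrightarrow> t + length ys \<le> 2 * poly p (bit_size (l 2)) + length (l 2) + 1 \<Longrightarrow>
      Q t (r, l(3 := ys))"
  shows "wp c Call Q (r, l)"
proof -
  obtain t s where *: "exec c (init (l 2)) t s" "t + length (result s) \<le> poly p (bit_size (l 2))"
      "result s \<in> Y"
    using assms(1,2) unfolding solves_in_def by blast
  show ?thesis
    by (rule wpI[OF hexec.Call[where l = l and r = r, OF *(1)]]) (use *(2,3) in \<open>auto intro!: assms(3)\<close>)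
qed

section \<open>Syntactic frames and counted loops\<close>

fun fv :: "exp \<Rightarrow> nat set" where
  "fv (N n) = {}"
| "fv (V x) = {x}"
| "fv (Len a) = {}"
| "fv (Idx a e) = fv e"
| "fv (Plus e1 e2) = fv e1 \<union> fv e2"
| "fv (Minus e1 e2) = fv e1 \<union> fv e2"

fun fl :: "exp \<Rightarrow> nat set" where
  "fl (N n) = {}"
| "fl (V x) = {}"
| "fl (Len a) = {a}"
| "fl (Idx a e) = insert a (fl e)"
| "fl (Plus e1 e2) = fl e1 \<union> fl e2"
| "fl (Minus e1 e2) = fl e1 \<union> fl e2"

lemma ev_cong:
  "(\<And>x. x \<in> fv e \<Longrightarrow> r' x = r x) \<Longrightarrow> (\<And>a. a \<in> fl e \<Longrightarrow> l' a = l a) \<Longrightarrow> ev e (r', l') = ev e (r, l)"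
  by (induction e) auto

fun mv :: "cmd \<Rightarrow> nat set" where
  "mv (Assign x e) = {x}"
| "mv (C1 ;; C2) = mv C1 \<union> mv C2"
| "mv (Cond e C1 C2) = mv C1 \<union> mv C2"
| "mv (While e C) = mv C"
| "mv _ = {}"

fun ml :: "cmd \<Rightarrow> nat set" where
  "ml (Assign x e) = {}"
| "ml (Clear a) = {a}"
| "ml (Push a e) = {a}"
| "ml (Update a e1 e2) = {a}"
| "ml (C1 ;; C2) = ml C1 \<union> ml C2"
| "ml (Cond e C1 C2) = ml C1 \<union> ml C2"
| "ml (While e C) = ml C"
| "ml Call = {3}"

lemma hexec_frame:
  assumes "hexec c C s t s'"
  shows "\<forall>x. x \<notin> mv C \<longrightarrow> fst s' x = fst s x" and "\<forall>a. a \<notin> ml C \<longrightarrow> snd s' a = snd s a"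
  using assms by (induction rule: hexec.induct) auto

lemma wp_mono: "wp c C P s \<Longrightarrow> (\<And>t s'. P t s' \<Longrightarrow> Q t s') \<Longrightarrow> wp c C Q s"
  unfolding wp_def by blast

lemma wp_frame:
  assumes "wp c C P (r, l)"
    and "\<And>t r' l'. P t (r', l') \<Longrightarrow> \<forall>x. x \<notin> mv C \<longrightarrow> r' x = r x \<Longrightarrow> \<forall>a. a \<notin> ml C \<longrightarrow> l' a = l a \<Longrightarrow>
      Q t (r', l')"
  shows "wp c C Q (r, l)"
proof -
  from assms(1) obtain t s' where h: "hexec c C (r, l) t s'" "P t s'" by (elim wpE)
  obtain r' l' where s': "s' = (r', l')" by (cases s')
  show ?thesis
    using h hexec_frame[OF h(1)] by (intro wpI[OF h(1)]) (auto simp: s' intro: assms(2))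
qed

definition For :: "nat \<Rightarrow> exp \<Rightarrow> cmd \<Rightarrow> cmd" where
  "For x e C = (Assign x (N 0) ;; While (Minus e (V x)) (C ;; Assign x (Plus (V x) (N 1))))"

text \<open>The language has no skip; the empty branch is an assignment to register 0, which serves
  as a dummy throughout.\<close>

definition When :: "exp \<Rightarrow> cmd \<Rightarrow> cmd" where
  "When e C = Cond e C (Assign 0 (N 0))"

lemma mv_For [simp]: "mv (For x e C) = insert x (mv C)"
  by (simp add: For_def)

lemma ml_For [simp]: "ml (For x e C) = ml C"
  by (simp add: For_def)

lemma mv_When [simp]: "mv (When e C) = insert 0 (mv C)"
  by (simp add: When_def)

lemma ml_When [simp]: "ml (When e C) = ml C"
  by (simp add: When_def)

lemma wp_When [simp]:
  "wp c (When e C) Q (r, l) \<longleftrightarrow>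
     (if ev e (r, l) \<noteq> 0 then wp c C (\<lambda>t. Q (1 + t)) (r, l) else Q 2 (r(0 := 0), l))"
  by (simp add: When_def numeral_2_eq_2)

text \<open>Invariants only need to mention what changes: that everything outside
  \<open>mv C\<close> and \<open>ml C\<close> keeps its value is supplied by the frame property in
  \<open>step\<close> and \<open>post\<close>. Each round pays 2 beyond the body, for the test and
  the increment.\<close>

lemma wp_For:
  assumes x: "x \<notin> mv C" "fv e \<inter> insert x (mv C) = {}" "fl e \<inter> ml C = {}"
    and n: "ev e (r, l) = n"
    and init: "I 0 (r(x := 0)) l"
    and step: "\<And>i r' l'. i < n \<Longrightarrow> I i r' l' \<Longrightarrow> r' x = i \<Longrightarrow>
      \<forall>y. y \<noteq> x \<and> y \<notin> mv C \<longrightarrow> r' y = r y \<Longrightarrow> \<forall>a. a \<notin> ml C \<longrightarrow> l' a = l a \<Longrightarrow>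
      wp c C (\<lambda>t (r'', l''). t \<le> B \<and> I (Suc i) (r''(x := Suc i)) l'') (r', l')"
    and post: "\<And>t r' l'. t \<le> n * (B + 2) + 2 \<Longrightarrow> I n r' l' \<Longrightarrow> r' x = n \<Longrightarrow>
      \<forall>y. y \<noteq> x \<and> y \<notin> mv C \<longrightarrow> r' y = r y \<Longrightarrow> \<forall>a. a \<notin> ml C \<longrightarrow> l' a = l a \<Longrightarrow> Q t (r', l')"
  shows "wp c (For x e C) Q (r, l)"
proof -
  let ?W = "While (Minus e (V x)) (C ;; Assign x (Plus (V x) (N 1)))"
  let ?fr = "\<lambda>r' l'. (\<forall>y. y \<noteq> x \<and> y \<notin> mv C \<longrightarrow> r' y = r y) \<and> (\<forall>a. a \<notin> ml C \<longrightarrow> l' a = l a)"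
  have bound: "ev e (r', l') = n" if "?fr r' l'" for r' l'
    unfolding n[symmetric] by (rule ev_cong) (use that x in auto)
  have main: "wp c ?W (\<lambda>t (r'', l''). t \<le> k * (B + 2) + 1 \<and> I n r'' l'' \<and> r'' x = n \<and> ?fr r'' l'') (r', l')"
    if "k \<le> n" "I (n - k) r' l'" "r' x = n - k" "?fr r' l'" for k r' l'
    using that
  proof (induction k arbitrary: r' l')
    case 0
    then show ?case using bound by (intro wp_WhileFalse) auto
  next
    case (Suc k)
    let ?i = "n - Suc k"
    have i: "?i < n" "Suc ?i = n - k" using Suc.prems(1) by auto
    have "wp c C (\<lambda>t (r'', l''). t \<le> B \<and> I (Suc ?i) (r''(x := Suc ?i)) l'') (r', l')"
      using Suc.prems i by (intro step) auto
    then have "wp c C (\<lambda>t. wp c (Assign x (Plus (V x) (N 1))) (\<lambda>t'. wp c ?W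
      (\<lambda>u (r'', l''). 1 + (t + t') + u \<le> Suc k * (B + 2) + 1 \<and> I n r'' l'' \<and> r'' x = n \<and> ?fr r'' l''))) (r', l')"
    proof (rule wp_frame, goal_cases)
      case (1 t r1 l1)
      have r1x: "r1 x = ?i" using 1 x Suc.prems(3) by simp
      have "wp c ?W (\<lambda>t (r'', l''). t \<le> k * (B + 2) + 1 \<and> I n r'' l'' \<and> r'' x = n \<and> ?fr r'' l'')
          (r1(x := n - k), l1)"
      proof (rule Suc.IH)
        show "I (n - k) (r1(x := n - k)) l1" using 1 i by simp
      qed (use 1 Suc.prems in auto)
      then show ?case
        using 1 i r1x by (auto elim!: wp_mono)
    qed
    moreover have "ev (Minus e (V x)) (r', l') \<noteq> 0"
      using bound[of r' l'] Suc.prems by simp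
    ultimately show ?case
      by (intro wp_WhileTrue) auto
  qed
  have "wp c ?W (\<lambda>t (r'', l''). t \<le> n * (B + 2) + 1 \<and> I n r'' l'' \<and> r'' x = n \<and> ?fr r'' l'') (r(x := 0), l)"
    using init by (intro main) auto
  then show ?thesis
    unfolding For_def by (auto elim!: wp_mono intro!: post)
qed

lemma wp_For_Push:
  assumes "\<And>i ys. ev e (r(x := i), l(a := ys)) = n"
    and "\<And>i ys. i < n \<Longrightarrow> ev e' (r(x := i), l(a := ys)) = f i"
    and "fv e \<inter> {x} = {}" "fl e \<inter> {a} = {}"
    and post: "\<And>t. t \<le> n * 3 + 2 \<Longrightarrow> Q t (r(x := n), l(a := l a @ map f [0..<n]))"
  shows "wp c (For x e (Push a e')) Q (r, l)"
proof (rule wp_For[where n = n and B = 1 and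
      I = "\<lambda>i r' l'. r' = r(x := i) \<and> l' = l(a := l a @ map f [0..<i])"], goal_cases)
  case 4
  show ?case using assms(1)[of "r x" "l a"] by simp
next
  case (6 i r' l')
  then show ?case using assms(2) by simp
next
  case (7 t r' l')
  then show ?case using post by simp
qed (use assms in auto)

section \<open>Encodings\<close>

lemma sorted_list_of_set_lessThan [simp]: "sorted_list_of_set {..<n} = [0..<n]"
  by (metis atLeast0LessThan sorted_list_of_set_range)

lemma enc_set_lessThan: "enc_set {..<n} = n # [0..<n]"
  by (simp add: enc_set_def enc_list_def)

lemma enc_set_atLeastLessThan: "enc_set {m..<n} = (n - m) # [m..<n]"
  by (simp add: enc_set_def enc_list_def)

lemma enc_rat_of_nat: "enc_rat (of_nat k) = [k, 1]"
  by (simp add: enc_rat_def)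

lemma enc_rat_Fract:
  assumes "0 \<le> q"
  obtains a b where "enc_rat q = [a, b]" "b > 0" "q = of_nat a / of_nat b"
proof -
  obtain x y where xy: "quotient_of q = (x, y)" by (cases "quotient_of q")
  then have "y > 0" and q: "q = of_int x / of_int y"
    by (auto simp: quotient_of_denom_pos quotient_of_div)
  then have "x \<ge> 0" using assms by (simp add: zero_le_divide_iff)
  show thesis
  proof
    show "enc_rat q = [nat x, nat y]" by (simp add: enc_rat_def xy)
  qed (use q \<open>y > 0\<close> \<open>x \<ge> 0\<close> in auto)
qed

lemma drop_Cons_nth:
  assumes "drop p xs = y # ys"
  shows "p < length xs" "xs ! p = y" "drop (Suc p) xs = ys"
proof -
  show "p < length xs" by (rule ccontr) (use assms in simp)
  then show "xs ! p = y" "drop (Suc p) xs = ys"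
    using assms by (simp_all add: Cons_nth_drop_Suc[symmetric])
qed

lemma bit_size_append [simp]: "bit_size (xs @ ys) = bit_size xs + bit_size ys"
  by (simp add: bit_size_def)

lemma bit_size_Cons [simp]: "bit_size (x # xs) = floor_log x + 1 + bit_size xs"
  by (simp add: bit_size_def)

lemma length_le_bit_size: "length xs \<le> bit_size xs"
  by (induction xs) (auto simp: bit_size_def)

text \<open>Input numbers can be exponential in the input size; this bounds the number of doublings
  needed to multiply by one of them.\<close>

lemma less_two_power_bit_size: "x \<in> set xs \<Longrightarrow> x < 2 ^ bit_size xs"
proof (induction xs)
  case (Cons y ys)
  have "z < 2 ^ (floor_log z + 1)" for z
    by (cases "z = 0") (use floor_log_exp2_gt[of z] in auto)
  then have "y < 2 ^ (floor_log y + 1 + bit_size ys)" if "x = y"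
    by (meson less_le_trans le_add1 one_le_numeral power_increasing)
  moreover have "2 ^ bit_size ys \<le> (2 :: nat) ^ bit_size (y # ys)"
    by (intro power_increasing) auto
  ultimately show ?case
    using Cons by (auto intro: less_le_trans)
qed simp

lemma floor_log_le: "floor_log n \<le> n"
proof (cases "n = 0")
  case False
  have "floor_log n < 2 ^ floor_log n" by (rule less_exp)
  also have "\<dots> \<le> n" using False by (intro floor_log_exp2_le) simp
  finally show ?thesis by simp
qed simp

text \<open>Crude, with a number standing in for its logarithm, but sufficient for the parts of
  queries that are newly written: their entries are indices, counts and the constant
  \<open>M\<close>. The copied prefix is bounded by its own bit size instead.\<close>

lemma bit_size_le: "\<forall>x\<in>set xs. x \<le> B \<Longrightarrow> bit_size xs \<le> length xs * (B + 1)"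
proof (induction xs)
  case (Cons x xs)
  then have "floor_log x \<le> B" using floor_log_le[of x] by simp
  with Cons show ?case by simp
qed (simp add: bit_size_def)

text \<open>The inner sum is the absolute difference, by two truncated subtractions, so the value is
  1 for equal arguments and 0 otherwise.\<close>

abbreviation eq_exp :: "exp \<Rightarrow> exp \<Rightarrow> exp" where
  "eq_exp a b \<equiv> Minus (N 1) (Plus (Minus a b) (Minus b a))"

section \<open>Reduction of the PCF problem to the supplier problem\<close>

text \<open>
  Registers: \<open>2\<close> the number \<open>n\<close> of facilities, \<open>3\<close> the reading position, \<open>4\<close> the number \<open>k\<close>
  of parts, \<open>8\<close> the number of points.  List \<open>4\<close> labels each point with the part it belongs to
  (counting from \<open>1\<close>).
\<close>

definition read_parts :: cmd where
  "read_parts =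
     (For 5 (V 2) (Push 4 (N 0)) ;;
      Assign 3 (Plus (V 3) (N 1)) ;;
      For 5 (V 4)
        (Assign 6 (Idx 0 (V 3)) ;;
         Assign 3 (Plus (V 3) (N 1)) ;;
         For 7 (V 6)
           (Update 4 (Idx 0 (V 3)) (Plus (V 5) (N 1)) ;;
            Assign 3 (Plus (V 3) (N 1)))) ;;
      For 5 (V 4) (Push 4 (Plus (V 5) (N 1))))"

definition write_cluster_metric :: "nat \<Rightarrow> cmd" where
  "write_cluster_metric M =
     For 5 (V 8) (For 7 (V 8)
       (Cond (eq_exp (V 5) (V 7)) (Push 2 (N 0))
          (Cond (Idx 4 (V 5))
             (Cond (eq_exp (Idx 4 (V 5)) (Idx 4 (V 7))) (Push 2 (N 1)) (Push 2 (N M)))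
             (Push 2 (N M))) ;;
        Push 2 (N 1)))"

text \<open>List 5 has a slot for each label including 0, so that a facility in no part can be
  recorded without a case distinction; only the slots from 1 on are inspected.\<close>

definition check_hits :: cmd where
  "check_hits =
     (Assign 9 (Plus (V 4) (N 1)) ;;
      For 5 (V 9) (Push 5 (N 0)) ;;
      For 5 (Len 3) (Update 5 (Idx 4 (Idx 3 (V 5))) (N 1)) ;;
      Assign 10 (N 1) ;;
      For 5 (V 4) (Cond (Idx 5 (Plus (V 5) (N 1))) (Assign 0 (N 0)) (Assign 10 (N 0))) ;;
      Clear 0 ;;
      Push 0 (V 10))"

text \<open>The prefix of the input up to the end of the ground set is copied verbatim into the
  query. The client for part \<open>j\<close> becomes point \<open>n + j\<close>, which keeps the
  points an initial segment of the naturals, as the encoding demands.\<close>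

definition pcf_via_supplier :: "nat \<Rightarrow> cmd" where
  "pcf_via_supplier M =
     (Assign 2 (Idx 0 (Plus (Idx 0 (N 0)) (N 1))) ;;
      Assign 3 (Plus (Plus (Idx 0 (N 0)) (N 2)) (V 2)) ;;
      Assign 4 (Idx 0 (V 3)) ;;
      For 5 (V 3) (Push 2 (Idx 0 (V 5))) ;;
      read_parts ;;
      Push 2 (V 4) ;;
      For 5 (V 4) (Push 2 (Plus (V 2) (V 5))) ;;
      Assign 8 (Plus (V 2) (V 4)) ;;
      Push 2 (V 8) ;;
      For 5 (V 8) (Push 2 (V 5)) ;;
      write_cluster_metric M ;;
      Call ;;
      check_hits)"

lemma mv_read_parts [simp]: "mv read_parts = {3, 5, 6, 7}" "ml read_parts = {4}"
  by (auto simp: read_parts_def)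

lemma mv_write_cluster_metric [simp]:
  "mv (write_cluster_metric M) = {5, 7}" "ml (write_cluster_metric M) = {2}"
  by (auto simp: write_cluster_metric_def)

definition labels_parts :: "nat \<Rightarrow> nat set list \<Rightarrow> nat list \<Rightarrow> bool" where
  "labels_parts n Ps cls \<longleftrightarrow> length cls = n + length Ps \<and>
     (\<forall>u<n. \<forall>j. cls ! u = Suc j \<longleftrightarrow> j < length Ps \<and> u \<in> Ps ! j) \<and>
     (\<forall>j<length Ps. cls ! (n + j) = Suc j)"

lemma wp_read_parts:
  assumes "r 2 = n" "r 4 = length Ps" "drop (r 3) (l 0) = length Ps # concat (map enc_set Ps)"
    "l 4 = []" and Ps: "distinct Ps" "sub_partition {..<n} (set Ps)"
  shows "wp c read_parts (\<lambda>t (r', l'). t \<le> 20 * (n + 1) * (length Ps + 1) \<and> labels_parts n Ps (l' 4)) (r, l)"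
proof -
  let ?k = "length Ps"
  have fin: "finite (Ps ! j)" and sub: "Ps ! j \<subseteq> {..<n}" if "j < ?k" for j
  proof -
    show "Ps ! j \<subseteq> {..<n}" using Ps nth_mem[OF that] unfolding sub_partition_def by blast
    then show "finite (Ps ! j)" using finite_subset by blast
  qed
  \<comment> \<open>By disjointness no facility is relabelled when a later part is read, so the
    final labels determine the parts.\<close>
  have disj: "u \<notin> Ps ! j'" if "u \<in> Ps ! j" "j < ?k" "j' < ?k" "j \<noteq> j'" for u j j'
    using Ps that unfolding sub_partition_def pairwise_def disjnt_def
    by (metis IntI empty_iff nth_eq_iff_index_eq nth_mem)
  have card: "card (Ps ! j) \<le> n" if "j < ?k" for j
    using card_mono[OF _ sub[OF that]] by simp
  define I where "I j r' l' \<longleftrightarrow> drop (r' 3) (l' 0) = concat (map enc_set (drop j Ps)) \<and> length (l' 4) = n \<and>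
    (\<forall>u<n. \<forall>j'. l' 4 ! u = Suc j' \<longleftrightarrow> j' < j \<and> u \<in> Ps ! j')"
    for j :: nat and r' :: "nat \<Rightarrow> nat" and l' :: "nat \<Rightarrow> nat list"
  have body: "wp c (Assign 6 (Idx 0 (V 3)) ;; Assign 3 (Plus (V 3) (N 1)) ;; For 7 (V 6)
           (Update 4 (Idx 0 (V 3)) (Plus (V 5) (N 1)) ;; Assign 3 (Plus (V 3) (N 1))))
     (\<lambda>t (r'', l''). t \<le> n * 4 + 4 \<and> I (Suc j) (r''(5 := Suc j)) l'') (r1, l1)"
    if j: "j < ?k" and I: "I j r1 l1" and r5: "r1 5 = j" for j r1 l1
  proof -
    let ?s = "sorted_list_of_set (Ps ! j)"
    let ?rest = "concat (map enc_set (drop (Suc j) Ps))"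
    have set_s: "set ?s = Ps ! j" using fin[OF j] by simp
    have len_s: "length ?s = card (Ps ! j)" by simp
    have "drop (r1 3) (l1 0) = length ?s # ?s @ ?rest"
      using I j by (simp add: I_def Cons_nth_drop_Suc[symmetric] enc_set_def enc_list_def)
    from drop_Cons_nth[OF this] have d: "r1 3 < length (l1 0)" "l1 0 ! r1 3 = length ?s"
      "drop (Suc (r1 3)) (l1 0) = ?s @ ?rest" .
    define J where "J i r' l' \<longleftrightarrow> drop (r' 3) (l' 0) = drop i ?s @ ?rest \<and> length (l' 4) = n \<and>
      (\<forall>u<n. \<forall>j'. l' 4 ! u = Suc j' \<longleftrightarrow> (j' < j \<and> u \<in> Ps ! j') \<or> (j' = j \<and> u \<in> set (take i ?s)))"
      for i :: nat and r' :: "nat \<Rightarrow> nat" and l' :: "nat \<Rightarrow> nat list"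
    have "wp c (For 7 (V 6) (Update 4 (Idx 0 (V 3)) (Plus (V 5) (N 1)) ;; Assign 3 (Plus (V 3) (N 1))))
       (\<lambda>t (r'', l''). 2 + t \<le> n * 4 + 4 \<and> I (Suc j) (r''(5 := Suc j)) l'')
       (r1(6 := length ?s, 3 := Suc (r1 3)), l1)"
    proof (rule wp_For[where n = "length ?s" and I = J and B = 2], goal_cases)
      case 5
      show ?case using I d by (simp add: J_def I_def)
    next
      case (6 i r2 l2)
      have s_i: "?s ! i < n" "?s ! i \<in> Ps ! j"
        using 6(1) sub[OF j] set_s nth_mem[OF 6(1)] by auto
      have "drop (r2 3) (l2 0) = ?s ! i # drop (Suc i) ?s @ ?rest"
        using 6(1,2) by (simp add: J_def Cons_nth_drop_Suc[symmetric])
      from drop_Cons_nth[OF this] have e: "r2 3 < length (l2 0)" "l2 0 ! r2 3 = ?s ! i"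
        "drop (Suc (r2 3)) (l2 0) = drop (Suc i) ?s @ ?rest" .
      have t: "set (take (Suc i) ?s) = insert (?s ! i) (set (take i ?s))"
        using 6(1) by (simp add: take_Suc_conv_app_nth)
      have "j' = j \<longleftrightarrow> (j' < j \<and> ?s ! i \<in> Ps ! j') \<or> j' = j" for j'
        using disj[OF s_i(2) j, of j'] j by auto
      then have "\<forall>u<n. \<forall>j'. (l2 4)[?s ! i := Suc j] ! u = Suc j' \<longleftrightarrow>
          (j' < j \<and> u \<in> Ps ! j') \<or> (j' = j \<and> u \<in> set (take (Suc i) ?s))"
        using 6(2) s_i unfolding J_def t by (auto simp: nth_list_update)
      moreover have "r2 5 = j" using 6(4) r5 by simp
      ultimately show ?case
        using 6(2) e by (simp add: J_def)
    next
      case (7 t r2 l2)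
      have "length ?s * (2 + 2) \<le> n * (2 + 2)"
        using card[OF j] by simp
      then have "2 + t \<le> n * 4 + 4" using 7(1) by simp
      moreover have "I (Suc j) (r2(5 := Suc j)) l2"
        using 7(2) set_s unfolding J_def I_def by (auto simp: less_Suc_eq)
      ultimately show ?case by simp
    qed auto
    then show ?thesis
      using d by simp
  qed
  have "wp c (For 5 (V 4) (Assign 6 (Idx 0 (V 3)) ;; Assign 3 (Plus (V 3) (N 1)) ;; For 7 (V 6)
           (Update 4 (Idx 0 (V 3)) (Plus (V 5) (N 1)) ;; Assign 3 (Plus (V 3) (N 1)))))
     (\<lambda>t (r', l'). t \<le> ?k * (n * 4 + 4 + 2) + 2 \<and> r' 4 = ?k \<and> I ?k r' l')
     (r(5 := n, 3 := Suc (r 3)), l(4 := map (\<lambda>_. 0) [0..<n]))"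
  proof (rule wp_For[where n = ?k and I = I and B = "n * 4 + 4"], goal_cases)
    case 5
    show ?case using drop_Cons_nth[OF assms(3)] by (simp add: I_def)
  next
    case (6 i r' l')
    show ?case using 6 by (intro body)
  next
    case (7 t r' l')
    then show ?case using assms by simp
  qed (use assms in auto)
  then have main: "wp c (For 5 (V 4) (Assign 6 (Idx 0 (V 3)) ;; Assign 3 (Plus (V 3) (N 1)) ;; For 7 (V 6)
           (Update 4 (Idx 0 (V 3)) (Plus (V 5) (N 1)) ;; Assign 3 (Plus (V 3) (N 1)))))
     (\<lambda>t. wp c (For 5 (V 4) (Push 4 (Plus (V 5) (N 1)))) (\<lambda>t' (r', l').
       n * 3 + 3 + (t + t') \<le> 20 * (n + 1) * (?k + 1) \<and> labels_parts n Ps (l' 4)))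
     (r(5 := n, 3 := Suc (r 3)), l(4 := map (\<lambda>_. 0) [0..<n]))"
  proof (rule wp_mono, clarify, goal_cases)
    case (1 t r' l')
    then have "labels_parts n Ps (l' 4 @ map Suc [0..<?k])"
      by (auto simp: labels_parts_def I_def nth_append)
    with 1 show ?case
      by (intro wp_For_Push[where n = ?k and f = Suc]) (auto simp: algebra_simps)
  qed
  show ?thesis
    unfolding read_parts_def wp_Then
    apply (rule wp_For_Push[where n = n and f = "\<lambda>_. 0"])
        apply (simp_all add: assms)
    apply (rule wp_mono[OF main[simplified]])
    apply (erule wp_mono)
    apply auto
    done
qed

text \<open>Label 0 is excluded from the clusters: a facility in no part has distance
  \<open>M\<close> from every other point, so it can serve no client cheaply.\<close>

definition cluster_dist :: "nat \<Rightarrow> nat list \<Rightarrow> nat \<Rightarrow> nat \<Rightarrow> nat" where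
  "cluster_dist M cls i j = (if i = j then 0 else if cls ! i \<noteq> 0 \<and> cls ! i = cls ! j then 1 else M)"

lemma wp_write_cluster_metric:
  assumes "r 8 = m" "length (l 4) = m"
  shows "wp c (write_cluster_metric M) (\<lambda>t (r', l'). t \<le> 10 * (m + 1) * (m + 1) \<and>
    l' 2 = l 2 @ enc_matrix m (\<lambda>i j. of_nat (cluster_dist M (l 4) i j))) (r, l)"
proof -
  let ?f = "\<lambda>i j. [cluster_dist M (l 4) i j, 1]"
  have "wp c (write_cluster_metric M) (\<lambda>t (r', l'). t \<le> m * ((m * (5 + 2) + 2) + 2) + 2 \<and>
    l' 2 = l 2 @ concat (map (\<lambda>i. concat (map (?f i) [0..<m])) [0..<m])) (r, l)"
    unfolding write_cluster_metric_def
  proof (rule wp_For[where n = m and B = "m * (5 + 2) + 2" and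
      I = "\<lambda>i r' l'. l' 2 = l 2 @ concat (map (\<lambda>i. concat (map (?f i) [0..<m])) [0..<i])"], goal_cases)
    case (6 i r1 l1)
    show ?case
    proof (rule wp_For[where n = m and B = 5 and
        I = "\<lambda>j r' l'. l' 2 = l1 2 @ concat (map (?f i) [0..<j])"], goal_cases)
      case (6 j r2 l2)
      have "l2 4 = l 4" "r2 5 = i" using 6 \<open>r1 5 = i\<close> \<open>\<forall>a. _ \<longrightarrow> l1 a = l a\<close> by auto
      with 6 \<open>i < m\<close> show ?case by (auto simp: cluster_dist_def assms)
    next
      case (7 t r2 l2)
      with 6 show ?case by simp
    qed (use 6 assms in auto)
  next
    case (7 t r1 l1)
    then show ?case by simp
  qed (use assms in auto)
  then show ?thesis
    by (rule wp_mono) (auto simp: enc_matrix_def enc_rat_of_nat algebra_simps)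
qed

lemma wp_check_hits:
  assumes "r 4 = k" "l 5 = []" "\<forall>y\<in>set (l 3). y < length (l 4) \<and> l 4 ! y \<le> k"
  shows "wp c check_hits (\<lambda>t (r', l'). t \<le> 20 * (k + 1) + 3 * length (l 3) \<and>
    l' 0 = [if \<forall>j<k. \<exists>y\<in>set (l 3). l 4 ! y = Suc j then 1 else 0]) (r, l)"
proof -
  let ?hit = "\<lambda>l' i. length (l' 5) = Suc k \<and>
    (\<forall>j\<le>k. l' 5 ! j \<noteq> 0 \<longleftrightarrow> (\<exists>y\<in>set (take i (l 3)). l 4 ! y = j))"
  have 1: "wp c (For 5 (Len 3) (Update 5 (Idx 4 (Idx 3 (V 5))) (N 1)))
    (\<lambda>t (r', l'). t \<le> length (l 3) * 3 + 2 \<and> ?hit l' (length (l 3)) \<and> r' 4 = k) (r1, l(5 := map (\<lambda>_. 0) [0..<Suc k]))"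
    if "r1 4 = k" for r1
  proof (rule wp_For[where n = "length (l 3)" and B = 1 and I = "\<lambda>i r' l'. ?hit l' i"], goal_cases)
    case 5
    then show ?case by (simp del: upt_Suc)
  next
    case (6 i r' l')
    then have "l 3 ! i \<in> set (l 3)" by simp
    then have "l 3 ! i < length (l 4)" "l 4 ! (l 3 ! i) \<le> k" using assms(3) by blast+
    moreover have "set (take (Suc i) (l 3)) = insert (l 3 ! i) (set (take i (l 3)))"
      using 6(1) by (simp add: take_Suc_conv_app_nth)
    ultimately show ?case using 6 by (auto simp: nth_list_update)
  qed (use that in auto)
  have 2: "wp c (For 5 (V 4) (Cond (Idx 5 (Plus (V 5) (N 1))) (Assign 0 (N 0)) (Assign 10 (N 0))))
    (\<lambda>t (r', l'). t \<le> k * 4 + 2 \<and> r' 10 = (if \<forall>j<k. l1 5 ! Suc j \<noteq> 0 then 1 else 0)) (r1, l1)"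
    if "r1 4 = k" "r1 10 = 1" "length (l1 5) = Suc k" for r1 l1
  proof (rule wp_For[where n = k and B = 2 and
      I = "\<lambda>i r' l'. r' 10 = (if \<forall>j<i. l1 5 ! Suc j \<noteq> 0 then 1 else 0)"], goal_cases)
    case (6 i r' l')
    then show ?case using that by (auto simp: less_Suc_eq)
  qed (use that in auto)
  define b where "b = (if \<forall>j<k. \<exists>y\<in>set (l 3). l 4 ! y = Suc j then 1 else 0 :: nat)"
  show ?thesis
    unfolding check_hits_def wp_Then b_def[symmetric]
    apply (simp del: One_nat_def)
    apply (rule wp_For_Push[where n = "Suc k" and f = "\<lambda>_. 0"])
        apply (simp_all add: assms del: upt_Suc One_nat_def)
    apply (rule wp_mono[OF 1])
     apply (simp add: assms)
    apply (clarsimp simp del: One_nat_def)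
    apply (rule wp_mono[OF 2])
       apply (auto simp: assms b_def)
    done
qed

text \<open>The answer is read off from which parts \<open>S\<close> meets and not from its cost,
  about which nothing is claimed when PCF has no solution. In the direction from PCF, a solution
  certifies OPT at most 1, which forces the cost of \<open>S\<close> below \<open>M\<close>.\<close>

lemma labels_parts_hit_iff:
  assumes cls: "labels_parts n Ps cls" and Ps: "distinct Ps" "sub_partition {..<n} (set Ps)"
    and \<F>: "down_closed {..<n} \<F>" and M: "\<alpha> < of_nat M"
    and S: "approx_solution \<alpha> (\<lambda>x y. of_rat (of_nat (cluster_dist M cls x y))) {n..<n + length Ps} \<F> S"
  shows "(\<forall>j<length Ps. \<exists>y\<in>S. cls ! y = Suc j) \<longleftrightarrow> pcf \<F> (set Ps)"
proof
  let ?k = "length Ps"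
  have "S \<in> \<F>" using S by (simp add: approx_solution_def)
  then have S_sub: "S \<subseteq> {..<n}" using \<F> by (auto simp: down_closed_def)
  have lab: "cls ! u = Suc j \<longleftrightarrow> j < ?k \<and> u \<in> Ps ! j" if "u < n" for u j
    using cls that by (simp add: labels_parts_def)
  {
    define g where "g j = (SOME y. y \<in> S \<and> cls ! y = Suc j)" for j
    assume "\<forall>j<?k. \<exists>y\<in>S. cls ! y = Suc j"
    then have "\<exists>y. y \<in> S \<and> cls ! y = Suc j" if "j < ?k" for j using that by blast
    then have g: "g j \<in> S \<and> cls ! g j = Suc j" if "j < ?k" for j
      unfolding g_def using that by (intro someI_ex[of "\<lambda>y. y \<in> S \<and> cls ! y = Suc j"])
    have "g ` {..<?k} \<subseteq> S" using g by blast
    then have "g ` {..<?k} \<in> \<F>" using \<F> \<open>S \<in> \<F>\<close> unfolding down_closed_def by simp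
    \<comment> \<open>Each representative carries the label of its own part, and a facility lying in
      part \<open>j\<close> has label \<open>Suc j\<close>; hence no other representative can fall
      into it.\<close>
    moreover have "g ` {..<?k} \<inter> Ps ! j = {g j}" if "j < ?k" for j
    proof -
      have "g j \<in> Ps ! j" using lab g[OF that] S_sub by blast
      moreover have "j' = j" if "j' < ?k" "g j' \<in> Ps ! j" for j'
      proof -
        have "cls ! g j' = Suc j" using lab[of "g j'" j] g[OF \<open>j' < ?k\<close>] S_sub that \<open>j < ?k\<close> by blast
        then show ?thesis using g[OF \<open>j' < ?k\<close>] by simp
      qed
      ultimately show ?thesis using that by auto
    qed
    ultimately show "pcf \<F> (set Ps)"
      unfolding pcf_def by (intro bexI[of _ "g ` {..<?k}"]) (auto simp: in_set_conv_nth)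
  }
  let ?d = "\<lambda>x y. of_rat (of_nat (cluster_dist M cls x y)) :: real"
  let ?C = "{n..<n + ?k}"
  assume "pcf \<F> (set Ps)"
  then obtain T where T: "T \<in> \<F>" "\<And>j. j < ?k \<Longrightarrow> card (T \<inter> Ps ! j) = 1"
    unfolding pcf_def by (metis nth_mem)
  have "set_distance ?d v T \<le> 1" if v: "v \<in> ?C" for v
  proof -
    define j where "j = v - n"
    then have j: "j < ?k" "v = n + j" using v by auto
    then obtain u where u: "u \<in> T" "u \<in> Ps ! j" using T(2)[OF j(1)] by (metis Int_iff card_1_singletonE insertI1)
    then have "u < n" using T(1) \<F> by (auto simp: down_closed_def)
    then have "cls ! u = Suc j" using lab u j by simp
    moreover have "cls ! v = Suc j" using cls j by (simp add: labels_parts_def)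
    ultimately have "?d v u \<le> 1" by (simp add: cluster_dist_def)
    then have "ennreal (?d v u) \<le> 1" by (metis ennreal_1 ennreal_leI)
    then show ?thesis unfolding set_distance_def using u(1) by (meson INF_lower2)
  qed
  then have "supplier_cost ?d ?C T \<le> 1" unfolding supplier_cost_def by (rule SUP_least)
  then have "supplier_opt ?d ?C \<F> \<le> 1" unfolding supplier_opt_def using T(1) by (meson INF_lower2)
  \<comment> \<open>Distance 1 within clusters makes the guarantee collapse to \<alpha> itself,
    which is below \<open>M\<close>.\<close>
  then have "\<alpha> * supplier_opt ?d ?C \<F> \<le> \<alpha>" using mult_left_mono by fastforce
  then have cost: "supplier_cost ?d ?C S < of_nat M"
    using S M unfolding approx_solution_def by (meson le_less_trans order_trans)
  show "\<forall>j<?k. \<exists>y\<in>S. cls ! y = Suc j"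
  proof (intro allI impI)
    fix j assume j: "j < ?k"
    have "set_distance ?d (n + j) S \<le> supplier_cost ?d ?C S"
      unfolding supplier_cost_def by (rule SUP_upper) (use j in simp)
    then have "(INF u\<in>S. ennreal (?d (n + j) u)) < of_nat M"
      using cost unfolding set_distance_def by (rule le_less_trans)
    then obtain u where u: "u \<in> S" "ennreal (?d (n + j) u) < of_nat M"
      by (auto simp: INF_less_iff)
    then have "cluster_dist M cls (n + j) u < M"
      by (metis ennreal_of_nat_eq_real_of_nat of_nat_less_iff of_nat_0_le_iff of_rat_of_nat_eq ennreal_less_iff)
    moreover have "cls ! (n + j) = Suc j" using cls j by (simp add: labels_parts_def)
    moreover have "u < n" using u(1) S_sub by blast
    \<comment> \<open>A facility is never the client itself, so a distance below \<open>M\<close>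
      leaves only the case of equal labels.\<close>
    ultimately have "cls ! u = Suc j" by (auto simp: cluster_dist_def split: if_splits)
    then show "\<exists>y\<in>S. cls ! y = Suc j" using u(1) by blast
  qed
qed

text \<open>Sharing a nonzero label is transitive, so two legs of length 1 stay inside one cluster,
  while a detour with a leg of length \<open>M\<close> is never shorter because \<open>M\<close> is
  at least 1.\<close>

lemma Metric_space_cluster_dist:
  assumes "M > 0"
  shows "Metric_space A (\<lambda>x y. of_rat (of_nat (cluster_dist M cls x y)))"
  by unfold_locales (use assms in \<open>auto simp: cluster_dist_def\<close>)

lemma pcf_polytime_if_supplier_polytime_approx:
  assumes rep: "down_closed_rep rep" and \<alpha>: "\<alpha> < \<infinity>" and sup: "supplier_polytime_approx \<alpha> rep"
  shows "pcf_polytime rep"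
proof -
  obtain c p where c: "solves_in c p (supplier_problem \<alpha> rep)"
    using sup by (auto simp: supplier_polytime_approx_def polytime_solvable_def solves_in_def)
  \<comment> \<open>\<open>M\<close> is chosen before any input is seen, so it can be hard-wired
    into the program.\<close>
  obtain M where M: "\<alpha> < of_nat M" using ennreal_Ex_less_of_nat \<alpha> by auto
  then have "M > 0" by (cases M) auto
  \<comment> \<open>\<open>B\<close> bounds the bit size of the supplier query: \<open>N\<close> for
    the copied prefix, then at most \<open>2 * N + 2 + 2 * N * N\<close> numbers (points and
    matrix), each at most \<open>N + M\<close>. \<open>P\<close> is the resulting bound from
    \<open>wp_Call\<close>.\<close>
  define B where "B N = N + (2 * N + 2 + 2 * N * N) * (N + M + 1)" for N
  define P where "P N = 2 * poly p (B N) + B N + 1" for N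
  define f where "f N = 100 * (N + 1) * (N + 1) + 4 * P N" for N
  have "poly_bounded f"
    unfolding f_def P_def B_def
    by (intro poly_bounded_add poly_bounded_mult poly_bounded_poly poly_bounded_const poly_bounded_id)
  then show ?thesis
    unfolding pcf_polytime_def
  proof (rule polytime_solvableI[where C = "pcf_via_supplier M" and c = c])
    fix xs Y
    assume "(xs, Y) \<in> pcf_problem rep"
    then obtain w n \<F> Ps where xs: "xs = enc_list w @ enc_set {..<n} @ enc_sets Ps"
      and Y: "Y = {[if pcf \<F> (set Ps) then 1 else 0]}"
      and w: "rep w = Some (n, \<F>)" and Ps: "distinct Ps" "sub_partition {..<n} (set Ps)"
      unfolding pcf_problem_def by blast
    have \<F>: "down_closed {..<n} \<F>" using rep w by (auto simp: down_closed_rep_def)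
    define N k where "N = bit_size xs" and "k = length Ps"
    define pre where "pre = length w # w @ n # [0..<n]"
    define pos where "pos = length w + 2 + n"
    have xs_eq: "xs = pre @ k # concat (map enc_set Ps)"
      by (simp add: xs pre_def enc_list_def enc_set_lessThan enc_sets_def k_def)
    have pos: "length pre = pos" by (simp add: pre_def pos_def)
    \<comment> \<open>Even an empty part contributes its length entry, so the number of new clients
      is bounded by the input length.\<close>
    have "length (concat (map enc_set Ps)) \<ge> k"
      unfolding k_def by (induction Ps) (auto simp: enc_set_def enc_list_def)
    then have "pos + 1 + k \<le> length xs" by (simp add: xs_eq pos)
    then have N: "pos + 1 + k \<le> N" unfolding N_def using length_le_bit_size order_trans by blast
    have nk: "n + k \<le> N" "n \<le> N" "k \<le> N" "pos \<le> N" using N by (auto simp: pos_def)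
    have xs_nth: "xs ! 0 = length w" "xs ! Suc (length w) = n" "xs ! pos = k" "length xs > pos"
      "take pos xs = pre" "drop pos xs = k # concat (map enc_set Ps)" "xs \<noteq> []" "length w + 1 < length xs" "xs ! (length w + 1) = n"
      using pos by (simp_all add: xs_eq nth_append pre_def pos_def)
    have map_plus: "map ((+) n) [0..<k] = [n..<n + k]"
      by (rule nth_equalityI) auto
    have lt_pos: "i < length xs" if "i < pos" for i using that xs_nth(4) by simp
    have pos_Suc: "Suc (Suc (length w + n)) = pos" by (simp add: pos_def)
    have map_nth: "map ((!) xs) [0..<pos] = pre"
      using xs_nth(4,5) by (metis less_imp_le map_nth map_upt_eqI length_take min.absorb2 nth_take nth_map length_map length_upt take_map take_upt add_0 diff_zero)
    have call: "wp c Call (\<lambda>t. wp c check_hits (\<lambda>t' (r', l').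
        t + t' \<le> 20 * (N + 1) + 4 * P N \<and> l' 0 = [if pcf \<F> (set Ps) then 1 else 0])) (r, l)"
      if "r 4 = k" "l 5 = []" and cls: "labels_parts n Ps (l 4)"
        and l2: "l 2 = pre @ k # [n..<n + k] @ (n + k) # [0..<n + k] @
          enc_matrix (n + k) (\<lambda>i j. of_nat (cluster_dist M (l 4) i j))" for r l
    proof (rule wp_Call[OF c])
      let ?d = "\<lambda>i j. rat_of_nat (cluster_dist M (l 4) i j)"
      have "l 2 = enc_list w @ enc_set {..<n} @ enc_set {n..<n + k} @ enc_set {..<n + k} @ enc_matrix (n + k) ?d"
        unfolding l2 by (simp add: pre_def enc_list_def enc_set_lessThan enc_set_atLeastLessThan)
      moreover have "{..<n} \<union> {n..<n + k} = {..<n + k}" by auto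
      ultimately show "(l 2, {ys. approx_solution \<alpha> (\<lambda>x y. of_rat (?d x y)) {n..<n + k} \<F> (set ys)})
          \<in> supplier_problem \<alpha> rep"
        unfolding supplier_problem_def
        using w Metric_space_cluster_dist[OF \<open>M > 0\<close>] by blast
      fix ys t
      assume ys: "ys \<in> {ys. approx_solution \<alpha> (\<lambda>x y. of_rat (?d x y)) {n..<n + k} \<F> (set ys)}"
        and t: "t + length ys \<le> 2 * poly p (bit_size (l 2)) + length (l 2) + 1"
      have sz: "bit_size (l 2) \<le> B N"
      proof -
        let ?rest = "k # [n..<n + k] @ (n + k) # [0..<n + k] @ enc_matrix (n + k) ?d"
        have "length (enc_matrix (n + k) ?d) = 2 * (n + k) * (n + k)"
          by (simp add: enc_matrix_def length_concat enc_rat_of_nat comp_def sum_list_triv)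
        then have "length ?rest = 2 + k + (n + k) + 2 * (n + k) * (n + k)" by simp
        also have "\<dots> \<le> 2 + N + N + 2 * N * N"
          using nk by (intro add_mono mult_mono) auto
        finally have len: "length ?rest \<le> 2 * N + 2 + 2 * N * N" by simp
        have "cluster_dist M (l 4) i j \<le> N + M" for i j
          using \<open>M > 0\<close> by (simp add: cluster_dist_def)
        then have "\<forall>x\<in>set ?rest. x \<le> N + M"
          using nk \<open>M > 0\<close> by (auto simp: enc_matrix_def enc_rat_of_nat)
        from bit_size_le[OF this] have "bit_size ?rest \<le> length ?rest * (N + M + 1)" .
        also have "\<dots> \<le> (2 * N + 2 + 2 * N * N) * (N + M + 1)"
          using len by (rule mult_le_mono1)
        finally have "bit_size ?rest \<le> (2 * N + 2 + 2 * N * N) * (N + M + 1)" .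
        moreover have "bit_size pre \<le> N" unfolding N_def xs_eq by simp
        ultimately show ?thesis unfolding l2 B_def bit_size_append by (rule add_mono[rotated])
      qed
      then have "t + length ys \<le> P N"
        using t poly_mono_nat[OF sz, of p] length_le_bit_size[of "l 2"] unfolding P_def by linarith
      have ys_sub: "set ys \<subseteq> {..<n}"
        using ys \<F> by (auto simp: approx_solution_def down_closed_def)
      have bnd: "\<forall>y\<in>set ys. y < length (l 4) \<and> l 4 ! y \<le> k"
      proof (intro ballI conjI)
        fix y assume "y \<in> set ys"
        then have y: "y < n" using ys_sub by blast
        then show "y < length (l 4)" using cls by (simp add: labels_parts_def)
        show "l 4 ! y \<le> k"
        proof (cases "l 4 ! y")
          case (Suc j)
          then have "j < k" using cls y by (simp add: labels_parts_def k_def)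
          then show ?thesis using Suc by simp
        qed simp
      qed
      have hit: "(\<forall>j<k. \<exists>y\<in>set ys. l 4 ! y = Suc j) \<longleftrightarrow> pcf \<F> (set Ps)"
        unfolding k_def by (rule labels_parts_hit_iff[OF cls Ps \<F> M]) (use ys in \<open>simp add: k_def\<close>)
      have "wp c check_hits (\<lambda>t (r', l'). t \<le> 20 * (k + 1) + 3 * length ys \<and>
          l' 0 = [if pcf \<F> (set Ps) then 1 else 0]) (r, l(3 := ys))"
        unfolding hit[symmetric]
        by (rule wp_mono[OF wp_check_hits[where k = k]]) (use that bnd in auto)
      then show "wp c check_hits (\<lambda>t' (r', l').
        t + t' \<le> 20 * (N + 1) + 4 * P N \<and> l' 0 = [if pcf \<F> (set Ps) then 1 else 0]) (r, l(3 := ys))"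
        by (rule wp_mono) (use \<open>t + length ys \<le> P N\<close> nk in auto)
    qed
    define ans where "ans = (if pcf \<F> (set Ps) then 1 else 0 :: nat)"
    have nn: "(n + 1) * (k + 1) \<le> (N + 1) * (N + 1)" "(n + k + 1) * (n + k + 1) \<le> (N + 1) * (N + 1)"
      by (rule mult_le_mono; use nk in simp)+
    have time: "1 + (1 + (1 + (t + (ta + (1 + (tb + (1 + (1 + (tc + (td + (te + t'))))))))))) < f N"
      if "t \<le> Suc (Suc (pos * 3))" "ta \<le> (20 * n + 20) * (k + 1)" "tb \<le> Suc (Suc (k * 3))"
        "tc \<le> Suc (Suc (n * 3 + k * 3))" "td \<le> (10 * n + 10 * k + 10) * (n + k + 1)"
        "te + t' \<le> 20 * N + 20 + 4 * P N" for t ta tb tc td te t'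
    proof -
      have "(20 * n + 20) * (k + 1) + (10 * n + 10 * k + 10) * (n + k + 1) \<le> 30 * ((N + 1) * (N + 1))"
        using nn by (simp add: algebra_simps)
      then show ?thesis
        using that nk unfolding f_def by (simp add: algebra_simps)
    qed
    show "wp c (pcf_via_supplier M) (\<lambda>t s. t + length (snd s 0) \<le> f (bit_size xs) \<and> snd s 0 \<in> Y) (hinit xs)"
      unfolding pcf_via_supplier_def hinit_def wp_Then Y ans_def[symmetric] N_def[symmetric]
      apply (simp add: xs_nth pos_Suc del: One_nat_def)
      apply (rule wp_For_Push[where n = pos and f = "(!) xs"])
      apply (simp_all add: xs_nth lt_pos map_nth del: One_nat_def)
      apply (rule wp_frame[OF wp_read_parts[where Ps = Ps and n = n]])
      apply (simp_all add: xs_nth k_def[symmetric] Ps del: One_nat_def)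
      apply (rule wp_For_Push[where n = k and f = "\<lambda>i. n + i"])
      apply (simp_all del: One_nat_def)
      apply (rule wp_For_Push[where n = "n + k" and f = "\<lambda>i. i"])
      apply (simp_all del: One_nat_def upt_Suc add: map_plus)
      apply (rule wp_frame[OF wp_write_cluster_metric[where m = "n + k"]])
      apply (simp_all add: labels_parts_def k_def[symmetric] del: One_nat_def)
      apply (rule wp_mono[OF call])
          apply (simp_all add: labels_parts_def k_def[symmetric] ans_def[symmetric] del: One_nat_def)
      apply (erule wp_mono)
      apply (clarsimp simp del: One_nat_def)
      apply (rule Suc_leI, rule time)
           apply assumption+
      done
  qed
qed

section \<open>Reduction of the supplier problem to the PCF problem\<close>

subsection \<open>Multiplication and comparison of distances\<close>

text \<open>For loops whose number of rounds is known only up to a bound: the invariant counts the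
  rounds done and the loop may stop at any count up to \<open>n\<close>.\<close>

lemma wp_While:
  assumes "I 0 s"
    and step: "\<And>k s. I k s \<Longrightarrow> ev e s \<noteq> 0 \<Longrightarrow> k < n \<and> wp c C (\<lambda>t s'. t \<le> B \<and> I (Suc k) s') s"
    and le: "\<And>k s. I k s \<Longrightarrow> k \<le> n"
  shows "wp c (While e C) (\<lambda>t s'. t \<le> n * (B + 1) + 1 \<and> (\<exists>k\<le>n. I k s') \<and> ev e s' = 0) s"
proof -
  have "wp c (While e C) (\<lambda>t s'. t \<le> (n - k) * (B + 1) + 1 \<and> (\<exists>k\<le>n. I k s') \<and> ev e s' = 0) s"
    if "I k s" "k \<le> n" for k s
    using that
  proof (induction "n - k" arbitrary: k s)
    case 0
    have "ev e s = 0" using step[OF 0(2)] 0 by (cases "ev e s = 0") auto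
    then show ?case using 0 by (intro wp_WhileFalse) auto
  next
    case (Suc x)
    show ?case
    proof (cases "ev e s = 0")
      case True
      then show ?thesis using Suc.prems by (intro wp_WhileFalse) auto
    next
      case False
      with step[OF Suc.prems(1)] have k: "k < n" and C: "wp c C (\<lambda>t s'. t \<le> B \<and> I (Suc k) s') s" by auto
      have n: "(n - Suc k) * (B + 1) + (B + 1) = (n - k) * (B + 1)"
        using k by (metis Suc_diff_Suc mult_Suc add.commute)
      show ?thesis
      proof (rule wp_WhileTrue[OF False], rule wp_mono[OF C], elim conjE)
        fix t s' assume "t \<le> B" "I (Suc k) s'"
        then have "wp c (While e C) (\<lambda>t s'. t \<le> (n - Suc k) * (B + 1) + 1 \<and> (\<exists>k\<le>n. I k s') \<and> ev e s' = 0) s'"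
          using Suc.hyps(2) le by (intro Suc.hyps(1)) auto
        then show "wp c (While e C) (\<lambda>t' s'. 1 + t + t' \<le> (n - k) * (B + 1) + 1 \<and>
            (\<exists>k\<le>n. I k s') \<and> ev e s' = 0) s'"
          by (rule wp_mono, elim conjE, intro conjI)
            (use \<open>t \<le> B\<close> n in linarith, assumption+)
      qed
    qed
  qed
  from this[OF assms(1)] show ?thesis by simp
qed

text \<open>
  The product of registers \<open>20\<close> and \<open>21\<close> is computed from tables of \<open>2\<^sup>i\<close> and \<open>2\<^sup>i\<close> times the first
  factor.
\<close>

definition mult :: cmd where
  "mult =
     (Clear 6 ;; Clear 7 ;; Assign 23 (N 1) ;; Assign 24 (V 20) ;;
      While (Minus (Plus (V 21) (N 1)) (V 23))
        (Push 6 (V 23) ;; Push 7 (V 24) ;;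
         Assign 23 (Plus (V 23) (V 23)) ;; Assign 24 (Plus (V 24) (V 24))) ;;
      Assign 22 (N 0) ;;
      For 42 (Len 6)
        (Assign 33 (Minus (Minus (Len 6) (N 1)) (V 42)) ;;
         When (Minus (Plus (V 21) (N 1)) (Idx 6 (V 33)))
           (Assign 21 (Minus (V 21) (Idx 6 (V 33))) ;; Assign 22 (Plus (V 22) (Idx 7 (V 33))))))"

lemma mv_mult [simp]: "mv mult = {0, 21, 22, 23, 24, 33, 42}" "ml mult = {6, 7}"
  by (auto simp: mult_def)

lemma wp_mult:
  assumes "r 21 < 2 ^ b"
  shows "wp c mult (\<lambda>t (r', l'). t \<le> 12 * b + 20 \<and> r' 22 = r 20 * r 21) (r, l)"
proof -
  let ?X = "r 20" and ?Y = "r 21"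
  define I where "I k s \<longleftrightarrow> k \<le> b \<and> snd s 6 = map (\<lambda>i. 2 ^ i) [0..<k] \<and> snd s 7 = map (\<lambda>i. ?X * 2 ^ i) [0..<k] \<and>
    fst s 23 = 2 ^ k \<and> fst s 24 = ?X * 2 ^ k \<and> fst s 20 = ?X \<and> fst s 21 = ?Y" for k :: nat and s :: hstate
  have table: "wp c (While (Minus (Plus (V 21) (N 1)) (V 23))
        (Push 6 (V 23) ;; Push 7 (V 24) ;;
         Assign 23 (Plus (V 23) (V 23)) ;; Assign 24 (Plus (V 24) (V 24))))
     (\<lambda>t s. t \<le> b * (4 + 1) + 1 \<and> (\<exists>k\<le>b. I k s) \<and> ev (Minus (Plus (V 21) (N 1)) (V 23)) s = 0)
     (r(23 := 1, 24 := ?X), l(6 := [], 7 := []))"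
  proof (rule wp_While)
    fix k s
    assume I: "I k s" and nz: "ev (Minus (Plus (V 21) (N 1)) (V 23)) s \<noteq> 0"
    obtain r1 l1 where s: "s = (r1, l1)" by (cases s)
    have "2 ^ k \<le> ?Y" using I nz by (simp add: I_def s)
    then have "(2::nat) ^ k < 2 ^ b" using assms by (rule le_less_trans)
    then have "k < b" by simp
    then show "k < b \<and> wp c (Push 6 (V 23) ;; Push 7 (V 24) ;;
         Assign 23 (Plus (V 23) (V 23)) ;; Assign 24 (Plus (V 24) (V 24))) (\<lambda>t s. t \<le> 4 \<and> I (Suc k) s) s"
      using I by (simp add: I_def s)
  qed (simp_all add: I_def)
  \<comment> \<open>Binary multiplication from the highest power down: the partial product plus the
    first factor times the rest of the second is constant, and after \<open>i\<close> rounds this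
    rest is below \<open>2 ^ (k - i)\<close>, hence finally 0.\<close>
  have loop: "wp c (For 42 (Len 6)
        (Assign 33 (Minus (Minus (Len 6) (N 1)) (V 42)) ;;
         When (Minus (Plus (V 21) (N 1)) (Idx 6 (V 33)))
           (Assign 21 (Minus (V 21) (Idx 6 (V 33))) ;; Assign 22 (Plus (V 22) (Idx 7 (V 33))))))
     (\<lambda>t (r', l'). t \<le> k * (4 + 2) + 2 \<and> r' 22 = ?X * ?Y) (r1(22 := 0), l1)"
    if I: "I k (r1, l1)" and k: "?Y < 2 ^ k" for k r1 l1
  proof (rule wp_For[where n = k and B = 4 and
      I = "\<lambda>i r' l'. r' 22 + ?X * r' 21 = ?X * ?Y \<and> r' 21 < 2 ^ (k - i)"], goal_cases)
    case (6 i r2 l2)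
    have l2: "l2 6 = map (\<lambda>i. 2 ^ i) [0..<k]" "l2 7 = map (\<lambda>i. ?X * 2 ^ i) [0..<k]"
      using 6(5) I by (simp_all add: I_def)
    define j where "j = k - Suc i"
    have j: "k - i = Suc j" "j < k" "k - Suc 0 - i = j" "k - Suc i = j" using 6(1) by (auto simp: j_def)
    show ?case
    proof (cases "2 ^ j \<le> r2 21")
      case True
      then obtain y where y: "r2 21 = y + 2 ^ j" by (metis le_Suc_ex add.commute)
      show ?thesis using 6 l2 j y by (simp add: algebra_simps)
    next
      case False
      then show ?thesis using 6 l2 j by simp
    qed
  next
    case (7 t r2 l2)
    from 7(2) have *: "r2 22 + ?X * r2 21 = ?X * ?Y" and "r2 21 < 2 ^ (k - k)" by blast+
    then have "r2 21 = 0" by simp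
    with * have "r2 22 = ?X * ?Y" by simp
    then show ?case using 7(1) by simp
  qed (use I k in \<open>auto simp: I_def\<close>)
  show ?thesis
    unfolding mult_def wp_Then
    apply (simp del: One_nat_def)
    apply (rule wp_mono[OF table])
    apply (clarsimp simp del: One_nat_def)
    subgoal for t r1 l1 k
      apply (rule wp_mono[OF loop[where k = k]])
        apply (auto simp: I_def)
      done
    done
qed

text \<open>
  Compares the distance of the points in registers \<open>25\<close> and \<open>26\<close> with the quotient of registers
  \<open>27\<close> and \<open>28\<close>; registers \<open>8\<close> and \<open>9\<close> hold the number of points and the position of the matrix.
  As the comparison is made by cross-multiplication, a zero in register \<open>28\<close> acts as infinity.
\<close>

definition compare :: cmd where
  "compare =
     (Assign 20 (V 25) ;; Assign 21 (V 8) ;; mult ;;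
      Assign 30 (Idx 0 (Plus (V 9) (Plus (Plus (V 22) (V 22)) (Plus (V 26) (V 26))))) ;;
      Assign 31 (Idx 0 (Plus (Plus (V 9) (Plus (Plus (V 22) (V 22)) (Plus (V 26) (V 26)))) (N 1))) ;;
      Assign 20 (V 30) ;; Assign 21 (V 28) ;; mult ;;
      Assign 32 (V 22) ;;
      Assign 20 (V 27) ;; Assign 21 (V 31) ;; mult ;;
      Assign 29 (Minus (Plus (V 22) (N 1)) (V 32)))"

lemma mv_compare [simp]: "mv compare = {0, 20, 21, 22, 23, 24, 29, 30, 31, 32, 33, 42}" "ml compare = {6, 7}"
  by (auto simp: compare_def)

text \<open>Three products are formed, one for the row offset in the matrix and two for
  cross-multiplication, at \<open>12 * b\<close> each. The three bounds concern their second
  factors, which drive the doubling.\<close>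

lemma wp_compare:
  assumes "r 8 < 2 ^ b" "r 28 < 2 ^ b" "den < 2 ^ b"
    and "let i = r 9 + 2 * (r 25 * r 8 + r 26) in
      Suc i < length (l 0) \<and> l 0 ! i = num \<and> l 0 ! Suc i = den"
  shows "wp c compare (\<lambda>t (r', l'). t \<le> 36 * b + 70 \<and> r' 30 = num \<and> r' 31 = den \<and>
    (r' 29 \<noteq> 0 \<longleftrightarrow> num * r 28 \<le> r 27 * den)) (r, l)"
proof -
  let ?i = "r 9 + 2 * (r 25 * r 8 + r 26)"
  have i: "r 9 + (r 25 * r 8 + r 25 * r 8 + (r 26 + r 26)) = ?i" by simp
  have *: "Suc ?i < length (l 0)" "?i < length (l 0)" "l 0 ! ?i = num" "l 0 ! Suc ?i = den"
    using assms(4) by (auto simp: Let_def)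
  show ?thesis
    unfolding compare_def wp_Then
    apply simp
    apply (rule wp_frame[OF wp_mult[where b = b]])
     apply (simp add: assms)
    apply (simp add: i * del: distrib_left_numeral)
    apply (rule wp_frame[OF wp_mult[where b = b]])
     apply (simp add: assms)
    apply (simp add: *)
    apply (rule wp_frame[OF wp_mult[where b = b]])
     apply (simp add: assms)
    apply (auto simp: less_Suc_eq_le)
    done
qed

section \<open>Addressing entries of the distance matrix\<close>

lemma length_concat_blocks:
  "(\<And>i. i < n \<Longrightarrow> length (f i) = b) \<Longrightarrow> length (concat (map f [0..<n])) = n * b"
  by (induction n) auto

lemma nth_concat_blocks:
  "(\<And>i. i < n \<Longrightarrow> length (f i) = b) \<Longrightarrow> i < n \<Longrightarrow> j < b \<Longrightarrow> concat (map f [0..<n]) ! (i * b + j) = f i ! j"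
proof (induction n)
  case (Suc n)
  have len: "length (concat (map f [0..<n])) = n * b"
    using Suc.prems(1) by (intro length_concat_blocks) simp
  show ?case
  proof (cases "i = n")
    case True
    then show ?thesis using len by (simp add: nth_append)
  next
    case False
    then have "i < n" using Suc.prems by simp
    then have "i * b + j < n * b"
      using Suc.prems(3) mult_le_mono1[of "Suc i" n b] by simp
    then show ?thesis using len Suc \<open>i < n\<close> by (simp add: nth_append)
  qed
qed simp

lemma enc_matrix_nth:
  assumes "i < m" "j < m"
  shows "Suc (2 * (i * m + j)) < length (enc_matrix m d)"
    and "enc_matrix m d ! (2 * (i * m + j)) = nat (fst (quotient_of (d i j)))"
    and "enc_matrix m d ! Suc (2 * (i * m + j)) = nat (snd (quotient_of (d i j)))"
proof -
  let ?row = "\<lambda>i. concat (map (\<lambda>j. enc_rat (d i j)) [0..<m])"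
  have len: "length (?row i) = m * 2" for i
    by (rule length_concat_blocks) (simp add: enc_rat_def)
  have "length (enc_matrix m d) = m * (m * 2)"
    unfolding enc_matrix_def by (rule length_concat_blocks) (simp add: len)
  moreover have "i * m + j < m * m"
    using mult_le_mono1[of "Suc i" m m] assms by simp
  ultimately show "Suc (2 * (i * m + j)) < length (enc_matrix m d)" by simp
  have *: "enc_matrix m d ! (i * (m * 2) + (j * 2 + e)) = enc_rat (d i j) ! e" if "e < 2" for e
  proof -
    have "enc_matrix m d ! (i * (m * 2) + (j * 2 + e)) = ?row i ! (j * 2 + e)"
      unfolding enc_matrix_def by (rule nth_concat_blocks) (use assms that in \<open>simp_all add: len\<close>)
    also have "\<dots> = enc_rat (d i j) ! e"
      by (rule nth_concat_blocks) (use assms that in \<open>simp_all add: enc_rat_def\<close>)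
    finally show ?thesis .
  qed
  show "enc_matrix m d ! (2 * (i * m + j)) = nat (fst (quotient_of (d i j)))"
    using *[of 0] by (simp add: enc_rat_def algebra_simps)
  show "enc_matrix m d ! Suc (2 * (i * m + j)) = nat (snd (quotient_of (d i j)))"
    using *[of 1] by (simp add: enc_rat_def algebra_simps)
qed

subsection \<open>Greedy choice of disjoint balls\<close>

text \<open>
  Clients are scanned in order.  A client whose ball meets no labelled facility is chosen, and the
  facilities in its ball are labelled with its (positive) number.  List \<open>4\<close> holds the labels,
  list \<open>5\<close> the chosen clients; register \<open>14\<close> becomes positive if some ball is empty.
\<close>

definition choose_balls :: cmd where
  "choose_balls =
     (Clear 4 ;; For 11 (V 2) (Push 4 (N 0)) ;; Clear 5 ;; Assign 14 (N 0) ;;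
      For 10 (V 4)
        (Assign 25 (Idx 0 (Plus (Plus (V 3) (N 1)) (V 10))) ;;
         Assign 12 (N 0) ;; Assign 13 (N 0) ;;
         For 26 (V 2)
           (compare ;; When (V 29) (Assign 13 (N 1) ;; When (Idx 4 (V 26)) (Assign 12 (N 1)))) ;;
         When (Minus (N 1) (V 13)) (Assign 14 (N 1)) ;;
         When (Minus (N 1) (V 12))
           (Push 5 (Plus (V 10) (N 1)) ;;
            For 26 (V 2) (compare ;; When (V 29) (Update 4 (V 26) (Plus (V 10) (N 1)))))))"

lemma mv_choose_balls [simp]:
  "mv choose_balls = {0, 10, 11, 12, 13, 14, 20, 21, 22, 23, 24, 25, 26, 29, 30, 31, 32, 33, 42}"
  "ml choose_balls = {4, 5, 6, 7}"
  by (auto simp: choose_balls_def)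

definition choose_time :: "nat \<Rightarrow> nat" where
  "choose_time s = s * (2 * s * (36 * s + 80) + 30) + 3 * s + 10"

section \<open>A supplier instance, its encoding and its balls\<close>

locale supplier_instance =
  fixes rep :: family_rep and w :: "nat list" and n :: nat and \<F> :: "nat set set"
    and m :: nat and C :: "nat set" and d :: "nat \<Rightarrow> nat \<Rightarrow> rat"
  assumes rep: "down_closed_rep rep" and w: "rep w = Some (n, \<F>)"
    and points: "{..<n} \<union> C = {..<m}"
    and metric: "Metric_space {..<m} (\<lambda>x y. of_rat (d x y))"
begin

definition cs :: "nat list" where "cs = sorted_list_of_set C"
definition pre :: "nat list" where "pre = enc_list w @ enc_set {..<n}"
definition input :: "nat list" where
  "input = pre @ enc_set C @ enc_set {..<m} @ enc_matrix m d"
definition sz :: nat where "sz = bit_size input"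
definition num :: "nat \<Rightarrow> nat \<Rightarrow> nat" where "num x y = nat (fst (quotient_of (d x y)))"
definition den :: "nat \<Rightarrow> nat \<Rightarrow> nat" where "den x y = nat (snd (quotient_of (d x y)))"

text \<open>Registers 3 and 9 point to the encoding of the clients and to the matrix; the summand 2
  skips the length fields of the client list and the point list. These registers and list 0 stay
  fixed once set up.\<close>

definition ready :: "hstate \<Rightarrow> bool" where
  "ready s \<longleftrightarrow> snd s 0 = input \<and> fst s 2 = n \<and> fst s 3 = length pre \<and> fst s 4 = length cs \<and>
     fst s 8 = m \<and> fst s 9 = length pre + 2 + length cs + m"

text \<open>The facilities in the ball of radius \<open>A / B\<close> around \<open>v\<close>,
  cross-multiplied so that membership is literally what \<open>compare\<close> tests.\<close>

definition near :: "nat \<Rightarrow> nat \<Rightarrow> nat \<Rightarrow> nat set" where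
  "near A B v = {u. u < n \<and> num v u * B \<le> A * den v u}"

lemma down_closed: "down_closed {..<n} \<F>" and nonempty: "\<F> \<noteq> {}"
  using rep w by (auto simp: down_closed_rep_def)

lemma subset_F: "S \<in> \<F> \<Longrightarrow> S \<subseteq> {..<n}"
  using down_closed by (auto simp: down_closed_def)

lemma subset_closed: "S \<in> \<F> \<Longrightarrow> T \<subseteq> S \<Longrightarrow> T \<in> \<F>"
  using down_closed by (auto simp: down_closed_def)

lemma n_le_m: "n \<le> m"
  using points by (metis Un_upper1 lessThan_subset_iff)

lemma C_subset: "C \<subseteq> {..<m}"
  using points by blast

lemma set_cs [simp]: "set cs = C"
  using finite_subset[OF C_subset] by (simp add: cs_def)

lemma cs_nth_less: "i < length cs \<Longrightarrow> cs ! i < m"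
  using C_subset nth_mem[of i cs] by auto

lemma d_nonneg: "0 \<le> d x y" and d_commute: "d x y = d y x"
  using Metric_space.nonneg[OF metric, of x y] Metric_space.commute[OF metric, of x y]
  by (simp_all add: zero_le_of_rat_iff)

lemma d_triangle: "x < m \<Longrightarrow> y < m \<Longrightarrow> z < m \<Longrightarrow> d x z \<le> d x y + d y z"
  using Metric_space.triangle[OF metric, of x y z] by (simp add: of_rat_add[symmetric] of_rat_less_eq)

lemma num_den: "den x y > 0" "d x y = of_nat (num x y) / of_nat (den x y)"
proof -
  from enc_rat_Fract[OF d_nonneg[of x y]] obtain a b where
    ab: "enc_rat (d x y) = [a, b]" "b > 0" "d x y = of_nat a / of_nat b" .
  then show "den x y > 0" "d x y = of_nat (num x y) / of_nat (den x y)"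
    by (auto simp: num_def den_def enc_rat_def)
qed

lemma near_iff:
  assumes "B > 0"
  shows "u \<in> near A B v \<longleftrightarrow> u < n \<and> d v u \<le> of_nat A / of_nat B"
proof -
  have "num v u * B \<le> A * den v u \<longleftrightarrow> rat_of_nat (num v u * B) \<le> rat_of_nat (A * den v u)"
    by (rule of_nat_le_iff[symmetric])
  also have "\<dots> \<longleftrightarrow> d v u \<le> of_nat A / of_nat B"
    using assms num_den(1)[of v u] by (simp add: num_den(2)[of v u] field_simps)
  finally show ?thesis by (simp add: near_def)
qed

lemma input_eq: "input = pre @ length cs # cs @ m # [0..<m] @ enc_matrix m d"
  by (simp add: input_def enc_set_lessThan) (simp add: enc_set_def enc_list_def cs_def)

lemma input_nth:
  "length pre < length input" "input ! length pre = length cs"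
  "i < length cs \<Longrightarrow> Suc (length pre + i) < length input"
  "i < length cs \<Longrightarrow> input ! Suc (length pre + i) = cs ! i"
  "Suc (length pre + length cs) < length input"
  "input ! Suc (length pre + length cs) = m"
  by (simp_all add: input_eq nth_append)

lemma input_matrix:
  assumes "x < m" "y < m"
  defines "i \<equiv> length pre + 2 + length cs + m + 2 * (x * m + y)"
  shows "Suc i < length input" "input ! i = num x y" "input ! Suc i = den x y"
  using enc_matrix_nth[OF assms(1,2), of d]
  by (simp_all add: input_eq nth_append i_def num_def den_def)

lemma sz_bounds: "n \<le> sz" "m \<le> sz" "length cs \<le> sz" "length pre \<le> sz"
  "x < m \<Longrightarrow> y < m \<Longrightarrow> num x y < 2 ^ sz" "x < m \<Longrightarrow> y < m \<Longrightarrow> den x y < 2 ^ sz" "m < 2 ^ sz" "1 \<le> sz"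
proof -
  have "length input \<le> sz" unfolding sz_def by (rule length_le_bit_size)
  then show "n \<le> sz" "m \<le> sz" "length cs \<le> sz" "length pre \<le> sz" "1 \<le> sz"
    using n_le_m by (auto simp: input_eq)
  show "m < 2 ^ sz" unfolding sz_def by (rule less_two_power_bit_size) (simp add: input_eq)
  assume "x < m" "y < m"
  from input_matrix[OF this] show "num x y < 2 ^ sz" "den x y < 2 ^ sz"
    unfolding sz_def by (metis Suc_lessD less_two_power_bit_size nth_mem)+
qed

lemma wp_compare_points:
  assumes "ready (r, l)" "r 25 = v" "r 26 = u" "v < m" "u < m" "r 28 < 2 ^ sz"
  shows "wp c compare (\<lambda>t (r', l'). t \<le> 36 * sz + 70 \<and> r' 30 = num v u \<and> r' 31 = den v u \<and>
    (r' 29 \<noteq> 0 \<longleftrightarrow> num v u * r 28 \<le> r 27 * den v u)) (r, l)"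
proof (rule wp_compare)
  show "let i = r 9 + 2 * (r 25 * r 8 + r 26) in
      Suc i < length (l 0) \<and> l 0 ! i = num v u \<and> l 0 ! Suc i = den v u"
    using assms input_matrix[of v u] by (simp add: ready_def Let_def)
qed (use assms sz_bounds in \<open>auto simp: ready_def\<close>)

text \<open>The state after scanning \<open>i\<close> clients. The conjunct for
  \<open>bad = 0\<close> is maximality of the packing: each scanned ball contains a labelled
  facility, which later yields the factor 3. The last conjunct certifies that the guess is
  infeasible.\<close>

definition greedy :: "nat \<Rightarrow> nat \<Rightarrow> nat \<Rightarrow> nat list \<Rightarrow> nat list \<Rightarrow> nat \<Rightarrow> bool" where
  "greedy A B i cls L bad \<longleftrightarrow> length cls = n \<and> distinct L \<and>
     (\<forall>j\<in>set L. \<exists>i'<i. j = Suc i' \<and> {u. u < n \<and> cls ! u = j} = near A B (cs ! i')) \<and>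
     (\<forall>u<n. cls ! u = 0 \<or> cls ! u \<in> set L) \<and>
     (bad = 0 \<longrightarrow> (\<forall>i'<i. \<exists>u\<in>near A B (cs ! i'). cls ! u \<noteq> 0)) \<and>
     (bad \<noteq> 0 \<longrightarrow> (\<exists>i'<i. near A B (cs ! i') = {}))"

lemma greedy_skip:
  assumes "greedy A B i cls L bad" "\<exists>u\<in>near A B (cs ! i). cls ! u \<noteq> 0"
  shows "greedy A B (Suc i) cls L bad"
  using assms unfolding greedy_def by (auto simp: less_Suc_eq)

text \<open>The new ball contains only unlabelled facilities, so no older label is overwritten and
  the older parts remain equal to their balls. An empty ball is also chosen, as an empty part, and
  recorded in \<open>bad'\<close>.\<close>

lemma greedy_choose:
  assumes g: "greedy A B i cls L bad" and free: "\<forall>u\<in>near A B (cs ! i). cls ! u = 0"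
    and cls': "length cls' = n" "\<forall>u<n. cls' ! u = (if u \<in> near A B (cs ! i) then Suc i else cls ! u)"
    and bad': "bad' = (if near A B (cs ! i) = {} then 1 else bad)"
  shows "greedy A B (Suc i) cls' (L @ [Suc i]) bad'"
proof -
  have L: "\<exists>i'<i. j = Suc i' \<and> {u. u < n \<and> cls ! u = j} = near A B (cs ! i')" if "j \<in> set L" for j
    using g that by (simp add: greedy_def)
  have cls: "cls ! u = 0 \<or> cls ! u \<in> set L" if "u < n" for u
    using g that by (simp add: greedy_def)
  have Si: "Suc i \<notin> set L" using L by blast
  have near_n: "u < n" if "u \<in> near A B v" for u v using that by (simp add: near_def)
  have part: "{u. u < n \<and> cls' ! u = j} = {u. u < n \<and> cls ! u = j}" if "j \<in> set L" for j
  proof -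
    have "j \<noteq> Suc i" "j \<noteq> 0" using that Si L[OF that] by auto
    then show ?thesis using cls'(2) free by auto
  qed
  have "{u. u < n \<and> cls' ! u = Suc i} = near A B (cs ! i)"
  proof (intro set_eqI iffI)
    fix u assume "u \<in> {u. u < n \<and> cls' ! u = Suc i}"
    then show "u \<in> near A B (cs ! i)" using cls'(2) cls[of u] Si by (auto split: if_splits)
  qed (use cls'(2) near_n in auto)
  then have parts: "\<forall>j\<in>set (L @ [Suc i]). \<exists>i'<Suc i. j = Suc i' \<and> {u. u < n \<and> cls' ! u = j} = near A B (cs ! i')"
  proof (intro ballI)
    fix j assume *: "{u. u < n \<and> cls' ! u = Suc i} = near A B (cs ! i)" and j: "j \<in> set (L @ [Suc i])"
    show "\<exists>i'<Suc i. j = Suc i' \<and> {u. u < n \<and> cls' ! u = j} = near A B (cs ! i')"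
    proof (cases "j \<in> set L")
      case True
      from L[OF True] obtain i' where "i' < i" "j = Suc i'"
        "{u. u < n \<and> cls ! u = j} = near A B (cs ! i')" by blast
      with part[OF True] show ?thesis by (intro exI[of _ i']) simp
    next
      case False
      with j * show ?thesis by (intro exI[of _ i]) simp
    qed
  qed
  have "\<forall>u<n. cls' ! u = 0 \<or> cls' ! u \<in> set (L @ [Suc i])"
  proof (intro allI impI)
    fix u assume "u < n"
    then show "cls' ! u = 0 \<or> cls' ! u \<in> set (L @ [Suc i])"
      using cls'(2) cls[of u] by (cases "u \<in> near A B (cs ! i)") auto
  qed
  moreover have "\<forall>i'<Suc i. \<exists>u\<in>near A B (cs ! i'). cls' ! u \<noteq> 0" if "bad' = 0"
  proof (intro allI impI)
    fix i' assume "i' < Suc i"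
    have bad: "bad = 0" "near A B (cs ! i) \<noteq> {}" using that bad' by (auto split: if_splits)
    show "\<exists>u\<in>near A B (cs ! i'). cls' ! u \<noteq> 0"
    proof (cases "i' = i")
      case True
      then show ?thesis using bad(2) cls'(2) near_n by fastforce
    next
      case False
      then have "\<exists>u\<in>near A B (cs ! i'). cls ! u \<noteq> 0"
        using g bad(1) \<open>i' < Suc i\<close> by (simp add: greedy_def)
      then obtain u where "u \<in> near A B (cs ! i')" "cls ! u \<noteq> 0" by blast
      then show ?thesis using cls'(2) near_n[of u] by (intro bexI[of _ u]) auto
    qed
  qed
  moreover have "\<exists>i'<Suc i. near A B (cs ! i') = {}" if "bad' \<noteq> 0"
    using that bad' g by (auto simp: greedy_def less_Suc_eq split: if_splits)
  ultimately show ?thesis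
    using g cls'(1) Si parts unfolding greedy_def by simp
qed

lemma wp_choose_balls:
  assumes "ready (r, l)" "r 27 = A" "r 28 = B" "B < 2 ^ sz"
  shows "wp c choose_balls (\<lambda>t (r', l'). t \<le> choose_time sz \<and>
    greedy A B (length cs) (l' 4) (l' 5) (r' 14)) (r, l)"
proof -
  let ?T = "sz * (36 * sz + 80) + 2"
  have ready_frame: "ready (r', l')" if "\<forall>x. x \<in> {2, 3, 4, 8, 9} \<longrightarrow> r' x = r x" "l' 0 = l 0" for r' l'
    using assms(1) that by (simp add: ready_def)
  \<comment> \<open>One pass over the facilities answers both questions about the ball: register 12
    tells whether it meets a labelled facility, register 13 whether it is nonempty.\<close>
  have scan: "wp c (For 26 (V 2)
           (compare ;; When (V 29) (Assign 13 (N 1) ;; When (Idx 4 (V 26)) (Assign 12 (N 1)))))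
     (\<lambda>t (r', l'). t \<le> ?T \<and> (r' 12 \<noteq> 0 \<longleftrightarrow> (\<exists>u\<in>near A B v. l1 4 ! u \<noteq> 0)) \<and>
        (r' 13 \<noteq> 0 \<longleftrightarrow> near A B v \<noteq> {})) (r1, l1)"
    if r1: "ready (r1, l1)" "r1 25 = v" "v < m" "r1 27 = A" "r1 28 = B" "r1 12 = 0" "r1 13 = 0"
      "length (l1 4) = n" for r1 l1 v
  proof (rule wp_For[where n = n and B = "36 * sz + 78" and
      I = "\<lambda>i r' l'. (r' 12 \<noteq> 0 \<longleftrightarrow> (\<exists>u<i. u \<in> near A B v \<and> l1 4 ! u \<noteq> 0)) \<and>
        (r' 13 \<noteq> 0 \<longleftrightarrow> (\<exists>u<i. u \<in> near A B v))"], goal_cases)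
    case (6 i r2 l2)
    have fr: "ready (r2, l2)" "r2 25 = v" "r2 27 = A" "r2 28 = B" "l2 4 = l1 4"
      using 6(4,5) r1 by (simp_all add: ready_def)
    show ?case
      unfolding wp_Then
    proof (rule wp_frame[OF wp_compare_points[where v = v and u = i]], goal_cases)
      case (7 t r3 l3)
      have "r3 29 \<noteq> 0 \<longleftrightarrow> i \<in> near A B v"
        using 7(1) 6(1) fr by (simp add: near_def)
      then show ?case using 7 6(1-3) r1(8) fr by (auto simp: less_Suc_eq)
    qed (use 6(1,3) r1 fr assms(4) n_le_m in auto)
  next
    case (7 t r2 l2)
    have "n * (36 * sz + 78 + 2) + 2 \<le> ?T" using mult_le_mono1[OF sz_bounds(1), of "36 * sz + 80"] by (simp add: algebra_simps)
    moreover have "(\<exists>u<n. u \<in> near A B v \<and> P u) \<longleftrightarrow> (\<exists>u\<in>near A B v. P u)" for P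
      by (auto simp: near_def)
    ultimately show ?case using 7(1,2) by auto
  qed (use r1 in \<open>auto simp: ready_def\<close>)
  have label: "wp c (For 26 (V 2) (compare ;; When (V 29) (Update 4 (V 26) (Plus (V 10) (N 1)))))
     (\<lambda>t (r', l'). t \<le> ?T \<and> length (l' 4) = n \<and>
        (\<forall>x<n. l' 4 ! x = (if x \<in> near A B v then Suc i else l1 4 ! x))) (r1, l1)"
    if r1: "ready (r1, l1)" "r1 25 = v" "v < m" "r1 27 = A" "r1 28 = B" "r1 10 = i" "length (l1 4) = n"
    for r1 l1 v i
  proof (rule wp_For[where n = n and B = "36 * sz + 78" and
      I = "\<lambda>u r' l'. length (l' 4) = n \<and>
        (\<forall>x<n. l' 4 ! x = (if x < u \<and> x \<in> near A B v then Suc i else l1 4 ! x))"], goal_cases)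
    case (6 u r2 l2)
    have fr: "ready (r2, l2)" "r2 25 = v" "r2 27 = A" "r2 28 = B" "r2 10 = i"
      using 6(4,5) r1 by (simp_all add: ready_def)
    show ?case
      unfolding wp_Then
    proof (rule wp_frame[OF wp_compare_points[where v = v and u = u]], goal_cases)
      case (7 t r3 l3)
      have "r3 29 \<noteq> 0 \<longleftrightarrow> u \<in> near A B v"
        using 7(1) 6(1) fr by (simp add: near_def)
      then show ?case using 7 6(1-3) fr by (auto simp: less_Suc_eq nth_list_update)
    qed (use 6(1,3) r1 fr assms(4) n_le_m in auto)
  next
    case (7 t r2 l2)
    have "n * (36 * sz + 78 + 2) + 2 \<le> ?T" using mult_le_mono1[OF sz_bounds(1), of "36 * sz + 80"] by (simp add: algebra_simps)
    then show ?case using 7(1,2) by auto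
  qed (use r1 in \<open>auto simp: ready_def\<close>)
  have body: "wp c (Assign 25 (Idx 0 (Plus (Plus (V 3) (N 1)) (V 10))) ;;
         Assign 12 (N 0) ;; Assign 13 (N 0) ;;
         For 26 (V 2)
           (compare ;; When (V 29) (Assign 13 (N 1) ;; When (Idx 4 (V 26)) (Assign 12 (N 1)))) ;;
         When (Minus (N 1) (V 13)) (Assign 14 (N 1)) ;;
         When (Minus (N 1) (V 12))
           (Push 5 (Plus (V 10) (N 1)) ;;
            For 26 (V 2) (compare ;; When (V 29) (Update 4 (V 26) (Plus (V 10) (N 1))))))
     (\<lambda>t (r', l'). t \<le> 2 * ?T + 10 \<and> greedy A B (Suc i) (l' 4) (l' 5) (r' 14)) (r1, l1)"
    if r1: "ready (r1, l1)" "r1 27 = A" "r1 28 = B" "r1 10 = i" "i < length cs"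
      and g: "greedy A B i (l1 4) (l1 5) (r1 14)" for r1 l1 i
  proof -
    let ?v = "cs ! i"
    have pos: "length pre + 1 + i < length input" "input ! (length pre + 1 + i) = ?v"
      using input_nth(3,4) r1(5) by auto
    have len: "length (l1 4) = n" using g by (simp add: greedy_def)
    have rd: "l1 0 = input" "r1 3 = length pre" using r1(1) by (simp_all add: ready_def)
    have rest: "wp c (When (Minus (N 1) (V 13)) (Assign 14 (N 1)) ;;
         When (Minus (N 1) (V 12))
           (Push 5 (Plus (V 10) (N 1)) ;;
            For 26 (V 2) (compare ;; When (V 29) (Update 4 (V 26) (Plus (V 10) (N 1))))))
        (\<lambda>t (r', l'). t \<le> ?T + 6 \<and> greedy A B (Suc i) (l' 4) (l' 5) (r' 14)) (r2, l2)"
      if hit: "r2 12 \<noteq> 0 \<longleftrightarrow> (\<exists>u\<in>near A B ?v. l1 4 ! u \<noteq> 0)" and ne: "r2 13 \<noteq> 0 \<longleftrightarrow> near A B ?v \<noteq> {}"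
        and fr: "ready (r2, l2)" "r2 25 = ?v" "r2 27 = A" "r2 28 = B" "r2 10 = i" "r2 14 = r1 14"
          "l2 4 = l1 4" "l2 5 = l1 5" for r2 l2
    proof (cases "\<exists>u\<in>near A B ?v. l1 4 ! u \<noteq> 0")
      case True
      then have "r2 12 \<noteq> 0" "r2 13 \<noteq> 0" using hit ne by blast+
      then show ?thesis using greedy_skip[OF g True] fr by simp
    next
      case False
      then have "r2 12 = 0" using hit by blast
      let ?bad = "if near A B ?v = {} then 1 else r1 14"
      have "wp c (For 26 (V 2) (compare ;; When (V 29) (Update 4 (V 26) (Plus (V 10) (N 1)))))
         (\<lambda>t (r', l'). t \<le> ?T \<and> greedy A B (Suc i) (l' 4) (l' 5) (r' 14)) (r3, l2(5 := l1 5 @ [Suc i]))"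
        if "r3 14 = ?bad" "\<forall>x. x \<notin> {0, 14} \<longrightarrow> r3 x = r2 x" for r3
      proof (rule wp_frame[OF label[where v = ?v and i = i]], goal_cases)
        case (8 t r4 l4)
        have "greedy A B (Suc i) (l4 4) (l1 5 @ [Suc i]) ?bad"
          by (rule greedy_choose[OF g]) (use 8(1) False fr(7) in auto)
        with 8 that(1) show ?case by simp
      qed (use that fr r1 len cs_nth_less in \<open>auto simp: ready_def\<close>)
      note lab = this
      show ?thesis
      proof (cases "near A B ?v = {}")
        case True
        then have "r2 13 = 0" using ne by blast
        with \<open>r2 12 = 0\<close> fr show ?thesis
          by (simp del: One_nat_def add: Suc_eq_plus1[symmetric]) (rule wp_mono[OF lab], use True in auto)
      next
        case False
        then have "r2 13 \<noteq> 0" using ne by blast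
        with \<open>r2 12 = 0\<close> fr show ?thesis
          by (simp del: One_nat_def add: Suc_eq_plus1[symmetric]) (rule wp_mono[OF lab], use False in auto)
      qed
    qed
    show ?thesis
      unfolding wp_Then
      apply (simp add: r1 rd pos del: One_nat_def)
      apply (rule wp_frame[OF scan[where v = ?v]])
             apply (simp_all add: r1 len cs_nth_less del: One_nat_def wp_When)
       apply (use r1 in \<open>simp add: ready_def\<close>)
      subgoal for t r2 l2
        using rest[of r2 l2, unfolded wp_Then] r1(1)
        by (auto simp: ready_def r1 simp del: One_nat_def wp_When elim!: wp_mono)
      done
  qed
  have "wp c (For 10 (V 4)
        (Assign 25 (Idx 0 (Plus (Plus (V 3) (N 1)) (V 10))) ;;
         Assign 12 (N 0) ;; Assign 13 (N 0) ;;
         For 26 (V 2)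
           (compare ;; When (V 29) (Assign 13 (N 1) ;; When (Idx 4 (V 26)) (Assign 12 (N 1)))) ;;
         When (Minus (N 1) (V 13)) (Assign 14 (N 1)) ;;
         When (Minus (N 1) (V 12))
           (Push 5 (Plus (V 10) (N 1)) ;;
            For 26 (V 2) (compare ;; When (V 29) (Update 4 (V 26) (Plus (V 10) (N 1)))))))
     (\<lambda>t (r', l'). t + 3 * n + 5 \<le> choose_time sz \<and> greedy A B (length cs) (l' 4) (l' 5) (r' 14))
     (r(11 := n, 14 := 0), l(4 := map (\<lambda>_. 0) [0..<n], 5 := []))"
  proof (rule wp_For[where n = "length cs" and B = "2 * ?T + 10" and
      I = "\<lambda>i r' l'. greedy A B i (l' 4) (l' 5) (r' 14)"], goal_cases)
    case 5
    show ?case by (simp add: greedy_def)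
  next
    case (6 i r' l')
    have "ready (r', l')" "r' 27 = A" "r' 28 = B"
      using 6(4,5) assms by (simp_all add: ready_def)
    then show ?case using 6(1-3) by (intro wp_mono[OF body[where i = i]]) auto
  next
    case (7 t r' l')
    have "length cs * (2 * ?T + 10 + 2) + 2 + 3 * n + 5 \<le> sz * (2 * ?T + 10 + 2) + 2 + 3 * sz + 5"
      by (intro add_mono mult_le_mono1 mult_le_mono2 sz_bounds order_refl)
    also have "\<dots> \<le> choose_time sz" by (simp add: choose_time_def algebra_simps)
    finally show ?case using 7(1,2) by simp
  qed (use assms in \<open>auto simp: ready_def\<close>)
  then show ?thesis
    unfolding choose_balls_def wp_Then
    apply (simp add: del: One_nat_def)
    apply (rule wp_For_Push[where n = n and f = "\<lambda>_. 0"])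
        apply (use assms(1) in \<open>simp_all add: ready_def del: One_nat_def\<close>)
    apply (erule wp_mono)
    apply auto
    done
qed

end
subsection \<open>Querying the PCF solver\<close>

text \<open>Two passes are made for each label, first counting and then listing, because an encoded
  set starts with its length. Increasing order of facilities gives the sorted list that the encoding
  requires.\<close>

definition ask :: cmd where
  "ask =
     (Clear 2 ;; For 34 (V 3) (Push 2 (Idx 0 (V 34))) ;; Push 2 (Len 5) ;;
      For 15 (Len 5)
        (Assign 18 (Idx 5 (V 15)) ;; Assign 17 (N 0) ;;
         For 16 (V 2) (When (eq_exp (Idx 4 (V 16)) (V 18)) (Assign 17 (Plus (V 17) (N 1)))) ;;
         Push 2 (V 17) ;;
         For 16 (V 2) (When (eq_exp (Idx 4 (V 16)) (V 18)) (Push 2 (V 16)))) ;;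
      Call ;;
      Assign 19 (Idx 3 (N 0)))"

lemma mv_ask [simp]: "mv ask = {0, 15, 16, 17, 18, 19, 34}" "ml ask = {2, 3}"
  by (auto simp: ask_def)

text \<open>The copied prefix contributes at most \<open>s\<close> bits; there are at most
  \<open>s\<close> parts with at most \<open>s\<close> elements and a length field each, and every
  number is at most \<open>s\<close>.\<close>

definition query_size :: "nat \<Rightarrow> nat" where
  "query_size s = s + (1 + s * (s + 1)) * (s + 1)"

definition ask_time :: "nat poly \<Rightarrow> nat \<Rightarrow> nat" where
  "ask_time p s = 20 * (s + 1) * (s + 1) + 2 * poly p (query_size s) + query_size s + 20"

locale pcf_solver = supplier_instance +
  fixes c :: com and p :: "nat poly"
  assumes solver: "solves_in c p (pcf_problem rep)"
begin

definition part :: "nat list \<Rightarrow> nat \<Rightarrow> nat set" where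
  "part cls j = {u. u < n \<and> cls ! u = j}"

definition good :: "nat list \<Rightarrow> nat list \<Rightarrow> bool" where
  "good cls L \<longleftrightarrow> pcf \<F> (set (map (part cls) L))"

lemma enc_part: "enc_set (part cls j) =
  length (filter (\<lambda>u. cls ! u = j) [0..<n]) # filter (\<lambda>u. cls ! u = j) [0..<n]"
proof -
  let ?xs = "filter (\<lambda>u. cls ! u = j) [0..<n]"
  have "part cls j = set ?xs" by (auto simp: part_def)
  moreover have "sorted_list_of_set (set ?xs) = ?xs"
    by (rule sorted_list_of_set.idem_if_sorted_distinct) (simp_all add: sorted_wrt_filter)
  ultimately show ?thesis by (simp add: enc_set_def enc_list_def)
qed

lemma bit_size_query:
  assumes "length L \<le> sz"
  shows "bit_size (pre @ enc_sets (map (part cls) L)) \<le> query_size sz"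
proof -
  let ?q = "enc_sets (map (part cls) L)"
  have fl: "length (filter P [0..<n]) \<le> n" for P
    using length_filter_le[of P "[0..<n]"] by simp
  have "length (concat (map enc_set (map (part cls) L'))) \<le> length L' * (n + 1)" for L'
  proof (induction L')
    case (Cons j L')
    then show ?case using fl[of "\<lambda>u. cls ! u = j"] by (simp add: enc_part del: length_filter_le)
  qed simp
  then have "length ?q \<le> 1 + length L * (n + 1)" by (simp add: enc_sets_def)
  also have "\<dots> \<le> 1 + sz * (sz + 1)"
    using assms sz_bounds by (intro add_mono mult_mono) auto
  finally have len: "length ?q \<le> 1 + sz * (sz + 1)" .
  have "\<forall>x\<in>set ?q. x \<le> sz"
  proof
    fix x assume "x \<in> set ?q"
    then consider "x = length L" | j where "x \<in> set (enc_set (part cls j))"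
      by (auto simp: enc_sets_def)
    then show "x \<le> sz"
    proof cases
      case 2
      then have "x \<le> n" using fl by (auto simp: enc_part)
      then show ?thesis using sz_bounds(1) by simp
    qed (use assms in simp)
  qed
  from bit_size_le[OF this] have "bit_size ?q \<le> length ?q * (sz + 1)" .
  also have "\<dots> \<le> (1 + sz * (sz + 1)) * (sz + 1)"
    using len by (rule mult_le_mono1)
  finally have "bit_size ?q \<le> (1 + sz * (sz + 1)) * (sz + 1)" .
  moreover have "bit_size pre \<le> sz" by (simp add: sz_def input_def)
  ultimately show ?thesis by (simp add: query_size_def)
qed

text \<open>The solver's guarantee covers only repetition-free lists of parts. Parts of different
  labels are disjoint, so for distinct labels the premise on \<open>distinct\<close> amounts to at
  most one part being empty.\<close>

lemma wp_ask:
  assumes "ready (r, l)" "l 4 = cls" "l 5 = L" "length cls = n" "length L \<le> sz"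
    and distinct: "distinct (map (part cls) L)"
  shows "wp c ask (\<lambda>t (r', l'). t \<le> ask_time p sz \<and> r' 19 = (if good cls L then 1 else 0)) (r, l)"
proof -
  have rd: "l 0 = input" "r 2 = n" "r 3 = length pre" using assms(1) by (simp_all add: ready_def)
  have pre: "map ((!) input) [0..<length pre] = pre" "i < length pre \<Longrightarrow> i < length input" for i
    by (auto simp: input_def nth_append intro!: nth_equalityI)
  let ?P = "\<lambda>j u. cls ! u = j"
  let ?l1 = "l(2 := pre @ [length L])"
  have sets: "wp c (For 15 (Len 5)
        (Assign 18 (Idx 5 (V 15)) ;; Assign 17 (N 0) ;;
         For 16 (V 2) (When (eq_exp (Idx 4 (V 16)) (V 18)) (Assign 17 (Plus (V 17) (N 1)))) ;;
         Push 2 (V 17) ;;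
         For 16 (V 2) (When (eq_exp (Idx 4 (V 16)) (V 18)) (Push 2 (V 16)))))
     (\<lambda>t (r', l'). t \<le> sz * (10 * sz + 12) + 2 \<and> l' 2 = pre @ enc_sets (map (part cls) L)) (r(34 := length pre), ?l1)"
  proof (rule wp_For[where n = "length L" and B = "10 * n + 7 + 3" and
      I = "\<lambda>i r' l'. l' 2 = pre @ length L # concat (map (\<lambda>j. enc_set (part cls j)) (take i L))"], goal_cases)
    case (6 i r1 l1)
    have fr: "l1 4 = cls" "l1 5 = L" "r1 2 = n" using 6(4,5) assms rd by auto
    have count: "wp c (For 16 (V 2) (When (eq_exp (Idx 4 (V 16)) (V 18)) (Assign 17 (Plus (V 17) (N 1)))))
      (\<lambda>t (r', l'). t \<le> n * (3 + 2) + 2 \<and> r' 17 = length (filter (?P (L ! i)) [0..<n])) (r1(18 := L ! i, 17 := 0), l1)"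
    proof (rule wp_For[where n = n and B = 3 and I = "\<lambda>u r' l'. r' 17 = length (filter (?P (L ! i)) [0..<u])"], goal_cases)
      case (6 u r2 l2)
      then show ?case using fr assms(4) by auto
    qed (use fr in auto)
    have list: "wp c (For 16 (V 2) (When (eq_exp (Idx 4 (V 16)) (V 18)) (Push 2 (V 16))))
      (\<lambda>t (r', l'). t \<le> n * (3 + 2) + 2 \<and> l' 2 = l2 2 @ filter (?P (L ! i)) [0..<n]) (r2, l2)"
      if "r2 2 = n" "r2 18 = L ! i" "l2 4 = cls" for r2 l2
    proof (rule wp_For[where n = n and B = 3 and I = "\<lambda>u r' l'. l' 2 = l2 2 @ filter (?P (L ! i)) [0..<u]"], goal_cases)
      case (6 u r3 l3)
      then show ?case using that assms(4) by auto
    qed (use that in auto)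
    have tk: "take (Suc i) L = take i L @ [L ! i]" using 6(1) by (simp add: take_Suc_conv_app_nth)
    show ?case
      unfolding wp_Then
      apply (simp add: fr 6 del: One_nat_def)
      apply (rule wp_frame[OF count])
      apply (simp del: One_nat_def)
      apply (rule wp_frame[OF list])
      apply (use fr 6 in \<open>auto simp: tk enc_part\<close>)
      done
  next
    case (7 t r1 l1)
    have "length L * (10 * n + 7 + 3 + 2) \<le> sz * (10 * sz + 12)"
      using assms(5) sz_bounds(1) by (intro mult_mono) auto
    then show ?case using 7(1,2) by (simp add: enc_sets_def comp_def)
  qed (use assms in auto)
  let ?q = "pre @ enc_sets (map (part cls) L)"
  have call: "wp c Call (\<lambda>t (r', l'). t \<le> 2 * poly p (query_size sz) + query_size sz + 1 \<and>
      l' 3 = [if good cls L then 1 else 0]) (r1, l1)" if "l1 2 = ?q" for r1 l1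
  proof (rule wp_Call[OF solver, where Y = "{[if good cls L then 1 else 0]}"], goal_cases)
    case 1
    have "pairwise disjnt (set (map (part cls) L))"
      by (auto simp: pairwise_def disjnt_def part_def)
    then have "sub_partition {..<n} (set (map (part cls) L))"
      by (auto simp: sub_partition_def part_def)
    then show "(l1 2, {[if good cls L then 1 else 0]}) \<in> pcf_problem rep"
      using w distinct unfolding that pcf_problem_def good_def pre_def append_assoc by blast
  next
    case (2 ys t)
    moreover have "bit_size ?q \<le> query_size sz" using bit_size_query assms(5) .
    ultimately show ?case
      using poly_mono_nat[of "bit_size ?q" "query_size sz" p] length_le_bit_size[of ?q] that by auto
  qed
  define ans where "ans = (if good cls L then 1 else 0 :: nat)"
  have time: "1 + (t + (1 + (ta + (tb + 1)))) \<le> ask_time p sz"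
    if "t \<le> Suc (Suc (length pre * 3))" "ta \<le> Suc (Suc (sz * (10 * sz + 12)))"
      "tb \<le> 2 * poly p (query_size sz) + query_size sz + 1" for t ta tb
    using that sz_bounds(4) by (simp add: ask_time_def algebra_simps)
  show ?thesis
    unfolding ask_def wp_Then ans_def[symmetric]
    apply (simp add: rd assms del: One_nat_def)
    apply (rule wp_For_Push[where n = "length pre" and f = "(!) input"])
        apply (simp_all add: rd pre assms del: One_nat_def)
    apply (rule wp_mono[OF sets])
    apply (clarsimp simp del: One_nat_def)
    apply (rule wp_mono[OF call[folded ans_def]])
     apply assumption
    apply (clarsimp simp del: One_nat_def)
    apply (rule time)
      apply assumption+
    done
qed

end

subsection \<open>Self-reduction\<close>

text \<open>Each facility tentatively loses its label and regains it if PCF then answers no. One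
  pass suffices because a failed deletion stays impossible after further deletions, see
  \<open>good_mono\<close>.\<close>

definition shrink :: cmd where
  "shrink =
     For 35 (V 2) (When (Idx 4 (V 35))
       (Assign 36 (Idx 4 (V 35)) ;; Update 4 (V 35) (N 0) ;; ask ;;
        When (Minus (N 1) (V 19)) (Update 4 (V 35) (V 36))))"

lemma mv_shrink [simp]: "mv shrink = {0, 15, 16, 17, 18, 19, 34, 35, 36}" "ml shrink = {2, 3, 4}"
  by (auto simp: shrink_def)

definition shrink_time :: "nat poly \<Rightarrow> nat \<Rightarrow> nat" where
  "shrink_time p s = s * (ask_time p s + 10) + 2"

context pcf_solver
begin

lemma good_iff: "good cls L \<longleftrightarrow> (\<exists>S\<in>\<F>. \<forall>j\<in>set L. card (S \<inter> part cls j) = 1)"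
  by (simp add: good_def pcf_def)

lemma good_part_nonempty: "good cls L \<Longrightarrow> j \<in> set L \<Longrightarrow> part cls j \<noteq> {}"
  by (auto simp: good_iff)

text \<open>An exact choice for \<open>cls\<close> remains exact under additional labels once its
  elements unlabelled in \<open>cls\<close> are dropped, and down-closedness keeps it in the family.
  Read contrapositively, removing labels never turns a bad labelling good. Label 0 must not name a
  part, since it means unlabelled.\<close>

lemma good_mono:
  assumes "good cls L" "0 \<notin> set L" "\<And>u. u < n \<Longrightarrow> cls ! u \<noteq> 0 \<Longrightarrow> cls' ! u = cls ! u"
  shows "good cls' L"
proof -
  from assms(1) obtain S where S: "S \<in> \<F>" "\<And>j. j \<in> set L \<Longrightarrow> card (S \<inter> part cls j) = 1"
    by (auto simp: good_iff)
  let ?S = "{u \<in> S. cls ! u \<noteq> 0}"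
  have "?S \<inter> part cls' j = S \<inter> part cls j" if "j \<in> set L" for j
  proof -
    have "j \<noteq> 0" using that assms(2) by metis
    then show ?thesis using assms(3) by (auto simp: part_def)
  qed
  moreover have "?S \<in> \<F>" using S(1) by (rule subset_closed) auto
  ultimately show ?thesis
    unfolding good_iff using S(2) by (intro bexI[of _ ?S]) auto
qed

lemma distinct_parts:
  assumes "distinct L" "\<And>i j. i \<in> set L \<Longrightarrow> j \<in> set L \<Longrightarrow> part cls i = {} \<Longrightarrow> part cls j = {} \<Longrightarrow> i = j"
  shows "distinct (map (part cls) L)"
proof -
  have "inj_on (part cls) (set L)"
  proof (rule inj_onI)
    fix i j assume ij: "i \<in> set L" "j \<in> set L" "part cls i = part cls j"
    show "i = j"
    proof (rule ccontr)
      assume "i \<noteq> j"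
      then have "part cls i \<inter> part cls j = {}" by (auto simp: part_def)
      with ij \<open>i \<noteq> j\<close> assms(2) show False by auto
    qed
  qed
  with assms(1) show ?thesis by (simp add: distinct_map)
qed

text \<open>A labelled facility outside an exact choice \<open>S\<close> could be unlabelled without
  spoiling \<open>S\<close>, against minimality. So all labelled facilities lie in \<open>S\<close>,
  and down-closedness applies.\<close>

lemma minimal_good:
  assumes "good cls L" "length cls = n" "0 \<notin> set L"
    "\<And>u. u < n \<Longrightarrow> cls ! u \<noteq> 0 \<Longrightarrow> \<not> good (cls[u := 0]) L"
  shows "{u. u < n \<and> cls ! u \<noteq> 0} \<in> \<F>"
proof -
  from assms(1) obtain S where S: "S \<in> \<F>" "\<And>j. j \<in> set L \<Longrightarrow> card (S \<inter> part cls j) = 1"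
    by (auto simp: good_iff)
  have "u \<in> S" if u: "u < n" "cls ! u \<noteq> 0" for u
  proof (rule ccontr)
    assume "u \<notin> S"
    then have "cls[u := 0] ! x = cls ! x" if "x \<in> S" for x
      using that by (metis nth_list_update_neq)
    then have "S \<inter> part (cls[u := 0]) j = S \<inter> part cls j" for j
      by (auto simp: part_def)
    then have "good (cls[u := 0]) L" unfolding good_iff using S by (intro bexI[of _ S]) auto
    with assms(4)[OF u] show False by blast
  qed
  then show ?thesis using S(1) by (blast intro: subset_closed)
qed

lemma wp_shrink:
  assumes rl: "ready (r, l)" "l 4 = cls" "l 5 = L" "length cls = n" "length L \<le> sz"
    and L: "distinct L" "0 \<notin> set L" and good: "good cls L"
  shows "wp c shrink (\<lambda>t (r', l'). t \<le> shrink_time p sz \<and> {u. u < n \<and> l' 4 ! u \<noteq> 0} \<in> \<F> \<and> length (l' 4) = n \<and>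
     (\<forall>u<n. l' 4 ! u = 0 \<or> l' 4 ! u = cls ! u) \<and> (\<forall>j\<in>set L. part (l' 4) j \<noteq> {})) (r, l)"
  unfolding shrink_def
proof (rule wp_For[where n = n and B = "ask_time p sz + 6" and
    I = "\<lambda>i r' l'. length (l' 4) = n \<and> good (l' 4) L \<and> (\<forall>u<n. l' 4 ! u = 0 \<or> l' 4 ! u = cls ! u) \<and>
      (\<forall>u<i. l' 4 ! u \<noteq> 0 \<longrightarrow> \<not> good ((l' 4)[u := 0]) L)"], goal_cases)
  case (6 i r1 l1)
  let ?old = "l1 4" and ?new = "(l1 4)[i := 0]"
  have fr: "ready (r1, l1)" "l1 5 = L" using 6(4,5) rl by (simp_all add: ready_def)
  from 6(2) have inv: "length ?old = n" "good ?old L" "\<forall>u<n. ?old ! u = 0 \<or> ?old ! u = cls ! u"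
    "\<forall>u<i. ?old ! u \<noteq> 0 \<longrightarrow> \<not> good (?old[u := 0]) L" by blast+
  show ?case
  proof (cases "?old ! i = 0")
    case True
    then show ?thesis using 6(1,3) inv by (auto simp: less_Suc_eq)
  next
    case False
    \<comment> \<open>Deletions that failed earlier also fail after this one; otherwise
      \<open>good_mono\<close> would have made the earlier attempt succeed.\<close>
    have keep: "\<not> good (?new[u := 0]) L" if "u < i" "?new ! u \<noteq> 0" for u
    proof
      assume "good (?new[u := 0]) L"
      then have "good (?old[u := 0]) L"
        by (rule good_mono[OF _ L(2)]) (use inv(1) 6(1) that(1) in \<open>auto simp: nth_list_update split: if_splits\<close>)
      then show False using inv(4) that by auto
    qed
    have "distinct (map (part ?new) L)"
    proof (rule distinct_parts[OF L(1)])
      \<comment> \<open>Before the deletion all parts are nonempty, so only the part that loses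
        facility \<open>i\<close> can become empty; the query is therefore repetition-free.\<close>
      have "j = ?old ! i" if j: "j \<in> set L" "part ?new j = {}" for j
      proof (rule ccontr)
        assume "j \<noteq> ?old ! i"
        obtain x where x: "x < n" "?old ! x = j"
          using good_part_nonempty[OF inv(2) j(1)] by (auto simp: part_def)
        with \<open>j \<noteq> ?old ! i\<close> have "?new ! x = j" by (metis nth_list_update_neq)
        with x(1) have "part ?new j \<noteq> {}" by (auto simp: part_def)
        with j(2) show False by blast
      qed
      then show "j = j'" if "j \<in> set L" "j' \<in> set L" "part ?new j = {}" "part ?new j' = {}" for j j'
        using that by metis
    qed
    then have ask: "wp c ask (\<lambda>t (r', l'). t \<le> ask_time p sz \<and> r' 19 = (if good ?new L then 1 else 0))
      (r1(36 := ?old ! i), l1(4 := ?new))"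
      using fr inv(1) rl(5) by (intro wp_ask) (auto simp: ready_def)
    show ?thesis
      unfolding wp_When wp_Then
      using False 6(1,3) inv(1)
      apply simp
      apply (rule wp_frame[OF ask])
      using inv keep
      apply (auto simp: less_Suc_eq nth_list_update split: if_splits)
      done
  qed
next
  case (7 t r1 l1)
  have "n * (ask_time p sz + 6 + 2) \<le> sz * (ask_time p sz + 10)"
    by (rule mult_le_mono) (use sz_bounds(1) in auto)
  then have "n * (ask_time p sz + 6 + 2) + 2 \<le> shrink_time p sz" by (simp add: shrink_time_def)
  moreover have "{u. u < n \<and> l1 4 ! u \<noteq> 0} \<in> \<F>"
    using 7(2) L(2) by (intro minimal_good) auto
  ultimately show ?case using 7(1,2) good_part_nonempty by auto
qed (use rl good in \<open>auto simp: ready_def\<close>)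

end

subsection \<open>Trying all distances\<close>

text \<open>
  Registers \<open>39\<close> and \<open>40\<close> hold the least successful distance so far, initially \<open>1 / 0\<close>, and
  list \<open>8\<close> the corresponding solution.
\<close>

definition try_guess :: cmd where
  "try_guess =
     (Assign 25 (Idx 0 (Plus (Plus (V 3) (N 1)) (V 37))) ;; Assign 26 (V 38) ;;
      Assign 27 (V 39) ;; Assign 28 (V 40) ;;
      compare ;;
      When (V 29)
        (Assign 27 (V 30) ;; Assign 28 (V 31) ;;
         choose_balls ;;
         When (Minus (N 1) (V 14))
           (ask ;;
            When (V 19)
              (shrink ;;
               Clear 8 ;; For 41 (V 2) (When (Idx 4 (V 41)) (Push 8 (V 41))) ;;
               Assign 39 (V 27) ;; Assign 40 (V 28)))))"

definition supplier_via_pcf :: cmd where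
  "supplier_via_pcf =
     (Assign 2 (Idx 0 (Plus (Idx 0 (N 0)) (N 1))) ;;
      Assign 3 (Plus (Plus (Idx 0 (N 0)) (N 2)) (V 2)) ;;
      Assign 4 (Idx 0 (V 3)) ;;
      Assign 8 (Idx 0 (Plus (Plus (V 3) (N 1)) (V 4))) ;;
      Assign 9 (Plus (Plus (Plus (V 3) (N 2)) (V 4)) (V 8)) ;;
      Assign 39 (N 1) ;; Assign 40 (N 0) ;;
      For 37 (V 4) (For 38 (V 2) try_guess) ;;
      Clear 0 ;; For 41 (Len 8) (Push 0 (Idx 8 (V 41))))"

lemma mv_try_guess [simp]:
  "mv try_guess = {0, 10, 11, 12, 13, 14, 15, 16, 17, 18, 19, 20, 21, 22, 23, 24, 25, 26, 27, 28,
     29, 30, 31, 32, 33, 34, 35, 36, 39, 40, 41, 42}"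
  "ml try_guess = {2, 3, 4, 5, 6, 7, 8}"
  unfolding try_guess_def by auto

definition guess_time :: "nat poly \<Rightarrow> nat \<Rightarrow> nat" where
  "guess_time p s = (36 * s + 70) + choose_time s + ask_time p s + shrink_time p s + 5 * s + 30"

lemma finite_INF_attained:
  fixes f :: "'a \<Rightarrow> 'b :: complete_linorder"
  assumes "finite A" "A \<noteq> {}"
  obtains a where "a \<in> A" "(INF a\<in>A. f a) = f a"
proof -
  have "Min (f ` A) \<in> f ` A" using assms by (intro Min_in) auto
  moreover have "Min (f ` A) = (INF a\<in>A. f a)" using assms by (intro Min_Inf) auto
  ultimately show thesis using that by auto
qed

lemma finite_SUP_attained:
  fixes f :: "'a \<Rightarrow> 'b :: complete_linorder"
  assumes "finite A" "A \<noteq> {}"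
  obtains a where "a \<in> A" "(SUP a\<in>A. f a) = f a"
proof -
  have "Max (f ` A) \<in> f ` A" using assms by (intro Max_in) auto
  moreover have "Max (f ` A) = (SUP a\<in>A. f a)" using assms by (intro Max_Sup) auto
  ultimately show thesis using that by auto
qed

context pcf_solver
begin

definition feasible :: "rat \<Rightarrow> bool" where
  "feasible q \<longleftrightarrow> (\<exists>S\<in>\<F>. \<forall>v\<in>C. \<exists>u\<in>S. d v u \<le> q)"

text \<open>\<open>G\<close> is the set of guesses tried so far, and \<open>B = 0\<close> encodes
  that none has succeeded. The kept guess \<open>A / B\<close> need not be feasible: it only lies
  below every feasible guess in \<open>G\<close> and has a cover within three times itself.\<close>

definition best :: "nat \<Rightarrow> nat \<Rightarrow> nat list \<Rightarrow> (nat \<times> nat) set \<Rightarrow> bool" where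
  "best A B ys G \<longleftrightarrow> A < 2 ^ sz \<and> B < 2 ^ sz \<and> (B = 0 \<longrightarrow> A = 1) \<and> set ys \<in> \<F> \<and> length ys \<le> sz \<and>
     (B \<noteq> 0 \<longrightarrow> (\<forall>v\<in>C. \<exists>u\<in>set ys. d v u \<le> 3 * (of_nat A / of_nat B))) \<and>
     (\<forall>(v, u)\<in>G. feasible (d v u) \<longrightarrow> B \<noteq> 0 \<and> of_nat A / of_nat B \<le> d v u)"

lemma greedy_partD:
  assumes "greedy A B (length cs) cls L bad" "j \<in> set L"
  obtains v where "v \<in> C" "part cls j = near A B v"
  using assms unfolding greedy_def part_def by (metis nth_mem set_cs)

lemma greedy_labels:
  assumes "greedy A B (length cs) cls L bad"
  shows "length cls = n" "distinct L" "0 \<notin> set L" "length L \<le> sz"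
proof -
  show "length cls = n" "distinct L" using assms by (auto simp: greedy_def)
  have sub: "set L \<subseteq> Suc ` {..<length cs}" using assms unfolding greedy_def by blast
  then show "0 \<notin> set L" by auto
  have "length L = card (set L)" using \<open>distinct L\<close> by (simp add: distinct_card)
  also have "\<dots> \<le> card (Suc ` {..<length cs})" using sub by (intro card_mono) auto
  also have "\<dots> \<le> sz" using sz_bounds(3) by (simp add: card_image)
  finally show "length L \<le> sz" .
qed

lemma greedy_infeasible:
  assumes "greedy A B (length cs) cls L bad" "bad \<noteq> 0" "B > 0"
  shows "\<not> feasible (of_nat A / of_nat B)"
proof
  assume "feasible (of_nat A / of_nat B)"
  then obtain S where S: "S \<in> \<F>" "\<forall>v\<in>C. \<exists>u\<in>S. d v u \<le> of_nat A / of_nat B"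
    by (auto simp: feasible_def)
  from assms obtain i where i: "i < length cs" "near A B (cs ! i) = {}" by (auto simp: greedy_def)
  then obtain u where "u \<in> S" "d (cs ! i) u \<le> of_nat A / of_nat B"
    using S(2) nth_mem[OF i(1)] by auto
  then have "u \<in> near A B (cs ! i)" using subset_F[OF S(1)] assms(3) by (auto simp: near_iff)
  with i(2) show False by blast
qed

text \<open>A feasible \<open>S\<close> meets every chosen ball but possibly more than once; keeping
  one representative per ball makes it exact and, by down-closedness, leaves it in the
  family.\<close>

lemma greedy_good:
  assumes g: "greedy A B (length cs) cls L bad" and "B > 0" and feas: "feasible (of_nat A / of_nat B)"
  shows "good cls L"
proof -
  from feas obtain S where S: "S \<in> \<F>" "\<forall>v\<in>C. \<exists>u\<in>S. d v u \<le> of_nat A / of_nat B"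
    by (auto simp: feasible_def)
  have ex: "\<exists>u. u \<in> S \<and> u \<in> part cls j" if j: "j \<in> set L" for j
  proof -
    obtain v where v: "v \<in> C" "part cls j = near A B v" using greedy_partD[OF g j] .
    then obtain u where "u \<in> S" "d v u \<le> of_nat A / of_nat B" using S(2) by blast
    then show ?thesis using v(2) subset_F[OF S(1)] \<open>B > 0\<close> by (auto simp: near_iff)
  qed
  define h where "h j = (SOME u. u \<in> S \<and> u \<in> part cls j)" for j
  have h: "h j \<in> S" "h j \<in> part cls j" if "j \<in> set L" for j
    using someI_ex[OF ex[OF that]] by (simp_all add: h_def)
  have "h ` set L \<inter> part cls j = {h j}" if "j \<in> set L" for j
    using h that by (fastforce simp: part_def)
  moreover have "h ` set L \<in> \<F>" using S(1) by (rule subset_closed) (use h(1) in auto)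
  ultimately show ?thesis unfolding good_iff by (intro bexI[of _ "h ` set L"]) auto
qed

lemma greedy_covers:
  assumes g: "greedy A B (length cs) cls L bad" and "bad = 0" and "B > 0"
    and cls': "\<forall>u<n. cls' ! u = 0 \<or> cls' ! u = cls ! u" "\<forall>j\<in>set L. part cls' j \<noteq> {}"
    and v: "v \<in> C"
  shows "\<exists>u<n. cls' ! u \<noteq> 0 \<and> d v u \<le> 3 * (of_nat A / of_nat B)"
proof -
  let ?q = "rat_of_nat A / rat_of_nat B"
  obtain i where i: "i < length cs" "v = cs ! i" using v by (metis in_set_conv_nth set_cs)
  with g \<open>bad = 0\<close> obtain u where u: "u \<in> near A B v" "cls ! u \<noteq> 0" by (auto simp: greedy_def)
  then have "u < n" by (simp add: near_def)
  define j where "j = cls ! u"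
  have j: "j \<in> set L" using g u(2) \<open>u < n\<close> by (auto simp: greedy_def j_def)
  obtain v' where v': "v' \<in> C" "part cls j = near A B v'" using greedy_partD[OF g j] .
  obtain u' where u': "u' < n" "cls' ! u' = j" using cls'(2) j by (auto simp: part_def)
  then have "cls' ! u' \<noteq> 0" "cls ! u' = j"
    using greedy_labels(3)[OF g] j cls'(1) by metis+
  then have "u' \<in> near A B v'" "u \<in> near A B v'"
    using v'(2) u'(1) \<open>u < n\<close> by (auto simp: part_def j_def)
  then have "d v u \<le> ?q" "d v' u \<le> ?q" "d v' u' \<le> ?q"
    using u(1) \<open>B > 0\<close> by (simp_all add: near_iff)
  \<comment> \<open>The three legs: from client \<open>v\<close> to the facility \<open>u\<close>
    shared with a chosen ball, on to its centre \<open>v'\<close>, and out to the facility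
    \<open>u'\<close> that survived shrinking. Chosen clients need no separate treatment.\<close>
  moreover have "d v u' \<le> d v u + d u u'" "d u u' \<le> d u v' + d v' u'"
    using v v'(1) C_subset u'(1) \<open>u < n\<close> n_le_m by (auto intro!: d_triangle)
  ultimately have "d v u' \<le> 3 * ?q" using d_commute[of u v'] by simp
  then show ?thesis using u'(1) \<open>cls' ! u' \<noteq> 0\<close> by blast
qed

lemma best_infeasible: "best A B ys G \<Longrightarrow> \<not> feasible (d v u) \<Longrightarrow> best A B ys (insert (v, u) G)"
  by (simp add: best_def)

text \<open>The stored solution survives in three cases: the guess exceeds the kept one, some ball
  is empty, or PCF answers no. In the last two the guess is infeasible and demands nothing of
  \<open>best\<close>. Otherwise guess and solution are replaced.\<close>

lemma wp_try_guess:
  assumes rd: "ready (r, l)" and i: "r 37 = i" "i < length cs" and u: "r 38 = u" "u < n"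
    and b: "best (r 39) (r 40) (l 8) G"
  shows "wp c try_guess (\<lambda>t (r', l'). t \<le> guess_time p sz \<and>
    best (r' 39) (r' 40) (l' 8) (insert (cs ! i, u) G)) (r, l)"
proof -
  let ?v = "cs ! i" and ?A = "r 39" and ?B = "r 40"
  let ?n = "num ?v u" and ?d = "den ?v u"
  have v: "?v < m" "u < m" using cs_nth_less i u n_le_m by auto
  have dist: "d ?v u = of_nat ?n / of_nat ?d" "?d > 0" by (rule num_den)+
  have A: "?A < 2 ^ sz" "?B < 2 ^ sz" using b by (simp_all add: best_def)
  have regs: "l 0 = input" "r 2 = n" "r 3 = length pre" "length pre + 1 + i < length input"
    "input ! (length pre + 1 + i) = ?v"
    using rd input_nth(3,4)[OF i(2)] by (simp_all add: ready_def)
  have cmp: "?n * ?B \<le> ?A * ?d \<longleftrightarrow> ?B = 0 \<or> d ?v u \<le> of_nat ?A / of_nat ?B"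
    using near_iff[of ?B u ?A ?v] u(2) by (cases "?B = 0") (auto simp: near_def)
  have later: "best ?A ?B (l 8) (insert (?v, u) G)" if "\<not> ?n * ?B \<le> ?A * ?d"
    using b that unfolding cmp by (auto simp: best_def)
  have update: "wp c (shrink ;; Clear 8 ;; For 41 (V 2) (When (Idx 4 (V 41)) (Push 8 (V 41))) ;;
               Assign 39 (V 27) ;; Assign 40 (V 28))
      (\<lambda>t (r', l'). t \<le> shrink_time p sz + 5 * sz + 10 \<and> best (r' 39) (r' 40) (l' 8) (insert (?v, u) G)) (r1, l1)"
    if rd1: "ready (r1, l1)" and g: "greedy ?n ?d (length cs) (l1 4) (l1 5) 0" and good: "good (l1 4) (l1 5)"
      and r1: "r1 27 = ?n" "r1 28 = ?d" and le: "?n * ?B \<le> ?A * ?d" for r1 l1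
  proof -
    note lab = greedy_labels[OF g]
    have collect: "wp c (For 41 (V 2) (When (Idx 4 (V 41)) (Push 8 (V 41))))
      (\<lambda>t (r', l'). t \<le> n * (2 + 2) + 2 \<and> l' 8 = filter (\<lambda>x. l2 4 ! x \<noteq> 0) [0..<n]) (r2, l2(8 := []))"
      if "r2 2 = n" "length (l2 4) = n" for r2 l2
    proof (rule wp_For[where n = n and B = 2 and I = "\<lambda>i r' l'. l' 8 = filter (\<lambda>x. l2 4 ! x \<noteq> 0) [0..<i]"], goal_cases)
      case (6 i r3 l3)
      then show ?case using that by auto
    qed (use that in auto)
    have new: "best ?n ?d (filter (\<lambda>x. cls ! x \<noteq> 0) [0..<n]) (insert (?v, u) G)"
      if "{u. u < n \<and> cls ! u \<noteq> 0} \<in> \<F>" "\<forall>u<n. cls ! u = 0 \<or> cls ! u = l1 4 ! u" "\<forall>j\<in>set (l1 5). part cls j \<noteq> {}" for cls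
    proof -
      let ?ys = "filter (\<lambda>x. cls ! x \<noteq> 0) [0..<n]"
      have "set ?ys = {u. u < n \<and> cls ! u \<noteq> 0}" by auto
      then have "set ?ys \<in> \<F>" using that(1) by simp
      moreover have "length ?ys \<le> sz"
        using length_filter_le[of "\<lambda>x. cls ! x \<noteq> 0" "[0..<n]"] sz_bounds(1) by simp
      moreover have "\<exists>u\<in>set ?ys. d v u \<le> 3 * (of_nat ?n / of_nat ?d)" if "v \<in> C" for v
        using greedy_covers[OF g refl dist(2) \<open>\<forall>u<n. _\<close> \<open>\<forall>j\<in>_. _\<close> that] by auto
      \<comment> \<open>The new guess does not exceed the one it replaces, so it inherits the lower
        bound for earlier feasible guesses. With no previous success, no earlier guess was
        feasible.\<close>
      moreover have "of_nat ?n / of_nat ?d \<le> d v' u'" if "(v', u') \<in> G" "feasible (d v' u')" for v' u'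
        using b that le unfolding cmp dist(1) by (force simp: best_def)
      ultimately show ?thesis
        using dist sz_bounds(5,6)[OF v] unfolding best_def by auto
    qed
    show ?thesis
      unfolding wp_Then
      apply (rule wp_frame[OF wp_shrink[OF rd1 refl refl lab(1) lab(4) lab(2) lab(3) good]])
      apply (simp del: One_nat_def)
      apply (rule wp_frame[OF collect])
      apply (use rd1 in \<open>simp add: ready_def\<close>)
      apply simp
      apply (use new r1 sz_bounds(1) in \<open>auto\<close>)
      done
  qed
  let ?upd = "shrink ;; Clear 8 ;; For 41 (V 2) (When (Idx 4 (V 41)) (Push 8 (V 41))) ;;
               Assign 39 (V 27) ;; Assign 40 (V 28)"
  have query: "wp c (When (Minus (N 1) (V 14)) (ask ;; When (V 19) ?upd))
      (\<lambda>t (r', l'). t \<le> ask_time p sz + shrink_time p sz + 5 * sz + 15 \<and>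
        best (r' 39) (r' 40) (l' 8) (insert (?v, u) G)) (r1, l1)"
    if rd1: "ready (r1, l1)" and g: "greedy ?n ?d (length cs) (l1 4) (l1 5) (r1 14)"
      and r1: "r1 27 = ?n" "r1 28 = ?d" "r1 39 = ?A" "r1 40 = ?B" "l1 8 = l 8"
      and le: "?n * ?B \<le> ?A * ?d" for r1 l1
  proof (cases "r1 14 = 0")
    case False
    then have "best ?A ?B (l 8) (insert (?v, u) G)"
      using best_infeasible[OF b] greedy_infeasible[OF g False dist(2)] dist(1) by simp
    with False r1 show ?thesis by simp
  next
    case True
    note g0 = g[unfolded True] and lab = greedy_labels[OF g]
    have "part (l1 4) j \<noteq> {}" if "j \<in> set (l1 5)" for j
      using g0 that unfolding greedy_def part_def by (metis empty_iff)
    then have "distinct (map (part (l1 4)) (l1 5))"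
      by (intro distinct_parts lab(2)) auto
    then have "wp c ask (\<lambda>t. wp c (When (V 19) ?upd) (\<lambda>t' (r', l').
        1 + (t + t') \<le> ask_time p sz + shrink_time p sz + 5 * sz + 15 \<and>
        best (r' 39) (r' 40) (l' 8) (insert (?v, u) G))) (r1, l1)"
    proof (rule wp_frame[OF wp_ask[OF rd1 refl refl lab(1) lab(4)]], goal_cases)
      case (1 t r2 l2)
      have fr: "ready (r2, l2)" "l2 4 = l1 4" "l2 5 = l1 5" "r2 27 = ?n" "r2 28 = ?d" "r2 39 = ?A"
        "r2 40 = ?B" "l2 8 = l 8" using 1(2,3) rd1 r1 by (simp_all add: ready_def)
      show ?case
      proof (cases "good (l1 4) (l1 5)")
        case False
        then have "best ?A ?B (l 8) (insert (?v, u) G)"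
          using best_infeasible[OF b] greedy_good[OF g dist(2)] dist(1) by metis
        with False 1(1) fr show ?thesis by simp
      next
        case True
        then have "wp c ?upd (\<lambda>t (r', l'). t \<le> shrink_time p sz + 5 * sz + 10 \<and>
            best (r' 39) (r' 40) (l' 8) (insert (?v, u) G)) (r2, l2)"
          using fr g0 le by (intro update) auto
        with True 1(1) show ?thesis by (auto simp del: wp_Then elim!: wp_mono)
      qed
    qed
    with True show ?thesis by simp
  qed
  have tail: "wp c (When (V 29) (Assign 27 (V 30) ;; Assign 28 (V 31) ;; choose_balls ;;
         When (Minus (N 1) (V 14)) (ask ;; When (V 19) ?upd)))
      (\<lambda>t (r', l'). t \<le> choose_time sz + ask_time p sz + shrink_time p sz + 5 * sz + 20 \<and>
        best (r' 39) (r' 40) (l' 8) (insert (?v, u) G)) (r1, l1)"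
    if rd1: "ready (r1, l1)" and r1: "r1 30 = ?n" "r1 31 = ?d" "r1 39 = ?A" "r1 40 = ?B" "l1 8 = l 8"
      and iff: "r1 29 \<noteq> 0 \<longleftrightarrow> ?n * ?B \<le> ?A * ?d" for r1 l1
  proof (cases "?n * ?B \<le> ?A * ?d")
    case False
    then show ?thesis using later r1 iff by simp
  next
    case True
    have "wp c choose_balls (\<lambda>t. wp c (When (Minus (N 1) (V 14)) (ask ;; When (V 19) ?upd))
      (\<lambda>t' (r', l'). 3 + (t + t') \<le> choose_time sz + ask_time p sz + shrink_time p sz + 5 * sz + 20 \<and>
        best (r' 39) (r' 40) (l' 8) (insert (?v, u) G))) (r1(27 := ?n, 28 := ?d), l1)"
    proof (rule wp_frame[OF wp_choose_balls[where A = ?n and B = ?d]], goal_cases)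
      case (5 t r2 l2)
      have "wp c (When (Minus (N 1) (V 14)) (ask ;; When (V 19) ?upd))
        (\<lambda>t (r', l'). t \<le> ask_time p sz + shrink_time p sz + 5 * sz + 15 \<and>
          best (r' 39) (r' 40) (l' 8) (insert (?v, u) G)) (r2, l2)"
        using 5 rd1 r1 True by (intro query) (auto simp: ready_def)
      with 5(1) show ?case by (auto simp del: wp_Then wp_When elim!: wp_mono)
    qed (use rd1 r1 sz_bounds(6)[OF v] in \<open>auto simp: ready_def\<close>)
    with True r1 iff show ?thesis by (simp del: One_nat_def)
  qed
  show ?thesis
    unfolding try_guess_def wp_Then[of c "Assign x e" for x e] wp_Then[of c compare]
    apply (simp add: regs i u del: One_nat_def wp_Then wp_When)
    apply (rule wp_frame[OF wp_compare_points[where v = ?v and u = u]])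
    apply (use rd v A in \<open>simp_all add: ready_def del: One_nat_def wp_Then wp_When\<close>)
    apply (rule wp_mono[OF tail])
    apply (use rd in \<open>auto simp: ready_def guess_time_def\<close>)
    done
qed

lemma approx_solution_best:
  assumes b: "best A B ys (C \<times> {..<n})"
  shows "approx_solution 3 (\<lambda>x y. of_rat (d x y)) C \<F> (set ys)"
proof -
  let ?d = "\<lambda>x y. real_of_rat (d x y)"
  have "\<F> \<subseteq> Pow {..<n}" using subset_F by blast
  then have "finite \<F>" by (rule finite_subset) simp
  then obtain T where T: "T \<in> \<F>" "supplier_opt ?d C \<F> = supplier_cost ?d C T"
    unfolding supplier_opt_def using finite_INF_attained[OF _ nonempty] by blast
  have "finite T" using finite_subset[OF subset_F[OF T(1)]] by simp
  have "finite C" using finite_subset[OF C_subset] by simp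
  have "supplier_cost ?d C (set ys) \<le> 3 * supplier_cost ?d C T"
  \<comment> \<open>These are the cases in which OPT is not a client-facility distance: without
    clients every cost is 0, and an infinite optimum makes the claim trivial.\<close>
  proof (cases "C = {} \<or> supplier_cost ?d C T = top")
    case True
    then show ?thesis
    proof
      assume "C = {}"
      then show ?thesis by (simp add: supplier_cost_def bot_ennreal)
    qed (simp add: ennreal_mult_top)
  next
    case False
    have att: "\<exists>u\<in>T. set_distance ?d v T = ennreal (?d v u)" if "v \<in> C" for v
    proof -
      have "set_distance ?d v T \<le> supplier_cost ?d C T"
        unfolding supplier_cost_def using that by (rule SUP_upper)
      with False have "set_distance ?d v T \<noteq> top" by (auto simp: top_unique)
      then have "T \<noteq> {}" by (auto simp: set_distance_def)
      with \<open>finite T\<close> show ?thesis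
        unfolding set_distance_def using finite_INF_attained[of T "\<lambda>u. ennreal (?d v u)"] by blast
    qed
    obtain v0 where v0: "v0 \<in> C" "supplier_cost ?d C T = set_distance ?d v0 T"
      unfolding supplier_cost_def
      using finite_SUP_attained[of C "\<lambda>v. set_distance ?d v T"] \<open>finite C\<close> False by blast
    then obtain u0 where u0: "u0 \<in> T" "supplier_cost ?d C T = ennreal (?d v0 u0)"
      using att by metis
    have "\<exists>u\<in>T. d v u \<le> d v0 u0" if v: "v \<in> C" for v
    proof -
      obtain u where u: "u \<in> T" "set_distance ?d v T = ennreal (?d v u)" using att[OF v] by blast
      have "ennreal (?d v u) \<le> ennreal (?d v0 u0)"
        unfolding u(2)[symmetric] u0(2)[symmetric] supplier_cost_def using v by (rule SUP_upper)
      then have "d v u \<le> d v0 u0"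
        using d_nonneg[of v0 u0] by (simp add: of_rat_less_eq ennreal_le_iff)
      then show ?thesis using u(1) by blast
    qed
    \<comment> \<open>The optimum is the distance of its worst client to the nearest open facility,
      so OPT is itself among the guesses; hence the kept guess is at most OPT.\<close>
    then have "feasible (d v0 u0)" using T(1) by (auto simp: feasible_def)
    moreover have "(v0, u0) \<in> C \<times> {..<n}" using v0(1) u0(1) subset_F[OF T(1)] by auto
    ultimately have B: "B \<noteq> 0" "of_nat A / of_nat B \<le> d v0 u0" using b by (auto simp: best_def)
    have "set_distance ?d v (set ys) \<le> 3 * supplier_cost ?d C T" if v: "v \<in> C" for v
    proof -
      obtain u where u: "u \<in> set ys" "d v u \<le> 3 * (of_nat A / of_nat B)"
        using b B(1) v by (auto simp: best_def)
      then have "d v u \<le> 3 * d v0 u0" using B(2) by linarith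
      then have "?d v u \<le> 3 * ?d v0 u0"
        by (metis of_rat_less_eq of_rat_mult of_rat_numeral_eq)
      then have "ennreal (?d v u) \<le> ennreal (3 * ?d v0 u0)" by (rule ennreal_leI)
      also have "\<dots> = 3 * supplier_cost ?d C T"
        using d_nonneg[of v0 u0] by (simp add: u0(2) ennreal_mult)
      finally show ?thesis
        unfolding set_distance_def using u(1) by (meson INF_lower2)
    qed
    then show ?thesis unfolding supplier_cost_def[of ?d C "set ys"] by (rule SUP_least)
  qed
  then show ?thesis
    using b T(2) by (simp add: approx_solution_def best_def)
qed

lemma wp_supplier_via_pcf:
  "wp c supplier_via_pcf (\<lambda>t s. t + length (snd s 0) \<le> sz * (sz * (guess_time p sz + 2) + 4) + 4 * sz + 20 \<and>
     approx_solution 3 (\<lambda>x y. of_rat (d x y)) C \<F> (set (snd s 0))) (hinit input)"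
proof -
  have pre_eq: "pre = length w # w @ n # [0..<n]"
    by (simp add: pre_def enc_list_def enc_set_lessThan)
  have input_w: "input \<noteq> []" "input ! 0 = length w" "length w + 1 < length input" "input ! (length w + 1) = n"
    by (simp_all add: input_eq pre_eq nth_append)
  have len_pre: "Suc (Suc (length w + n)) = length pre" by (simp add: pre_eq)
  have input_m: "length pre + 1 + length cs < length input" "input ! (length pre + 1 + length cs) = m"
    using input_nth(5,6) by simp_all
  let ?G = "\<lambda>i. set (take i cs) \<times> {..<n}"
  have "wp c (For 37 (V 4) (For 38 (V 2) try_guess))
    (\<lambda>t (r', l'). t \<le> sz * (sz * (guess_time p sz + 2) + 4) + 2 \<and> best (r' 39) (r' 40) (l' 8) (C \<times> {..<n})) (r, l)"
    if rd: "ready (r, l)" and r: "r 39 = 1" "r 40 = 0" "l 8 = []" for r l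
  proof (rule wp_For[where n = "length cs" and B = "sz * (guess_time p sz + 2) + 2" and
      I = "\<lambda>i r' l'. best (r' 39) (r' 40) (l' 8) (?G i)"], goal_cases)
    case 5
    have "(1::nat) < 2 ^ sz" using sz_bounds(8) by (metis one_less_numeral_iff one_less_power semiring_norm(76) less_le_trans zero_less_one)
    \<comment> \<open>The initial solution is the empty set, in the family by nonemptiness and
      down-closedness. It is what the program returns if no guess succeeds.\<close>
    moreover have "{} \<in> \<F>" using nonempty subset_closed by blast
    ultimately show ?case using r by (simp add: best_def)
  next
    case (6 i r1 l1)
    have rd1: "ready (r1, l1)" using 6(4,5) rd by (simp add: ready_def)
    show ?case
    proof (rule wp_For[where n = n and B = "guess_time p sz" and
        I = "\<lambda>u r' l'. best (r' 39) (r' 40) (l' 8) (?G i \<union> {cs ! i} \<times> {..<u})"], goal_cases)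
      case (6 u r2 l2)
      have rd2: "ready (r2, l2)" "r2 37 = i" using 6(4,5) rd1 \<open>r1 37 = i\<close> by (simp_all add: ready_def)
      have "insert (cs ! i, u) (?G i \<union> {cs ! i} \<times> {..<u}) = ?G i \<union> {cs ! i} \<times> {..<Suc u}"
        by (auto simp: less_Suc_eq)
      then show ?case
        using wp_try_guess[OF rd2(1,2) \<open>i < length cs\<close> 6(3,1,2)]
        by (auto elim!: wp_mono)
    next
      case (7 t r2 l2)
      have "?G i \<union> {cs ! i} \<times> {..<n} = ?G (Suc i)"
        using \<open>i < length cs\<close> by (auto simp: take_Suc_conv_app_nth)
      moreover have "n * (guess_time p sz + 2) \<le> sz * (guess_time p sz + 2)"
        using sz_bounds(1) by (rule mult_le_mono1)
      ultimately show ?case using 7(1,2) by simp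
    qed (use 6 rd1 in \<open>auto simp: ready_def\<close>)
  next
    case (7 t r1 l1)
    have "length cs * (sz * (guess_time p sz + 2) + 2 + 2) \<le> sz * (sz * (guess_time p sz + 2) + 2 + 2)"
      using sz_bounds(3) by (rule mult_le_mono1)
    then show ?case using 7(1,2) by (simp add: algebra_simps)
  qed (use rd in \<open>auto simp: ready_def\<close>)
  note loop = this
  have time: "t + (1 + ta) + 7 + k \<le> sz * (sz * (guess_time p sz + 2) + 4) + 4 * sz + 20"
    if "t \<le> sz * (sz * (guess_time p sz + 2) + 4) + 2" "ta \<le> k * 3 + 2" "k \<le> sz" for t ta k
    using that by simp
  show ?thesis
    unfolding supplier_via_pcf_def hinit_def wp_Then
    apply (simp add: input_w len_pre input_nth input_m del: One_nat_def)
    apply (rule wp_mono[OF loop])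
        apply (simp_all add: ready_def del: One_nat_def)
    apply (clarsimp simp del: One_nat_def)
    subgoal premises prems for t r1 l1
    proof (rule wp_For_Push[where n = "length (l1 8)" and f = "(!) (l1 8)"], goal_cases)
      case (5 ta)
      have "approx_solution 3 (\<lambda>x y. of_rat (d x y)) C \<F> (set (l1 8))"
        using prems(2) by (rule approx_solution_best)
      moreover have "length (l1 8) \<le> sz" using prems(2) by (simp add: best_def)
      ultimately show ?case
        using time[of t ta "length (l1 8)"] prems(1) 5 by (simp add: map_nth algebra_simps)
    qed simp_all
    done
qed

end

lemma supplier_polytime_approx_if_pcf_polytime:
  assumes rep: "down_closed_rep rep" and pcf: "pcf_polytime rep"
  shows "supplier_polytime_approx 3 rep"
proof -
  obtain c p where c: "solves_in c p (pcf_problem rep)"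
    using pcf by (auto simp: pcf_polytime_def polytime_solvable_def solves_in_def)
  define f where "f s = s * (s * (guess_time p s + 2) + 4) + 4 * s + 20" for s
  have "poly_bounded f"
    unfolding f_def guess_time_def choose_time_def shrink_time_def ask_time_def query_size_def
    by (intro poly_bounded_add poly_bounded_mult poly_bounded_poly poly_bounded_const poly_bounded_id)
  then show ?thesis
    unfolding supplier_polytime_approx_def
  proof (rule polytime_solvableI[where C = supplier_via_pcf and c = c])
    fix xs Y
    assume "(xs, Y) \<in> supplier_problem 3 rep"
    then obtain w n \<F> m C d where
      xs: "xs = enc_list w @ enc_set {..<n} @ enc_set C @ enc_set {..<m} @ enc_matrix m d"
      and Y: "Y = {ys. approx_solution 3 (\<lambda>x y. of_rat (d x y)) C \<F> (set ys)}"
      and inst: "rep w = Some (n, \<F>)" "{..<n} \<union> C = {..<m}"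
        "Metric_space {..<m} (\<lambda>x y. of_rat (d x y))"
      unfolding supplier_problem_def by blast
    \<comment> \<open>The instance varies with the input, whereas \<open>c\<close> and
      \<open>p\<close> were fixed before; program and time bound are therefore uniform over all
      inputs.\<close>
    interpret pcf_solver rep w n \<F> m C d c p
      by (intro pcf_solver.intro supplier_instance.intro pcf_solver_axioms.intro) (fact rep inst c)+
    have "input = xs" by (simp add: xs input_def pre_def)
    then show "wp c supplier_via_pcf (\<lambda>t s. t + length (snd s 0) \<le> f (bit_size xs) \<and> snd s 0 \<in> Y) (hinit xs)"
      using wp_supplier_via_pcf by (simp add: f_def Y sz_def)
  qed
qed

text \<open>The dichotomy holds for each represented class of families separately. The negative half
  is the contrapositive of the reduction from PCF, applied to an arbitrary finite \<alpha>.\<close>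

theorem theorem7:
  fixes rep :: family_rep
  assumes "down_closed_rep rep"
  shows "(pcf_polytime rep \<longrightarrow> supplier_polytime_approx 3 rep) \<and>
    (\<not> pcf_polytime rep \<longrightarrow> \<not> (\<exists>\<alpha><\<infinity>. supplier_polytime_approx \<alpha> rep))"
  using supplier_polytime_approx_if_pcf_polytime pcf_polytime_if_supplier_polytime_approx assms
  by blast

end
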